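(* Let $N\ge1$, $T\ge1$, $0\le S_0\le T$ be integers and let $\epsilon=\{\epsilon_i\}$ be a finite or infinite sequence of $\pm1$'s with $0\le S_0+\sum_{i=1}^m\epsilon_i\le T$ for every $m$. Let $R_n$ be the $n$th correlation function of the point process $\mathbb M$ in $\mathbb Z^3$ generated by the Markov chain $\mathfrak M_{S_0,\epsilon}$ (see context). Let $(r_1,t_1,x_1),\dots,(r_n,t_n,x_n)$ be pairwise distinct points with $r_1\le r_2\le\dots\le r_n$, $t_1\ge t_2\ge\dots\ge t_n$, where the $r_i\geq 0$ are times of the chain, $0\le t_i\le T$ and $x_i\in\mathfrak X^{S(r_i),t_i}$. Then $$R_n(r_1,t_1,x_1;\dots;r_n,t_n,x_n)=\det\big[K(r_i,t_i,x_i;r_j,t_j,x_j)\big]_{i,j=1,\dots,n},$$ where $$K(r,t,x;r',t',x')=\sum_{i=0}^{N-1}\frac{1}{c_i^{r',t';r,t}}\Psi_i^{S(r),t}(x)\Psi_i^{S(r'),t'}(x')\quad\text{if } r\ge r',\ t\le t',$$ $$K(r,t,x;r',t',x')=-\sum_{i\ge N}c_i^{r,t;r',t'}\Psi_i^{S(r),t}(x)\Psi_i^{S(r'),t'}(x')\quad\text{if } r<r'\text{, or } r=r',\,t>t',$$ $$c_i^{r,t;r,t}=1,\qquad c_i^{r,t;r',t'}=\prod_{k=t'+1}^{t}c_{t-}^{S(r),k}(i)\prod_{k=r}^{r'-1}c_{S\epsilon_{k+1}}^{S(k),t}(i),$$ and $S\epsilon_{k+1}$ stands for $S+$ if $\epsilon_{k+1}=+1$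 and for $S-$ if $\epsilon_{k+1}=-1$.
   Context: Paths. For an integer $0\le S\le T$, $\Omega(N,T,S)$ is the set of families of $N$ non-intersecting lattice paths $\tau_1,\dots,\tau_N:\{0,\dots,T\}\to\mathbb Z$ with $\tau_i(0)=i-1$, $\tau_i(T)=S+i-1$, $\tau_i(t+1)-\tau_i(t)\in\{0,1\}$ and $\tau_1(t)<\dots<\tau_N(t)$ for all $t$; such a family is identified with $X=(X(0),\dots,X(T))$, $X(t)=(\tau_1(t),\dots,\tau_N(t))$. $\mu(N,T,S)$ is the uniform probability measure on $\Omega(N,T,S)$. For $0\le S,t\le T$, $\mathfrak X^{S,t}=\{x\in\mathbb Z:\max(0,t+S-T)\le x\le\min(t+N-1,S+N-1)\}$ and $\mathcal X^{S,t}=\{(x_1<\dots<x_N):x_i\in\mathfrak X^{S,t}\}$. $(a)_k=a(a+1)\cdots(a+k-1)$. Matrices. $P^{S,t}_{t+}$ ($0\le t\le T-1$; rows $\mathcal X^{S,t}$, columns $\mathcal X^{S,t+1}$) equals $\dfrac{\prod_{i<j}(y_j-y_i)\prod_{i:y_i=x_i+1}(N+S-x_i-1)\prod_{i:y_i=x_i}(x_i+T-t-S)}{(T-t)_N\prod_{i<j}(x_j-x_i)}$ if all $y_i-x_i\in\{0,1\}$, else $0$. $P^{S,t}_{S+}$ ($0\le S\le T-1$; rows $\mathcal X^{S,t}$, columns $\mathcal X^{S+1,t}$) equals $\dfrac{\prod_{i<j}(y_j-y_i)\prod_{i:y_i=x_i+1}(N+t-x_i-1)\prod_{i:y_i=x_i}(x_i+T-t-S)}{(T-S)_N\prod_{i<j}(x_j-x_i)}$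 if all $y_i-x_i\in\{0,1\}$, else $0$. $P^{S,t}_{S-}$ ($1\le S\le T$; rows $\mathcal X^{S,t}$, columns $\mathcal X^{S-1,t}$) equals $\dfrac{\prod_{i<j}(y_j-y_i)\prod_{i:y_i=x_i-1}x_i\prod_{i:y_i=x_i}(S+N-1-x_i)}{(S)_N\prod_{i<j}(x_j-x_i)}$ if all $y_i-x_i\in\{-1,0\}$, else $0$. Markov steps. For $X\in\Omega(N,T,S)$ and $Y\in\Omega(N,T,S\pm1)$, $$P^S_{S\mapsto S\pm1}(X,Y)=\prod_{t=0}^{T-1}\frac{P^{S\pm1,t}_{t+}(Y(t),Y(t+1))\,P^{S\pm1,t+1}_{S\mp}(Y(t+1),X(t+1))}{(P^{S\pm1,t}_{t+}P^{S\pm1,t+1}_{S\mp})(Y(t),X(t+1))}$$ if all denominators are positive, and $0$ otherwise. These are stochastic matrices mapping $\mu(N,T,S)$ to $\mu(N,T,S\pm1)$. Dynamics. $S(0)=S_0$, $S(r)=S_0+\sum_{i=1}^r\epsilon_i$. $\mathfrak M_{S_0,\epsilon}(r)$, $r=0,1,\dots$ (up to the length of $\epsilon$), is the Markov chain with $\mathfrak M_{S_0,\epsilon}(r)\in\Omega(N,T,S(r))$, initial distribution $\mu(N,T,S_0)$ and transition probability from time $r$ to $r+1$ equal to $P^{S(r)}_{S\mapsto S+1}$ if $\epsilon_{r+1}=1$ and $P^{S(r)}_{S\mapsto S-1}$ if $\epsilon_{r+1}=-1$. The random point configuration $\mathbb M$ in $\mathbb Z^3$ contains $(r,t,x)$ iff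 $x$ is one of the $N$ coordinates of $(\mathfrak M_{S_0,\epsilon}(r))(t)$. $R_n(r_1,t_1,x_1;\dots;r_n,t_n,x_n)$ is the probability that all the points $(r_i,t_i,x_i)$ belong to the configuration. Functions $\Psi$. On $\mathfrak X^{S,t}$ let $w^{S,t}(x)=\dfrac1{x!(t+N-1-x)!(S+N-1-x)!(T-t-S+x)!}$. For $0\le k<|\mathfrak X^{S,t}|$ let $p_k^{S,t}$ be the degree $k$ orthonormal polynomial (normalized Hahn polynomial) with respect to $w^{S,t}$ on $\mathfrak X^{S,t}$, with positive leading coefficient, and $\Psi_k^{S,t}(x)=p_k^{S,t}(x)\sqrt{w^{S,t}(x)}$. For $k\ge|\mathfrak X^{S,t}|$ set $\Psi^{S,t}_k=0$, so sums over $i\ge N$ are finite. Constants. $c^{S,t}_{t+}(i)=\sqrt{\left(1-\frac{i}{t+N}\right)\left(1-\frac{i}{T+N-t-1}\right)}$, $c^{S,t}_{t-}=c^{S,t-1}_{t+}$, $c^{S,t}_{S+}(i)=\sqrt{\left(1-\frac{i}{S+N}\right)\left(1-\frac{i}{T+N-S-1}\right)}$, $c^{S,t}_{S-}=c^{S-1,t}_{S+}$. (In a product $c_i^{r,t;r',t'}$ multiplying nonzero $\Psi_i^{S(r),t}$, $\Psi_i^{S(r'),t'}$, a factor with negative radicand can occur only together with a zero factor, and the product is then $0$.) *)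

theory Defs
  imports
    "HOL-Probability.Probability"
    "HOL-Library.Extended_Nat"
    "HOL-Computational_Algebra.Polynomial"
    "Jordan_Normal_Form.Determinant"
begin

text \<open>
  An \<open>N\<close>-tuple of integers is a list of length \<open>N\<close>, a family of paths is the list
  \<open>X(0), \<dots>, X(T)\<close> of such tuples.  Tuples are indexed from \<open>0\<close>: the path
  \<open>\<tau>\<^sub>i\<close> of the literature, \<open>1 \<le> i \<le> N\<close>, is \<open>t \<mapsto> X ! t ! (i - 1)\<close>, so that it starts at
  \<open>i - 1\<close> and ends at \<open>S + i - 1\<close>.
\<close>

definition \<Omega> :: "nat \<Rightarrow> nat \<Rightarrow> int \<Rightarrow> int list list set" where
  "\<Omega> N T S = {X. length X = T + 1
     \<and> (\<forall>t\<le>T. length (X ! t) = N \<and> sorted_wrt (<) (X ! t))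
     \<and> (\<forall>i<N. X ! 0 ! i = int i \<and> X ! T ! i = S + int i)
     \<and> (\<forall>t<T. \<forall>i<N. X ! (t + 1) ! i - X ! t ! i \<in> {0, 1})}"

definition points :: "nat \<Rightarrow> nat \<Rightarrow> int \<Rightarrow> nat \<Rightarrow> int set" where
  "points N T S t =
     {x. max 0 (int t + S - int T) \<le> x \<and> x \<le> min (int t + int N - 1) (S + int N - 1)}"

definition tuples :: "nat \<Rightarrow> nat \<Rightarrow> int \<Rightarrow> nat \<Rightarrow> int list set" where
  "tuples N T S t = {x. length x = N \<and> sorted_wrt (<) x \<and> set x \<subseteq> points N T S t}"


section \<open>One-step matrices\<close>

definition vandermonde :: "nat \<Rightarrow> int list \<Rightarrow> real" where
  "vandermonde N x = (\<Prod>j<N. \<Prod>i<j. real_of_int (x ! j - x ! i))"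

text \<open>
  The matrices are functions of a row index and a column index; they are only meant to be
  evaluated on the row and column sets named in the comments.
\<close>

\<comment> \<open>\<open>t < T\<close>; rows \<open>tuples N T S t\<close>, columns \<open>tuples N T S (t + 1)\<close>\<close>
definition P_t_plus :: "nat \<Rightarrow> nat \<Rightarrow> int \<Rightarrow> nat \<Rightarrow> int list \<Rightarrow> int list \<Rightarrow> real" where
  "P_t_plus N T S t x y =
     (if \<forall>i<N. y ! i - x ! i \<in> {0, 1}
      then vandermonde N y
           * (\<Prod>i | i < N \<and> y ! i = x ! i + 1. real_of_int (int N + S - x ! i - 1))
           * (\<Prod>i | i < N \<and> y ! i = x ! i. real_of_int (x ! i + int T - int t - S))
           / (pochhammer (real T - real t) N * vandermonde N x)
      else 0)"

\<comment> \<open>\<open>0 \<le> S < T\<close>; rows \<open>tuples N T S t\<close>, columns \<open>tuples N T (S + 1) t\<close>\<close>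
definition P_S_plus :: "nat \<Rightarrow> nat \<Rightarrow> int \<Rightarrow> nat \<Rightarrow> int list \<Rightarrow> int list \<Rightarrow> real" where
  "P_S_plus N T S t x y =
     (if \<forall>i<N. y ! i - x ! i \<in> {0, 1}
      then vandermonde N y
           * (\<Prod>i | i < N \<and> y ! i = x ! i + 1. real_of_int (int N + int t - x ! i - 1))
           * (\<Prod>i | i < N \<and> y ! i = x ! i. real_of_int (x ! i + int T - int t - S))
           / (pochhammer (real T - real_of_int S) N * vandermonde N x)
      else 0)"

\<comment> \<open>\<open>1 \<le> S \<le> T\<close>; rows \<open>tuples N T S t\<close>, columns \<open>tuples N T (S - 1) t\<close>\<close>
definition P_S_minus :: "nat \<Rightarrow> nat \<Rightarrow> int \<Rightarrow> nat \<Rightarrow> int list \<Rightarrow> int list \<Rightarrow> real" where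
  "P_S_minus N T S t x y =
     (if \<forall>i<N. y ! i - x ! i \<in> {-1, 0}
      then vandermonde N y
           * (\<Prod>i | i < N \<and> y ! i = x ! i - 1. real_of_int (x ! i))
           * (\<Prod>i | i < N \<and> y ! i = x ! i. real_of_int (S + int N - 1 - x ! i))
           / (pochhammer (real_of_int S) N * vandermonde N x)
      else 0)"

text \<open>The sign of a step \<open>S \<mapsto> S + e\<close> is an integer \<open>e \<in> {1, -1}\<close>.\<close>

definition P_S :: "int \<Rightarrow> nat \<Rightarrow> nat \<Rightarrow> int \<Rightarrow> nat \<Rightarrow> int list \<Rightarrow> int list \<Rightarrow> real" where
  "P_S e = (if e = 1 then P_S_plus else P_S_minus)"


section \<open>Markov steps on families of paths\<close>

\<comment> \<open>\<open>S' = S + e\<close> below; entry \<open>(x, y)\<close> of the matrix product of \<open>P_t_plus\<close> at \<open>(S', t)\<close>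
   with \<open>P_S (- e)\<close> at \<open>(S', t + 1)\<close>\<close>
definition step_denom ::
    "nat \<Rightarrow> nat \<Rightarrow> int \<Rightarrow> int \<Rightarrow> nat \<Rightarrow> int list \<Rightarrow> int list \<Rightarrow> real" where
  "step_denom N T S' e t x y =
     (\<Sum>z\<in>tuples N T S' (t + 1). P_t_plus N T S' t x z * P_S (- e) N T S' (t + 1) z y)"

definition step ::
    "nat \<Rightarrow> nat \<Rightarrow> int \<Rightarrow> int \<Rightarrow> int list list \<Rightarrow> int list list \<Rightarrow> real" where
  "step N T S e X Y =
     (if \<forall>t<T. step_denom N T (S + e) e t (Y ! t) (X ! (t + 1)) > 0
      then \<Prod>t<T. P_t_plus N T (S + e) t (Y ! t) (Y ! (t + 1))
                  * P_S (- e) N T (S + e) (t + 1) (Y ! (t + 1)) (X ! (t + 1))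
                  / step_denom N T (S + e) e t (Y ! t) (X ! (t + 1))
      else 0)"


section \<open>The Markov chain and its correlation functions\<close>

text \<open>
  A time-inhomogeneous Markov chain with times \<open>{k. enat k \<le> L}\<close>, at most countable state
  spaces \<open>E k\<close>, initial distribution \<open>init\<close> and transition probabilities \<open>p k\<close> from time
  \<open>k\<close> to time \<open>k + 1\<close>.
\<close>

definition markov_chain ::
    "'w measure \<Rightarrow> enat \<Rightarrow> (nat \<Rightarrow> 's set) \<Rightarrow> 's pmf \<Rightarrow> (nat \<Rightarrow> 's \<Rightarrow> 's \<Rightarrow> real)
      \<Rightarrow> (nat \<Rightarrow> 'w \<Rightarrow> 's) \<Rightarrow> bool" where
  "markov_chain Pr L E init p M \<longleftrightarrow>
     prob_space Pr
     \<and> (\<forall>k. enat k \<le> L \<longrightarrow>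
          M k \<in> measurable Pr (count_space UNIV) \<and> (\<forall>\<omega>\<in>space Pr. M k \<omega> \<in> E k))
     \<and> distr Pr (count_space UNIV) (M 0) = measure_pmf init
     \<and> (\<forall>k h. enat (Suc k) \<le> L \<longrightarrow> measure Pr {\<omega>\<in>space Pr. \<forall>j\<le>k. M j \<omega> = h j} > 0 \<longrightarrow>
          (\<forall>y\<in>E (Suc k).
             cond_prob Pr (\<lambda>\<omega>. M (Suc k) \<omega> = y) (\<lambda>\<omega>. \<forall>j\<le>k. M j \<omega> = h j) = p k (h k) y))"

text \<open>
  The sequence \<open>\<epsilon>\<close> is indexed from \<open>1\<close> and has length \<open>L\<close>, which may be \<open>\<infinity>\<close>; values
  \<open>\<epsilon> i\<close> with \<open>i = 0\<close> or \<open>i > L\<close> are irrelevant.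
\<close>

definition S_at :: "int \<Rightarrow> (nat \<Rightarrow> int) \<Rightarrow> nat \<Rightarrow> int" where
  "S_at S0 \<epsilon> r = S0 + (\<Sum>i=1..r. \<epsilon> i)"

definition path_chain ::
    "'w measure \<Rightarrow> nat \<Rightarrow> nat \<Rightarrow> int \<Rightarrow> (nat \<Rightarrow> int) \<Rightarrow> enat \<Rightarrow> (nat \<Rightarrow> 'w \<Rightarrow> int list list) \<Rightarrow> bool" where
  "path_chain Pr N T S0 \<epsilon> L M \<longleftrightarrow>
     markov_chain Pr L (\<lambda>r. \<Omega> N T (S_at S0 \<epsilon> r)) (pmf_of_set (\<Omega> N T S0))
       (\<lambda>r. step N T (S_at S0 \<epsilon> r) (\<epsilon> (r + 1))) M"

\<comment> \<open>the coordinates \<open>r\<close> and \<open>t\<close> of a point are never negative, hence of type \<open>nat\<close>\<close>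
definition configuration ::
    "nat \<Rightarrow> enat \<Rightarrow> (nat \<Rightarrow> 'w \<Rightarrow> int list list) \<Rightarrow> 'w \<Rightarrow> (nat \<times> nat \<times> int) set" where
  "configuration T L M \<omega> = {(r, t, x). enat r \<le> L \<and> t \<le> T \<and> x \<in> set (M r \<omega> ! t)}"

definition correlation ::
    "'w measure \<Rightarrow> ('w \<Rightarrow> 'b set) \<Rightarrow> nat \<Rightarrow> (nat \<Rightarrow> 'b) \<Rightarrow> real" where
  "correlation Pr C n q = measure Pr {\<omega>\<in>space Pr. \<forall>i<n. q i \<in> C \<omega>}"


section \<open>Normalized Hahn polynomials and the kernel\<close>

definition weight :: "nat \<Rightarrow> nat \<Rightarrow> int \<Rightarrow> nat \<Rightarrow> int \<Rightarrow> real" where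
  "weight N T S t x =
     1 / (fact (nat x) * fact (nat (int t + int N - 1 - x)) * fact (nat (S + int N - 1 - x))
          * fact (nat (int T - int t - S + x)))"

\<comment> \<open>for \<open>k < card (points N T S t)\<close> there is exactly one such polynomial\<close>
definition hahn :: "nat \<Rightarrow> nat \<Rightarrow> int \<Rightarrow> nat \<Rightarrow> nat \<Rightarrow> real poly" where
  "hahn N T S t k = (THE p. degree p = k \<and> lead_coeff p > 0
     \<and> (\<forall>q. degree q < k \<longrightarrow>
          (\<Sum>x\<in>points N T S t. poly p (of_int x) * poly q (of_int x) * weight N T S t x) = 0)
     \<and> (\<Sum>x\<in>points N T S t. (poly p (of_int x))\<^sup>2 * weight N T S t x) = 1)"

definition \<Psi> :: "nat \<Rightarrow> nat \<Rightarrow> int \<Rightarrow> nat \<Rightarrow> nat \<Rightarrow> int \<Rightarrow> real" where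
  "\<Psi> N T S t k x =
     (if k < card (points N T S t)
      then poly (hahn N T S t k) (of_int x) * sqrt (weight N T S t x) else 0)"

text \<open>
  The library's \<open>sqrt\<close> is an odd function on all of the reals.  A negative radicand occurs in
  a term of the kernel only together with a vanishing factor, so this is immaterial.
\<close>

definition c_t_plus :: "nat \<Rightarrow> nat \<Rightarrow> int \<Rightarrow> nat \<Rightarrow> nat \<Rightarrow> real" where
  "c_t_plus N T S t i =
     sqrt ((1 - real i / (real t + real N)) * (1 - real i / (real T + real N - real t - 1)))"

\<comment> \<open>used for \<open>t \<ge> 1\<close> only\<close>
definition c_t_minus :: "nat \<Rightarrow> nat \<Rightarrow> int \<Rightarrow> nat \<Rightarrow> nat \<Rightarrow> real" where
  "c_t_minus N T S t = c_t_plus N T S (t - 1)"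

definition c_S_plus :: "nat \<Rightarrow> nat \<Rightarrow> int \<Rightarrow> nat \<Rightarrow> nat \<Rightarrow> real" where
  "c_S_plus N T S t i =
     sqrt ((1 - real i / (real_of_int S + real N))
         * (1 - real i / (real T + real N - real_of_int S - 1)))"

definition c_S_minus :: "nat \<Rightarrow> nat \<Rightarrow> int \<Rightarrow> nat \<Rightarrow> nat \<Rightarrow> real" where
  "c_S_minus N T S t = c_S_plus N T (S - 1) t"

definition c_S :: "int \<Rightarrow> nat \<Rightarrow> nat \<Rightarrow> int \<Rightarrow> nat \<Rightarrow> nat \<Rightarrow> real" where
  "c_S e = (if e = 1 then c_S_plus else c_S_minus)"

definition c_coeff ::
    "nat \<Rightarrow> nat \<Rightarrow> int \<Rightarrow> (nat \<Rightarrow> int) \<Rightarrow> nat \<Rightarrow> nat \<times> nat \<Rightarrow> nat \<times> nat \<Rightarrow> real" where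
  "c_coeff N T S0 \<epsilon> i = (\<lambda>(r, t) (r', t').
     (\<Prod>k=t'+1..t. c_t_minus N T (S_at S0 \<epsilon> r) k i)
     * (\<Prod>k=r..<r'. c_S (\<epsilon> (k + 1)) N T (S_at S0 \<epsilon> k) t i))"

text \<open>
  The sum over \<open>i \<ge> N\<close> has only finitely many nonzero terms.  The kernel is not defined for
  \<open>r > r'\<close>, \<open>t > t'\<close>.
\<close>

definition kernel ::
    "nat \<Rightarrow> nat \<Rightarrow> int \<Rightarrow> (nat \<Rightarrow> int) \<Rightarrow> nat \<times> nat \<times> int \<Rightarrow> nat \<times> nat \<times> int \<Rightarrow> real" where
  "kernel N T S0 \<epsilon> = (\<lambda>(r, t, x) (r', t', x').
     if r \<ge> r' \<and> t \<le> t' then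
       (\<Sum>i<N. 1 / c_coeff N T S0 \<epsilon> i (r', t') (r, t)
                * \<Psi> N T (S_at S0 \<epsilon> r) t i x * \<Psi> N T (S_at S0 \<epsilon> r') t' i x')
     else if r < r' \<or> r = r' \<and> t > t' then
       - (\<Sum>\<^sub>\<infinity>i\<in>{N..}. c_coeff N T S0 \<epsilon> i (r, t) (r', t')
                * \<Psi> N T (S_at S0 \<epsilon> r) t i x * \<Psi> N T (S_at S0 \<epsilon> r') t' i x')
     else undefined)"

end

theory Submission
  imports Defs
begin

text \<open>
  Let \<open>q\<^sub>1, \<dots>, q\<^sub>n\<close> be the points.  Order the vertices \<open>(r, t)\<close> along a lattice walk from \<open>(0, T)\<close>
  to \<open>(R, 0)\<close> through all \<open>(r\<^sub>i, t\<^sub>i)\<close>.  The matrices \<open>P\<^sub>t\<^sub>+\<close> and \<open>P\<^sub>S\<^sub>\<plusminus>\<close> commute, hence the denominators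
  of the Markov step telescope, and the expectation of a product of functions of the slices at the
  vertices is obtained by applying \<open>P\<^sub>t\<^sub>+\<close> (for \<open>t + 1 \<rightarrow> t\<close>) and \<open>P\<^sub>S\<^sub>\<mp>\<close> (for \<open>S \<rightarrow> S \<plusminus> 1\<close>) along the walk to
  the constant \<open>1\<close>, multiplying by the function of each vertex.

  These matrices map \<open>det [g\<^sub>k(x\<^sub>i)] / V(x)\<close>, with \<open>V\<close> the Vandermonde determinant, to a determinant of
  the same form, where each \<open>g\<^sub>k\<close> is replaced by its image under a first order difference operator;
  the operators are diagonal on the normalized Hahn polynomials, with the numbers \<open>c\<close> as eigenvalues
  up to a common factor.  For the function \<open>\<Prod>\<^sub>i (1 - z\<^sub>i 1[q\<^sub>i is occupied])\<close> every point adds a rank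
  one perturbation, and a Schur complement turns the resulting \<open>N \<times> N\<close> determinant into
  \<open>det [\<delta>\<^sub>i\<^sub>j - z\<^sub>i K(q\<^sub>i, q\<^sub>j)]\<close>.  Inclusion--exclusion over \<open>z \<in> {0, 1}\<^sup>n\<close> yields \<open>det K\<close>.
\<close>

section \<open>Determinants\<close>

text \<open>Unperturbed, the N functions would stay multiples of Hahn polynomials of degree < N.
  Removing a point from one of them subtracts a multiple of a point mass, whose expansion involves
  all indices k: this is the origin of the sum over i >= N in the kernel. The obstacle is that the
  number of indices at a vertex, N + min(S, t, T - S, T - t), varies along the walk, and the
  eigenvalue relation fails where an index reappears after having been lost. It is therefore proved
  only after multiplication by the coefficient c accumulated since the index came into play, which
  vanishes in the bad cases (\<open>Hop_H'\<close>). At the end of the walk t = 0, so exactly N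
  indices are left and the functions form an N x N system. The normalization is never computed:
  every step contributes a constant free of z, and z = 0 identifies their product through the total
  mass 1.\<close>

definition detf :: "nat \<Rightarrow> (nat \<Rightarrow> nat \<Rightarrow> 'a::comm_ring_1) \<Rightarrow> 'a" where
  "detf n f = Determinant.det (Matrix.mat n n (\<lambda>(i, j). f i j))"

lemma detf_leibniz:
  "detf n f = (\<Sum>p | p permutes {0..<n}. signof p * (\<Prod>i = 0..<n. f i (p i)))"
proof -
  have "(\<Prod>i = 0..<n. Matrix.mat n n (\<lambda>(i, j). f i j) $$ (i, p i)) = (\<Prod>i = 0..<n. f i (p i))"
    if "p permutes {0..<n}" for p
    by (rule prod.cong) (use permutes_in_image[OF that] in auto)
  then show ?thesis
    unfolding detf_def by (subst det_def'[where n = n]) (auto intro!: sum.cong)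
qed

lemma detf_cong: "(\<And>i j. i < n \<Longrightarrow> j < n \<Longrightarrow> f i j = g i j) \<Longrightarrow> detf n f = detf n g"
  unfolding detf_def by (rule arg_cong[where f = Determinant.det]) (auto intro!: eq_matI)

text \<open>Multilinearity in all rows at once: \<open>h\<close> selects one summand per row. In
  \<open>sum_jump_slater\<close> it is a choice of destinations for the particles.\<close>

lemma detf_sum_rows:
  assumes "\<And>i. i < n \<Longrightarrow> finite (Y i)"
  shows "detf n (\<lambda>i k. \<Sum>y\<in>Y i. f i y k)
    = (\<Sum>h\<in>PiE {0..<n} Y. detf n (\<lambda>i k. f i (h i) k))"
proof -
  have "detf n (\<lambda>i k. \<Sum>y\<in>Y i. f i y k)
      = (\<Sum>p | p permutes {0..<n}. \<Sum>h\<in>PiE {0..<n} Y. signof p * (\<Prod>i = 0..<n. f i (h i) (p i)))"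
    unfolding detf_leibniz
    by (intro sum.cong refl, subst prod_sum_PiE) (use assms in \<open>auto simp: sum_distrib_left\<close>)
  then show ?thesis
    unfolding detf_leibniz by (subst sum.swap) simp
qed

lemma detf_scale_rows: "detf n (\<lambda>i j. c i * f i j) = (\<Prod>i<n. c i) * detf n f"
  unfolding detf_leibniz
  by (simp add: sum_distrib_left prod.distrib mult_ac lessThan_atLeast0)

lemma detf_transpose: "detf n (\<lambda>i j. f j i) = detf n f"
proof -
  have "Matrix.mat n n (\<lambda>(i, j). f j i) = transpose_mat (Matrix.mat n n (\<lambda>(i, j). f i j))"
    by (auto intro!: eq_matI)
  then show ?thesis
    unfolding detf_def using det_transpose[of "Matrix.mat n n (\<lambda>(i, j). f i j)" n] by simp
qed

lemma detf_scale: "detf n (\<lambda>i j. c * f i j) = c ^ n * detf n f"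
  using detf_scale_rows[of n "\<lambda>_. c" f] by simp

lemma detf_identical_rows:
  assumes "i < n" "j < n" "i \<noteq> j" "\<And>k. k < n \<Longrightarrow> f i k = f j k"
  shows "detf n f = 0"
  unfolding detf_def
  by (rule det_identical_rows[of _ n i j]) (use assms in \<open>auto intro!: eq_vecI\<close>)

lemma detf_zero_row:
  assumes "i < n" "\<And>k. k < n \<Longrightarrow> f i k = 0"
  shows "detf n f = 0"
proof -
  have "(\<Prod>i = 0..<n. f i (p i)) = 0" if "p permutes {0..<n}" for p
    using assms permutes_in_image[OF that, of i] by (intro prod_zero bexI[of _ i]) auto
  then show ?thesis
    unfolding detf_leibniz by simp
qed

lemma detf_mult: "detf n (\<lambda>i k. \<Sum>l<n. f i l * g l k) = detf n f * detf n g"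
proof -
  have "Matrix.mat n n (\<lambda>(i, k). \<Sum>l<n. f i l * g l k)
      = Matrix.mat n n (\<lambda>(i, j). f i j) * Matrix.mat n n (\<lambda>(i, j). g i j)"
    by (auto intro!: eq_matI simp: scalar_prod_def lessThan_atLeast0)
  then show ?thesis
    unfolding detf_def by (simp add: det_mult[of _ n])
qed

lemma detf_upper_triangular:
  assumes "\<And>i j. j < i \<Longrightarrow> i < n \<Longrightarrow> f i j = 0"
  shows "detf n f = (\<Prod>i<n. f i i)"
proof -
  have "detf n f = prod_list (diag_mat (Matrix.mat n n (\<lambda>(i, j). f i j)))"
    unfolding detf_def
    by (rule det_upper_triangular[where n = n]) (use assms in \<open>auto simp: upper_triangular_def\<close>)
  also have "\<dots> = (\<Prod>i<n. f i i)"
    by (simp add: prod_list_diag_prod lessThan_atLeast0)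
  finally show ?thesis .
qed

lemma detf_lower_triangular:
  assumes "\<And>i j. i < j \<Longrightarrow> j < n \<Longrightarrow> f i j = 0"
  shows "detf n f = (\<Prod>i<n. f i i)"
  using detf_upper_triangular[of n "\<lambda>i j. f j i"] assms by (simp add: detf_transpose[of n f])

lemma detf_diagonal: "detf n (\<lambda>i j. if i = j then d i else 0) = (\<Prod>i<n. d i)"
  by (subst detf_upper_triangular) auto

text \<open>The matrix of values factors through the coefficient matrix, which is triangular.\<close>

lemma detf_poly_powers:
  fixes q :: "nat \<Rightarrow> 'a::comm_ring_1 poly"
  assumes "\<And>k. k < n \<Longrightarrow> degree (q k) \<le> k"
  shows "detf n (\<lambda>i k. poly (q k) (x i)) = detf n (\<lambda>i k. x i ^ k) * (\<Prod>k<n. coeff (q k) k)"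
proof -
  have "detf n (\<lambda>i k. poly (q k) (x i)) = detf n (\<lambda>i k. \<Sum>l<n. x i ^ l * coeff (q k) l)"
  proof (rule detf_cong)
    fix i k assume k: "i < n" "k < n"
    have "poly (q k) (x i) = (\<Sum>l\<le>degree (q k). coeff (q k) l * x i ^ l)"
      by (rule poly_altdef)
    also have "\<dots> = (\<Sum>l<n. coeff (q k) l * x i ^ l)"
      using assms[of k] k by (intro sum.mono_neutral_left) (auto simp: coeff_eq_0)
    finally show "poly (q k) (x i) = (\<Sum>l<n. x i ^ l * coeff (q k) l)"
      by (simp add: mult.commute)
  qed
  also have "\<dots> = detf n (\<lambda>i k. x i ^ k) * detf n (\<lambda>l k. coeff (q k) l)"
    by (rule detf_mult)
  also have "detf n (\<lambda>l k. coeff (q k) l) = (\<Prod>k<n. coeff (q k) k)"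
    by (rule detf_upper_triangular) (metis assms coeff_eq_0 le_less_trans less_trans)
  finally show ?thesis .
qed

text \<open>In the Newton basis the Vandermonde matrix is triangular.\<close>

lemma detf_powers:
  fixes x :: "nat \<Rightarrow> 'a::idom"
  shows "detf n (\<lambda>i k. x i ^ k) = (\<Prod>j<n. \<Prod>i<j. x j - x i)"
proof -
  define q where "q k = (\<Prod>j<k. [:- x j, 1:])" for k
  have deg: "degree (q k) = k" for k
    unfolding q_def by (simp add: degree_prod_eq_sum_degree)
  have lead: "lead_coeff (q k) = 1" for k
    unfolding q_def lead_coeff_prod by simp
  have "detf n (\<lambda>i k. poly (q k) (x i)) = (\<Prod>j<n. poly (q j) (x j))"
    by (rule detf_lower_triangular) (auto simp: q_def poly_prod intro!: prod_zero)
  moreover have "detf n (\<lambda>i k. poly (q k) (x i))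
      = detf n (\<lambda>i k. x i ^ k) * (\<Prod>k<n. coeff (q k) k)"
    by (rule detf_poly_powers) (simp add: deg)
  moreover have "coeff (q k) k = 1" for k
    using deg[of k] lead[of k] by simp
  ultimately show ?thesis
    by (simp add: q_def poly_prod)
qed

text \<open>With \<open>U = Y G\<close>, both sides are the determinant of the block matrix \<open>(B, U; V, G)\<close>,
  \<open>B\<close> being the diagonal matrix of \<open>b\<close>, reduced by block row and by block column operations.\<close>

lemma detf_schur:
  fixes b :: "nat \<Rightarrow> 'a::field"
  assumes b: "\<And>k. k < N \<Longrightarrow> b k \<noteq> 0"
    and G0: "\<And>i j. j < i \<Longrightarrow> i < n \<Longrightarrow> G i j = 0" and G1: "\<And>i. i < n \<Longrightarrow> G i i = 1"
    and U: "\<And>k j. k < N \<Longrightarrow> j < n \<Longrightarrow> U k j = (\<Sum>i<n. Y k i * G i j)"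
  shows "detf N (\<lambda>k l. (if k = l then b k else 0) - (\<Sum>i<n. Y k i * V i l))
    = (\<Prod>k<N. b k) * detf n (\<lambda>i j. G i j - (\<Sum>k<N. V i k * U k j / b k))"
proof -
  let ?M = "\<lambda>p q f. Matrix.mat p q (\<lambda>(i, j). f i j)"
  define MB MU MV MG MY where
    "MB = ?M N N (\<lambda>k l. if k = l then b k else 0)" and "MU = ?M N n U"
    and "MV = ?M n N V" and "MG = ?M n n G" and "MY = ?M N n (\<lambda>k i. - Y k i)"
  define MW where "MW = ?M N n (\<lambda>k j. - (U k j / b k))"
  note defs = MB_def MU_def MV_def MG_def MY_def MW_def
  let ?X = "four_block_mat MB MU MV MG"
  have car: "MB \<in> carrier_mat N N" "MU \<in> carrier_mat N n" "MV \<in> carrier_mat n N"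
      "MG \<in> carrier_mat n n" "MY \<in> carrier_mat N n" "MW \<in> carrier_mat N n"
    by (auto simp: defs)
  have Xc: "?X \<in> carrier_mat (N + n) (N + n)"
    using car by auto
  have unit: "Determinant.det (four_block_mat (1\<^sub>m N) Z (0\<^sub>m n N) (1\<^sub>m n)) = 1"
    if "Z \<in> carrier_mat N n" for Z :: "'a mat"
    by (subst det_four_block_mat_lower_left_zero[where n = N and m = n]) (use that in auto)
  have G: "Determinant.det MG = 1"
    using detf_upper_triangular[of n G] G0 G1 unfolding detf_def MG_def by simp

  \<comment> \<open>The row operation with -Y clears the upper right block, as U - Y G = 0.\<close>
  have "four_block_mat (1\<^sub>m N) MY (0\<^sub>m n N) (1\<^sub>m n) * ?X
      = four_block_mat (MB + MY * MV) (0\<^sub>m N n) MV MG"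
  proof -
    have "MU + MY * MG = 0\<^sub>m N n"
      by (rule eq_matI) (auto simp: defs scalar_prod_def U lessThan_atLeast0 sum_negf)
    then show ?thesis
      by (subst mult_four_block_mat[where ?nr1.0 = N and ?n1.0 = N and ?n2.0 = n and ?nr2.0 = n
            and ?nc1.0 = N and ?nc2.0 = n])
         (use car in auto)
  qed
  then have "Determinant.det ?X
      = Determinant.det (four_block_mat (MB + MY * MV) (0\<^sub>m N n) MV MG)"
    using det_mult[of "four_block_mat (1\<^sub>m N) MY (0\<^sub>m n N) (1\<^sub>m n)" "N + n" ?X] Xc unit[of MY] car
    by (auto simp: four_block_carrier_mat)
  also have "\<dots> = Determinant.det (MB + MY * MV)"
    by (subst det_four_block_mat_upper_right_zero[where n = N and m = n]) (use car G in auto)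
  also have "MB + MY * MV
      = ?M N N (\<lambda>k l. (if k = l then b k else 0) - (\<Sum>i<n. Y k i * V i l))"
    by (rule eq_matI) (auto simp: defs scalar_prod_def lessThan_atLeast0 sum_negf)
  finally have left: "Determinant.det ?X
      = detf N (\<lambda>k l. (if k = l then b k else 0) - (\<Sum>i<n. Y k i * V i l))"
    by (simp add: detf_def)

  \<comment> \<open>The column operation with the negative of the quotients
    \<open>U k j / b k\<close> clears the same block.\<close>
  have "?X * four_block_mat (1\<^sub>m N) MW (0\<^sub>m n N) (1\<^sub>m n)
      = four_block_mat MB (0\<^sub>m N n) MV (MG + MV * MW)"
  proof -
    have "(\<Sum>i = 0..<N. (if k = i then b k else 0) * (- (U i j / b i))) = - U k j" if "k < N" for k j
      using that b[of k] by (subst sum.remove[of _ k]) (auto intro!: sum.neutral)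
    then have "MB * MW + MU = 0\<^sub>m N n"
      by (intro eq_matI) (auto simp: defs scalar_prod_def)
    moreover have "MV * MW + MG = MG + MV * MW"
      by (intro comm_add_mat[of _ n n]) (use car in auto)
    ultimately show ?thesis
      by (subst mult_four_block_mat[where ?nr1.0 = N and ?n1.0 = N and ?n2.0 = n and ?nr2.0 = n
            and ?nc1.0 = N and ?nc2.0 = n])
         (use car in auto)
  qed
  then have "Determinant.det ?X
      = Determinant.det (four_block_mat MB (0\<^sub>m N n) MV (MG + MV * MW))"
    using det_mult[of ?X "N + n" "four_block_mat (1\<^sub>m N) MW (0\<^sub>m n N) (1\<^sub>m n)"] Xc unit[of MW] car
    by (auto simp: four_block_carrier_mat)
  also have "\<dots> = Determinant.det MB * Determinant.det (MG + MV * MW)"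
    by (subst det_four_block_mat_upper_right_zero[where n = N and m = n]) (use car in auto)
  also have "MG + MV * MW = ?M n n (\<lambda>i j. G i j - (\<Sum>k<N. V i k * U k j / b k))"
    by (rule eq_matI) (auto simp: defs scalar_prod_def lessThan_atLeast0 sum_negf)
  finally have "Determinant.det ?X
      = (\<Prod>k<N. b k) * detf n (\<lambda>i j. G i j - (\<Sum>k<N. V i k * U k j / b k))"
    using detf_diagonal[of N b] by (simp add: detf_def MB_def)
  with left show ?thesis
    by simp
qed

text \<open>Inclusion--exclusion: with \<open>1\<^sub>A\<close> the diagonal projection, every factor of the Leibniz
  formula for \<open>det (1 - 1\<^sub>A K)\<close> telescopes to an entry of \<open>K\<close>.\<close>

lemma detf_inclusion_exclusion:
  fixes K :: "nat \<Rightarrow> nat \<Rightarrow> 'a::comm_ring_1"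
  shows "(\<Sum>A\<in>Pow {0..<n}. (-1) ^ card A *
      detf n (\<lambda>i j. (if i = j then 1 else 0) - (if i \<in> A then 1 else 0) * K i j)) = detf n K"
proof -
  let ?d = "\<lambda>i j. (if i = j then 1 else 0 :: 'a)"
  have "(\<Prod>i = 0..<n. K i (p i)) = (\<Sum>A\<in>Pow {0..<n}. (-1) ^ card A *
      (\<Prod>i = 0..<n. ?d i (p i) - (if i \<in> A then 1 else 0) * K i (p i)))" for p
  proof -
    have "(\<Prod>i = 0..<n. K i (p i))
        = (\<Prod>i = 0..<n. - (?d i (p i) - K i (p i)) + ?d i (p i))"
      by simp
    also have "\<dots> = (\<Sum>A\<in>Pow {0..<n}. (\<Prod>i\<in>A. - (?d i (p i) - K i (p i)))
        * (\<Prod>i\<in>{0..<n} - A. ?d i (p i)))"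
      by (rule prod_add) simp
    also have "\<dots> = (\<Sum>A\<in>Pow {0..<n}. (-1) ^ card A *
      (\<Prod>i = 0..<n. ?d i (p i) - (if i \<in> A then 1 else 0) * K i (p i)))"
    proof (intro sum.cong refl)
      fix A assume "A \<in> Pow {0..<n}"
      then have A: "A \<subseteq> {0..<n}" by auto
      then have "(\<Prod>i = 0..<n. ?d i (p i) - (if i \<in> A then 1 else 0) * K i (p i))
        = (\<Prod>i\<in>{0..<n} - A. ?d i (p i)) * (\<Prod>i\<in>A. ?d i (p i) - K i (p i))"
        by (subst prod.subset_diff[of A]) (auto intro!: arg_cong2[where f = times] prod.cong)
      then show "(\<Prod>i\<in>A. - (?d i (p i) - K i (p i))) * (\<Prod>i\<in>{0..<n} - A. ?d i (p i)) =
        (-1) ^ card A * (\<Prod>i = 0..<n. ?d i (p i) - (if i \<in> A then 1 else 0) * K i (p i))"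
        by (simp only: prod_uminus) (simp add: mult_ac)
    qed
    finally show ?thesis .
  qed
  then show ?thesis
    unfolding detf_leibniz
    by (simp add: sum_distrib_left) (subst sum.swap, intro sum.cong refl, simp add: mult_ac sum_distrib_left)
qed


section \<open>One-step matrices acting on Slater determinants\<close>

definition tup :: "nat \<Rightarrow> int set \<Rightarrow> int list set" where
  "tup N A = {x. length x = N \<and> sorted_wrt (<) x \<and> set x \<subseteq> A}"

lemma tuples_eq_tup: "tuples N T S t = tup N (points N T S t)"
  by (simp add: tuples_def tup_def)

lemma finite_tup: "finite A \<Longrightarrow> finite (tup N A)"
  by (rule finite_subset[OF _ finite_lists_length_eq[of A N]]) (auto simp: tup_def)

lemma tup_nth_less: "x \<in> tup N A \<Longrightarrow> i < j \<Longrightarrow> j < N \<Longrightarrow> x ! i < x ! j"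
  by (auto simp: tup_def sorted_wrt_iff_nth_less)

lemma tup_nth_mem: "x \<in> tup N A \<Longrightarrow> i < N \<Longrightarrow> x ! i \<in> A"
  by (auto simp: tup_def)

lemma vandermonde_pos: "x \<in> tup N A \<Longrightarrow> vandermonde N x > 0"
  unfolding vandermonde_def by (intro prod_pos) (auto dest: tup_nth_less)

definition slater :: "nat \<Rightarrow> (nat \<Rightarrow> int \<Rightarrow> real) \<Rightarrow> int list \<Rightarrow> real" where
  "slater N g x = detf N (\<lambda>i k. g k (x ! i))"

text \<open>Lower order terms drop out by column operations, so the quotient by the Vandermonde is
  constant. This gives the row sums of the one-step matrices and the start of the recursion in
  \<open>hm_eq_slater\<close>.\<close>

lemma slater_poly:
  assumes "\<And>k. k < N \<Longrightarrow> degree (q k) \<le> k"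
  shows "slater N (\<lambda>k y. poly (q k) (of_int y)) x = (\<Prod>k<N. coeff (q k) k) * vandermonde N x"
  using detf_poly_powers[of N q "\<lambda>i. of_int (x ! i)", OF assms]
  by (simp add: slater_def detf_powers vandermonde_def)

lemma slater_cong:
  assumes "x \<in> tup N A" "\<And>k y. k < N \<Longrightarrow> y \<in> A \<Longrightarrow> g k y = g' k y"
  shows "slater N g x = slater N g' x"
  unfolding slater_def by (rule detf_cong) (use assms in \<open>auto dest: tup_nth_mem\<close>)

lemma slater_scale_arg: "slater N (\<lambda>k y. c y * g k y) x = (\<Prod>i<N. c (x ! i)) * slater N g x"
  unfolding slater_def by (rule detf_scale_rows)

definition point_mass :: "int \<Rightarrow> int \<Rightarrow> real" where
  "point_mass a y = (if y = a then 1 else 0)"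

text \<open>If \<open>y\<close> and \<open>z\<close> differ, some entry of \<open>y\<close> is
  missing in \<open>z\<close>, as both are increasing of the same length, and its row vanishes. Such
  determinants single out one matrix entry in \<open>jump_eq_slater\<close>.\<close>

lemma slater_point_mass:
  assumes y: "y \<in> tup N B" and z: "z \<in> tup N B"
  shows "slater N (\<lambda>k. point_mass (z ! k)) y = (if y = z then 1 else 0)"
proof (cases "y = z")
  case True
  have "z ! i = z ! k \<longleftrightarrow> i = k" if "i < N" "k < N" for i k
    using tup_nth_less[OF z] that by (metis less_irrefl linorder_neqE_nat)
  then have "slater N (\<lambda>k. point_mass (z ! k)) y = detf N (\<lambda>i k. if i = k then 1 else 0)"
    unfolding slater_def point_mass_def True by (intro detf_cong) auto
  then show ?thesis
    using True by (simp add: detf_diagonal)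
next
  case False
  have dist: "distinct y" "distinct z" "sorted y" "sorted z" "length y = N" "length z = N"
    using y z by (auto simp: tup_def strict_sorted_iff)
  have "\<not> set y \<subseteq> set z"
  proof
    assume "set y \<subseteq> set z"
    then have "set y = set z"
      using dist by (intro card_subset_eq) (auto simp: distinct_card)
    then show False
      using False dist sorted_distinct_set_unique by blast
  qed
  then obtain a where "a \<in> set y" "a \<notin> set z"
    by auto
  then obtain i where "i < N" "y ! i \<notin> set z"
    using dist by (metis in_set_conv_nth)
  then have "slater N (\<lambda>k. point_mass (z ! k)) y = 0"
    unfolding slater_def point_mass_def
    by (intro detf_zero_row[of i]) (use dist in auto)
  with False show ?thesis by simp
qed

definition hop :: "int \<Rightarrow> (int \<Rightarrow> real) \<Rightarrow> (int \<Rightarrow> real) \<Rightarrow> (int \<Rightarrow> real) \<Rightarrow> int \<Rightarrow> real" where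
  "hop \<sigma> u b g x = u x * g (x + \<sigma>) + b x * g x"

text \<open>The common shape of the three one-step matrices: the Doob transform, by the Vandermonde,
  of N independent particles that step by \<open>\<sigma>\<close> with weight \<open>u\<close> or
  stay with weight \<open>b\<close>.\<close>

definition jump ::
    "nat \<Rightarrow> int \<Rightarrow> (int \<Rightarrow> real) \<Rightarrow> (int \<Rightarrow> real) \<Rightarrow> real \<Rightarrow> int list \<Rightarrow> int list \<Rightarrow> real" where
  "jump N \<sigma> u b \<kappa> x y =
     (if \<forall>i<N. y ! i - x ! i \<in> {0, \<sigma>}
      then vandermonde N y * (\<Prod>i | i < N \<and> y ! i = x ! i + \<sigma>. u (x ! i))
           * (\<Prod>i | i < N \<and> y ! i = x ! i. b (x ! i)) / (\<kappa> * vandermonde N x)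
      else 0)"

lemma jump_nonneg:
  assumes "x \<in> tup N A" "y \<in> tup N B" "\<kappa> > 0" "\<And>a. a \<in> A \<Longrightarrow> u a \<ge> 0 \<and> b a \<ge> 0"
  shows "jump N \<sigma> u b \<kappa> x y \<ge> 0"
  using vandermonde_pos[OF assms(1)] vandermonde_pos[OF assms(2)] assms(3,4) tup_nth_mem[OF assms(1)]
  unfolding jump_def by (auto intro!: divide_nonneg_pos mult_nonneg_nonneg prod_nonneg)

text \<open>Expand the determinant of the \<open>hop\<close>ped functions along its rows.  A choice of
  destinations that is not strictly increasing contains a collision, and the corresponding
  determinant has two equal rows.\<close>

lemma sum_jump_slater:
  assumes x: "x \<in> tup N A" and \<sigma>: "\<sigma> \<in> {1, -1}" and "finite B"
    and u: "\<And>a. a \<in> A \<Longrightarrow> a + \<sigma> \<in> B \<or> u a = 0" and b: "\<And>a. a \<in> A \<Longrightarrow> a \<in> B \<or> b a = 0"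
  shows "(\<Sum>y\<in>tup N B. jump N \<sigma> u b \<kappa> x y * (slater N g y / vandermonde N y))
    = slater N (\<lambda>k. hop \<sigma> u b (g k)) x / (\<kappa> * vandermonde N x)"
proof -
  let ?Y = "\<lambda>i. {x ! i, x ! i + \<sigma>}"
  define v where "v i y = (if y = x ! i + \<sigma> then u (x ! i) else b (x ! i))" for i y
  define F where "F h = (\<Prod>i<N. v i (h i)) * detf N (\<lambda>i k. g k (h i))" for h
  define H where "H = PiE {0..<N} ?Y"
  have \<sigma>0: "\<sigma> \<noteq> 0" using \<sigma> by auto
  have "slater N (\<lambda>k. hop \<sigma> u b (g k)) x = detf N (\<lambda>i k. \<Sum>y\<in>?Y i. v i y * g k y)"
    unfolding slater_def hop_def v_def using \<sigma>0 by (intro detf_cong) auto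
  also have "\<dots> = (\<Sum>h\<in>H. F h)"
    unfolding H_def F_def by (subst detf_sum_rows) (auto simp: detf_scale_rows)
  also have "\<dots> = (\<Sum>h\<in>{h\<in>H. map h [0..<N] \<in> tup N B}. F h)"
  proof (intro sum.mono_neutral_right ballI)
    fix h assume "h \<in> H - {h \<in> H. map h [0..<N] \<in> tup N B}"
    then have h: "h \<in> H" and "map h [0..<N] \<notin> tup N B" by auto
    have hi: "h i = x ! i \<or> h i = x ! i + \<sigma>" if "i < N" for i
      using h that by (auto simp: H_def PiE_def Pi_def)
    have "(\<exists>i<N. h i \<notin> B) \<or> (\<exists>i j. i < j \<and> j < N \<and> \<not> h i < h j)"
      using \<open>map h [0..<N] \<notin> tup N B\<close> by (auto simp: tup_def sorted_wrt_iff_nth_less)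
    then consider (out) i where "i < N" "h i \<notin> B" | (coll) i j where "i < j" "j < N" "\<not> h i < h j"
      by blast
    then show "F h = 0"
    proof cases
      case out
      then have "v i (h i) = 0"
        using hi[of i] u[OF tup_nth_mem[OF x, of i]] b[OF tup_nth_mem[OF x, of i]] \<sigma>0
        by (auto simp: v_def)
      then have "(\<Prod>i<N. v i (h i)) = 0"
        using out by (auto intro!: prod_zero)
      then show ?thesis by (simp add: F_def)
    next
      case coll
      \<comment> \<open>All moves are 0 or the same unit step, so two particles can meet but not
        cross.\<close>
      then have "h i = h j"
        using hi[of i] hi[of j] tup_nth_less[OF x, of i j] \<sigma> by auto
      then show ?thesis
        using coll by (auto simp: F_def intro!: detf_identical_rows[of i N j])
    qed
  qed (auto simp: H_def intro!: finite_PiE)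
  also have "\<dots> = (\<Sum>y\<in>{y\<in>tup N B. \<forall>i<N. y ! i - x ! i \<in> {0, \<sigma>}}.
      (\<Prod>i<N. v i (y ! i)) * slater N g y)"
  proof (rule sum.reindex_bij_witness[where i = "\<lambda>y. restrict (nth y) {0..<N}"
        and j = "\<lambda>h. map h [0..<N]"], goal_cases)
    case (1 h)
    then show ?case by (auto simp: H_def PiE_def extensional_def fun_eq_iff)
  next
    case (2 h)
    then show ?case by (auto simp: H_def PiE_def Pi_def)
  next
    case (3 y)
    then show ?case by (auto simp: tup_def intro!: nth_equalityI)
  next
    case (4 y)
    then have "map (restrict ((!) y) {0..<N}) [0..<N] = y"
      by (auto simp: tup_def intro!: nth_equalityI)
    with 4 show ?case
      by (auto simp: H_def)
  next
    case (5 h)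
    then show ?case
      by (auto simp: F_def slater_def intro!: arg_cong2[where f = times] prod.cong detf_cong)
  qed
  also have "\<dots> = (\<Sum>y\<in>{y\<in>tup N B. \<forall>i<N. y ! i - x ! i \<in> {0, \<sigma>}}.
      \<kappa> * vandermonde N x * (jump N \<sigma> u b \<kappa> x y * (slater N g y / vandermonde N y)))"
    if "\<kappa> \<noteq> 0"
  proof (intro sum.cong refl)
    fix y assume y: "y \<in> {y\<in>tup N B. \<forall>i<N. y ! i - x ! i \<in> {0, \<sigma>}}"
    have "(\<Prod>i<N. v i (y ! i)) = (\<Prod>i\<in>{..<N} \<inter> {i. y ! i = x ! i + \<sigma>}. u (x ! i))
        * (\<Prod>i\<in>{..<N} \<inter> - {i. y ! i = x ! i + \<sigma>}. b (x ! i))"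
      unfolding v_def by (rule prod.If_cases) simp
    also have "{..<N} \<inter> {i. y ! i = x ! i + \<sigma>} = {i. i < N \<and> y ! i = x ! i + \<sigma>}"
      by auto
    also have "{..<N} \<inter> - {i. y ! i = x ! i + \<sigma>} = {i. i < N \<and> y ! i = x ! i}"
      using y \<sigma>0 by auto
    finally show "(\<Prod>i<N. v i (y ! i)) * slater N g y = \<kappa> * vandermonde N x *
        (jump N \<sigma> u b \<kappa> x y * (slater N g y / vandermonde N y))"
      using y vandermonde_pos[OF x] vandermonde_pos[of y N B] that by (simp add: jump_def)
  qed
  also have "(\<Sum>y\<in>{y\<in>tup N B. \<forall>i<N. y ! i - x ! i \<in> {0, \<sigma>}}.
      \<kappa> * vandermonde N x * (jump N \<sigma> u b \<kappa> x y * (slater N g y / vandermonde N y)))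
    = (\<Sum>y\<in>tup N B.
      \<kappa> * vandermonde N x * (jump N \<sigma> u b \<kappa> x y * (slater N g y / vandermonde N y)))"
    using finite_tup[OF \<open>finite B\<close>] by (intro sum.mono_neutral_left) (auto simp: jump_def)
  finally have "\<kappa> \<noteq> 0 \<Longrightarrow> ?thesis"
    unfolding sum_distrib_left[symmetric] using vandermonde_pos[OF x] by simp
  \<comment> \<open>Division by 0 gives 0, so both sides vanish.\<close>
  moreover have "\<kappa> = 0 \<Longrightarrow> ?thesis"
    by (simp add: jump_def cong: if_cong)
  ultimately show ?thesis by blast
qed

lemma jump_eq_slater:
  assumes x: "x \<in> tup N A" and z: "z \<in> tup N B" and \<sigma>: "\<sigma> \<in> {1, -1}" and B: "finite B"
    and u: "\<And>a. a \<in> A \<Longrightarrow> a + \<sigma> \<in> B \<or> u a = 0" and b: "\<And>a. a \<in> A \<Longrightarrow> a \<in> B \<or> b a = 0"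
  shows "jump N \<sigma> u b \<kappa> x z = vandermonde N z *
    (slater N (\<lambda>k. hop \<sigma> u b (point_mass (z ! k))) x / (\<kappa> * vandermonde N x))"
proof -
  have "slater N (\<lambda>k. hop \<sigma> u b (point_mass (z ! k))) x / (\<kappa> * vandermonde N x)
    = (\<Sum>y\<in>tup N B. jump N \<sigma> u b \<kappa> x y *
        (slater N (\<lambda>k. point_mass (z ! k)) y / vandermonde N y))"
    by (rule sum_jump_slater[symmetric]) (use assms in auto)
  also have "\<dots> = (\<Sum>y\<in>tup N B. if y = z then jump N \<sigma> u b \<kappa> x z / vandermonde N z else 0)"
    by (intro sum.cong refl) (use z in \<open>simp add: slater_point_mass\<close>)
  also have "\<dots> = jump N \<sigma> u b \<kappa> x z / vandermonde N z"
    using z finite_tup[OF B] by simp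
  finally show ?thesis
    using vandermonde_pos[OF z] by simp
qed

text \<open>An entry of the second factor is itself a Slater quotient in its row index, so the
  product matrix is governed by the composed one-variable operators. Commutation of matrices thereby
  reduces to commutation of difference operators.\<close>

lemma sum_jump_jump:
  assumes x: "x \<in> tup N A" and z: "z \<in> tup N C" and \<sigma>: "\<sigma> \<in> {1, -1}" "\<sigma>' \<in> {1, -1}"
    and B: "finite B" "finite C"
    and u: "\<And>a. a \<in> A \<Longrightarrow> a + \<sigma> \<in> B \<or> u a = 0" and b: "\<And>a. a \<in> A \<Longrightarrow> a \<in> B \<or> b a = 0"
    and u': "\<And>a. a \<in> B \<Longrightarrow> a + \<sigma>' \<in> C \<or> u' a = 0" and b': "\<And>a. a \<in> B \<Longrightarrow> a \<in> C \<or> b' a = 0"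
  shows "(\<Sum>y\<in>tup N B. jump N \<sigma> u b \<kappa> x y * jump N \<sigma>' u' b' \<kappa>' y z)
    = vandermonde N z * (slater N (\<lambda>k. hop \<sigma> u b (hop \<sigma>' u' b' (point_mass (z ! k)))) x
        / (\<kappa> * \<kappa>' * vandermonde N x))"
proof -
  have "(\<Sum>y\<in>tup N B. jump N \<sigma> u b \<kappa> x y * jump N \<sigma>' u' b' \<kappa>' y z)
    = (\<Sum>y\<in>tup N B. vandermonde N z / \<kappa>' * (jump N \<sigma> u b \<kappa> x y *
        (slater N (\<lambda>k. hop \<sigma>' u' b' (point_mass (z ! k))) y / vandermonde N y)))"
  proof (intro sum.cong refl)
    fix y assume y: "y \<in> tup N B"
    show "jump N \<sigma> u b \<kappa> x y * jump N \<sigma>' u' b' \<kappa>' y z = vandermonde N z / \<kappa>' * (jump N \<sigma> u b \<kappa> x y *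
        (slater N (\<lambda>k. hop \<sigma>' u' b' (point_mass (z ! k))) y / vandermonde N y))"
      by (subst jump_eq_slater[OF y z \<sigma>(2) B(2) u' b']) auto
  qed
  also have "\<dots> = vandermonde N z / \<kappa>' *
      (slater N (\<lambda>k. hop \<sigma> u b (hop \<sigma>' u' b' (point_mass (z ! k)))) x / (\<kappa> * vandermonde N x))"
    unfolding sum_distrib_left[symmetric]
    by (subst sum_jump_slater[OF x \<sigma>(1) B(1) u b]) auto
  finally show ?thesis by (simp add: mult_ac)
qed

section \<open>Difference operators on polynomials; row sums\<close>

definition hop_poly :: "int \<Rightarrow> real \<Rightarrow> real \<Rightarrow> real \<Rightarrow> real poly \<Rightarrow> real poly" where
  "hop_poly \<sigma> u0 u1 b0 q = [:u0, u1:] * pcompose q [:of_int \<sigma>, 1:] + [:b0, - u1:] * q"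

lemma poly_hop_poly:
  "poly (hop_poly \<sigma> u0 u1 b0 q) (of_int x)
    = hop \<sigma> (\<lambda>x. u0 + u1 * of_int x) (\<lambda>x. b0 - u1 * of_int x) (\<lambda>y. poly q (of_int y)) x"
  by (simp add: hop_poly_def hop_def poly_pcompose algebra_simps)

text \<open>Shifting a + X q by c gives a + c q(X + c) + X q(X + c), whence the induction. The
  second coefficient is wanted because the difference of a polynomial and its shift starts
  there.\<close>

lemma coeff_pcompose_shift:
  fixes q :: "'a::comm_ring_1 poly"
  assumes "degree q \<le> Suc m"
  shows "coeff (pcompose q [:c, 1:]) (Suc m) = coeff q (Suc m)
    \<and> coeff (pcompose q [:c, 1:]) m = coeff q m + of_nat (Suc m) * c * coeff q (Suc m)"
  using assms
proof (induction q arbitrary: m)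
  case 0
  then show ?case by simp
next
  case (pCons a q)
  have deg: "degree (pcompose q [:c, 1:]) \<le> m" if "degree q \<le> m"
    using degree_pcompose_le[of q "[:c, 1:]"] that by simp
  have step: "pcompose (pCons a q) [:c, 1:]
      = [:a:] + Polynomial.smult c (pcompose q [:c, 1:]) + pCons 0 (pcompose q [:c, 1:])"
    by (simp add: pcompose_pCons)
  have dq: "degree q \<le> m"
    using pCons.prems by (cases "q = 0") auto
  then have top: "coeff (pcompose q [:c, 1:]) (Suc m) = 0" "coeff q (Suc m) = 0"
    using deg by (auto intro!: coeff_eq_0)
  show ?case
  proof (cases m)
    case 0
    then have "q = [:coeff q 0:]"
      using dq by (auto elim!: degree_eq_zeroE)
    then have "pcompose q [:c, 1:] = [:coeff q 0:]"
      by (metis pcompose_const)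
    then show ?thesis
      using 0 by (simp add: step coeff_pCons split: nat.splits)
  next
    case (Suc l)
    then show ?thesis
      using pCons.IH[of l] dq top
      by (simp add: step coeff_pCons algebra_simps split: nat.splits)
  qed
qed

text \<open>The slopes of the two coefficients cancel: the operator is \<open>u0\<close> times the
  shift, plus \<open>b0\<close>, plus \<open>u1\<close> X times a difference. The difference lowers
  the degree by one and yields the factor \<open>\<sigma>\<close> k, so the degree does not
  rise.\<close>

lemma hop_poly_coeff:
  assumes "degree q \<le> k"
  shows "degree (hop_poly \<sigma> u0 u1 b0 q) \<le> k"
    and "coeff (hop_poly \<sigma> u0 u1 b0 q) k = (u0 + b0 + of_int \<sigma> * u1 * of_nat k) * coeff q k"
proof -
  let ?Q = "pcompose q [:of_int \<sigma>, 1:]"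
  have eq: "hop_poly \<sigma> u0 u1 b0 q = Polynomial.smult u0 ?Q + Polynomial.smult b0 q + Polynomial.smult u1 (pCons 0 (?Q - q))"
    by (simp add: hop_poly_def algebra_simps smult_diff_right)
  have dQ: "degree ?Q \<le> k"
    using degree_pcompose_le[of q "[:of_int \<sigma>, 1:]"] assms by simp
  have top: "coeff ?Q k = coeff q k"
  proof (cases k)
    case 0
    then have "q = [:coeff q 0:]"
      using assms by (auto elim!: degree_eq_zeroE)
    then show ?thesis
      using 0 by (metis pcompose_const)
  next
    case (Suc m)
    then show ?thesis
      using coeff_pcompose_shift[of q m "of_int \<sigma>"] assms by simp
  qed
  show "degree (hop_poly \<sigma> u0 u1 b0 q) \<le> k"
  proof (rule degree_le, intro allI impI)
    fix i assume i: "k < i"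
    then obtain j where j: "i = Suc j" by (cases i) auto
    have "coeff ?Q j = coeff q j"
      using top i j dQ assms by (cases "j = k") (auto simp: coeff_eq_0)
    then show "coeff (hop_poly \<sigma> u0 u1 b0 q) i = 0"
      using i j dQ assms by (simp add: eq coeff_eq_0)
  qed
  show "coeff (hop_poly \<sigma> u0 u1 b0 q) k = (u0 + b0 + of_int \<sigma> * u1 * of_nat k) * coeff q k"
  proof (cases k)
    case 0
    then show ?thesis using top by (simp add: eq algebra_simps)
  next
    case (Suc m)
    then show ?thesis
      using top coeff_pcompose_shift[of q m "of_int \<sigma>"] assms by (simp add: eq algebra_simps)
  qed
qed

text \<open>For monomials the Slater quotient is 1, and the operator is triangular on them, with
  \<open>\<kappa>\<close> the product of its first N diagonal entries. This is the origin of the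
  Pochhammer symbols in the one-step matrices.\<close>

lemma sum_jump_eq_1:
  assumes x: "x \<in> tup N A" and \<sigma>: "\<sigma> \<in> {1, -1}" and B: "finite B"
    and u: "\<And>a. a \<in> A \<Longrightarrow> a + \<sigma> \<in> B \<or> u a = 0" and b: "\<And>a. a \<in> A \<Longrightarrow> a \<in> B \<or> b a = 0"
    and u_def: "u = (\<lambda>a. u0 + u1 * of_int a)" and b_def: "b = (\<lambda>a. b0 - u1 * of_int a)"
    and \<kappa>: "\<kappa> = (\<Prod>k<N. u0 + b0 + of_int \<sigma> * u1 * of_nat k)" "\<kappa> \<noteq> 0"
  shows "(\<Sum>y\<in>tup N B. jump N \<sigma> u b \<kappa> x y) = 1"
proof -
  let ?q = "\<lambda>k. monom (1::real) k"
  have "(\<Sum>y\<in>tup N B. jump N \<sigma> u b \<kappa> x y) = (\<Sum>y\<in>tup N B. jump N \<sigma> u b \<kappa> x y *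
      (slater N (\<lambda>k y. poly (?q k) (of_int y)) y / vandermonde N y))"
  proof (intro sum.cong refl)
    fix y assume "y \<in> tup N B"
    then show "jump N \<sigma> u b \<kappa> x y = jump N \<sigma> u b \<kappa> x y *
      (slater N (\<lambda>k y. poly (?q k) (of_int y)) y / vandermonde N y)"
      using slater_poly[of N ?q y] vandermonde_pos[of y N B] by (simp add: degree_monom_eq)
  qed
  also have "\<dots> = slater N (\<lambda>k. hop \<sigma> u b (\<lambda>y. poly (?q k) (of_int y))) x / (\<kappa> * vandermonde N x)"
    by (rule sum_jump_slater) (use assms in auto)
  also have "(\<lambda>k. hop \<sigma> u b (\<lambda>y. poly (?q k) (of_int y)))
      = (\<lambda>k y. poly (hop_poly \<sigma> u0 u1 b0 (?q k)) (of_int y))"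
    by (simp add: fun_eq_iff poly_hop_poly u_def b_def)
  also have "slater N \<dots> x = \<kappa> * vandermonde N x"
    by (subst slater_poly) (auto simp: hop_poly_coeff degree_monom_eq \<kappa>)
  finally show ?thesis
    using \<kappa> vandermonde_pos[OF x] by simp
qed


section \<open>Orthonormal polynomials on a finite set of integers\<close>

definition ip :: "int set \<Rightarrow> (int \<Rightarrow> real) \<Rightarrow> real poly \<Rightarrow> real poly \<Rightarrow> real" where
  "ip X w p q = (\<Sum>x\<in>X. poly p (of_int x) * poly q (of_int x) * w x)"

lemma ip_commute: "ip X w p q = ip X w q p"
  by (simp add: ip_def mult_ac)

lemma ip_diff_left: "ip X w (p - p') q = ip X w p q - ip X w p' q"
  by (simp add: ip_def algebra_simps sum_subtractf)

lemma ip_smult_left: "ip X w (Polynomial.smult a p) q = a * ip X w p q"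
  by (simp add: ip_def sum_distrib_left mult_ac)

lemma ip_smult_right: "ip X w p (Polynomial.smult a q) = a * ip X w p q"
  by (simp add: ip_def sum_distrib_left mult_ac)

lemma ip_sum_left: "ip X w (\<Sum>i\<in>I. p i) q = (\<Sum>i\<in>I. ip X w (p i) q)"
  unfolding ip_def by (subst sum.swap) (simp add: poly_sum sum_distrib_right)

lemma ip_self_eq_0:
  assumes "finite X" "\<And>x. x \<in> X \<Longrightarrow> w x > 0" "ip X w p p = 0" "x \<in> X"
  shows "poly p (of_int x) = 0"
proof -
  have "\<forall>x\<in>X. poly p (of_int x) * poly p (of_int x) * w x = 0"
    using assms unfolding ip_def by (subst (asm) sum_nonneg_eq_0_iff) (auto intro!: mult_nonneg_nonneg simp: less_imp_le)
  with assms(2,4) show ?thesis by fastforce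
qed

lemma poly_eq_0_of_card:
  fixes p :: "real poly"
  assumes "\<And>x. x \<in> X \<Longrightarrow> poly p (of_int x) = 0" "degree p < card X"
  shows "p = 0"
proof (rule ccontr)
  assume p: "p \<noteq> 0"
  have "card X = card (real_of_int ` X)"
    by (rule card_image[symmetric]) (simp add: inj_on_def)
  also have "\<dots> \<le> card {x. poly p x = 0}"
    using assms(1) by (intro card_mono poly_roots_finite p) auto
  also have "\<dots> \<le> degree p"
    by (rule card_poly_roots_bound[OF p])
  finally show False using assms(2) by simp
qed

lemma poly_in_span:
  fixes p :: "nat \<Rightarrow> 'a::field poly"
  assumes "\<And>j. j < k \<Longrightarrow> degree (p j) = j \<and> p j \<noteq> 0" "degree q < k"
  shows "\<exists>a. q = (\<Sum>j<k. Polynomial.smult (a j) (p j))"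
  using assms
proof (induction k arbitrary: q)
  case 0
  then show ?case by simp
next
  case (Suc k)
  define c where "c = coeff q k / coeff (p k) k"
  define r where "r = q - Polynomial.smult c (p k)"
  have pk: "degree (p k) = k" "coeff (p k) k \<noteq> 0"
    using Suc.prems(1)[of k] leading_coeff_0_iff[of "p k"] by (simp, metis lessI)
  have rk: "coeff r k = 0" using pk by (simp add: r_def c_def)
  have dr: "degree r \<le> k"
    using Suc.prems(2) pk unfolding r_def by (intro degree_diff_le order_trans[OF degree_smult_le]) auto
  have "\<exists>a. r = (\<Sum>j<k. Polynomial.smult (a j) (p j))"
  proof (cases "degree r < k")
    case True
    then show ?thesis using Suc.IH[of r] Suc.prems(1) by auto
  next
    case False
    then have "degree r = k" using dr by simp
    then have "r = 0" using rk by (metis leading_coeff_0_iff)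
    then show ?thesis by (intro exI[of _ "\<lambda>_. 0"]) simp
  qed
  then obtain a where "r = (\<Sum>j<k. Polynomial.smult (a j) (p j))" by blast
  then have "q = (\<Sum>j<Suc k. Polynomial.smult ((a(k := c)) j) (p j))"
    by (simp add: r_def algebra_simps)
  then show ?case by blast
qed

definition is_onp :: "int set \<Rightarrow> (int \<Rightarrow> real) \<Rightarrow> nat \<Rightarrow> real poly \<Rightarrow> bool" where
  "is_onp X w k p \<longleftrightarrow> degree p = k \<and> lead_coeff p > 0
     \<and> (\<forall>q. degree q < k \<longrightarrow> ip X w p q = 0) \<and> ip X w p p = 1"

text \<open>Gram-Schmidt on the monomial of degree k. As k < card X, the monic remainder cannot
  vanish on all of X and can be normalized.\<close>

lemma ex_onp:
  assumes X: "finite X" "\<And>x. x \<in> X \<Longrightarrow> w x > 0" and "k < card X"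
  shows "\<exists>p. is_onp X w k p"
  using assms(3)
proof (induction k rule: less_induct)
  case (less k)
  then have "\<forall>j<k. \<exists>p. is_onp X w j p" by auto
  then obtain p where p: "\<And>j. j < k \<Longrightarrow> is_onp X w j (p j)" by metis
  define r where "r = (\<Sum>j<k. Polynomial.smult (ip X w (monom 1 k) (p j)) (p j))"
  define q where "q = monom 1 k - r"
  have onp: "ip X w (p i) (p j) = (if i = j then 1 else 0)" if "i < k" "j < k" for i j
    using p[OF that(1)] p[OF that(2)] ip_commute[of X w "p i" "p j"]
    by (cases i j rule: linorder_cases) (auto simp: is_onp_def)
  have nz: "degree (p j) = j \<and> p j \<noteq> 0" if "j < k" for j
    using p[OF that] by (auto simp: is_onp_def)
  have r: "r = 0 \<or> degree r < k"
  proof (cases "k = 0")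
    case False
    have "degree r < k"
      unfolding r_def using p False
      by (intro degree_sum_less) (auto simp: is_onp_def intro: le_less_trans[OF degree_smult_le])
    then show ?thesis by simp
  qed (simp add: r_def)
  have ck: "coeff q k = 1"
    using r by (auto simp: q_def coeff_eq_0)
  have "degree q \<le> k"
    unfolding q_def using r by (intro degree_diff_le) (auto simp: degree_monom_eq)
  then have dq: "degree q = k"
    using ck le_degree[of q k] by simp
  have orth: "ip X w q (p j) = 0" if "j < k" for j
    using that by (simp add: q_def r_def ip_diff_left ip_sum_left ip_smult_left onp if_distrib
        cong: if_cong)
  have orth': "ip X w q s = 0" if s: "degree s < k" for s
  proof -
    obtain a where "s = (\<Sum>j<k. Polynomial.smult (a j) (p j))"
      using poly_in_span[of k p s, OF nz s] by blast
    then have "ip X w s q = 0"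
      using orth by (simp add: ip_sum_left ip_smult_left ip_commute[of X w _ q])
    then show ?thesis by (simp add: ip_commute)
  qed
  have "ip X w q q \<noteq> 0"
  proof
    assume "ip X w q q = 0"
    then have "q = 0"
      using ip_self_eq_0[OF X] dq less.prems by (intro poly_eq_0_of_card[of X q]) auto
    with ck show False by simp
  qed
  moreover have "ip X w q q \<ge> 0"
    unfolding ip_def using X by (intro sum_nonneg mult_nonneg_nonneg[OF zero_le_square]) (auto simp: less_imp_le)
  ultimately have pos: "ip X w q q > 0" by simp
  define c where "c = 1 / sqrt (ip X w q q)"
  have c: "c > 0" "c * c * ip X w q q = 1" using pos by (auto simp: c_def)
  have "is_onp X w k (Polynomial.smult c q)"
    using c dq ck orth' by (simp add: is_onp_def ip_smult_left ip_smult_right mult.assoc)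
  then show ?case by blast
qed

text \<open>After matching leading coefficients the difference has lower degree, so both polynomials
  are orthogonal to it and it is orthogonal to itself. Norm and sign fix the remaining
  factor.\<close>

lemma onp_unique:
  assumes X: "finite X" "\<And>x. x \<in> X \<Longrightarrow> w x > 0" and k: "k < card X"
    and p: "is_onp X w k p" and p': "is_onp X w k p'"
  shows "p = p'"
proof -
  define c where "c = lead_coeff p' / lead_coeff p"
  define q where "q = p' - Polynomial.smult c p"
  have "degree p = k" "degree p' = k" "lead_coeff p > 0" "lead_coeff p' > 0"
    using p p' by (auto simp: is_onp_def)
  then have c: "c > 0" and "coeff q k = 0" and "degree q \<le> k"
    by (auto simp: c_def q_def intro!: degree_diff_le order_trans[OF degree_smult_le])
  then have dq: "degree q < k \<or> q = 0"
    by (metis le_neq_implies_less leading_coeff_0_iff)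
  have "ip X w q q = 0"
    using dq
  proof
    assume "degree q < k"
    then have "ip X w p q = 0" "ip X w p' q = 0" using p p' by (auto simp: is_onp_def)
    then show ?thesis by (subst (1) q_def) (simp add: ip_diff_left ip_smult_left)
  qed (simp add: ip_def)
  then have "q = 0"
    using dq k ip_self_eq_0[OF X] by (intro poly_eq_0_of_card[of X q]) auto
  then have p'_eq: "p' = Polynomial.smult c p" by (simp add: q_def)
  then have "c\<^sup>2 = 1"
    using p p' by (simp add: is_onp_def ip_smult_left ip_smult_right power2_eq_square)
  then have "c = 1"
    using c by (auto simp: power2_eq_1_iff)
  then show ?thesis using p'_eq by simp
qed

locale orthonormal_polys =
  fixes X :: "int set" and w :: "int \<Rightarrow> real" and P :: "nat \<Rightarrow> real poly"
  assumes fin: "finite X" and w_pos: "\<And>x. x \<in> X \<Longrightarrow> w x > 0"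
    and onp: "\<And>k. k < card X \<Longrightarrow> is_onp X w k (P k)"
begin

lemma degree_P: "k < card X \<Longrightarrow> degree (P k) = k"
  and lead_P: "k < card X \<Longrightarrow> coeff (P k) k > 0"
  using onp[of k] by (auto simp: is_onp_def)

lemma ip_low: "k < card X \<Longrightarrow> degree q < k \<Longrightarrow> ip X w (P k) q = 0"
  using onp[of k] by (auto simp: is_onp_def)

lemma ip_P: "j < card X \<Longrightarrow> k < card X \<Longrightarrow> ip X w (P j) (P k) = (if j = k then 1 else 0)"
  using onp[of k] ip_low[of j "P k"] ip_low[of k "P j"] degree_P[of j] degree_P[of k]
    ip_commute[of X w "P j" "P k"]
  by (cases j k rule: linorder_cases) (auto simp: is_onp_def)

text \<open>Orthonormality says that a square matrix has orthonormal rows; then so are its columns.\<close>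

lemma complete:
  assumes x: "x \<in> X" "y \<in> X"
  shows "(\<Sum>k<card X. poly (P k) (of_int x) * poly (P k) (of_int y)) * w y = (if x = y then 1 else 0)"
proof -
  let ?d = "card X"
  obtain e where e: "bij_betw e {0..<?d} X"
    using ex_bij_betw_nat_finite[OF fin] by blast
  define A where "A = Matrix.mat ?d ?d (\<lambda>(k, i). poly (P k) (of_int (e i)) * sqrt (w (e i)))"
  have Ac: "A \<in> carrier_mat ?d ?d" by (simp add: A_def)
  have eX: "e i \<in> X" if "i < ?d" for i using e that by (auto simp: bij_betw_def)
  have "A * transpose_mat A = 1\<^sub>m ?d"
  proof (rule eq_matI)
    fix j k assume jk: "j < dim_row (1\<^sub>m ?d :: real mat)" "k < dim_col (1\<^sub>m ?d :: real mat)"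
    then have "(A * transpose_mat A) $$ (j, k)
      = (\<Sum>i = 0..<?d. poly (P j) (of_int (e i)) * poly (P k) (of_int (e i)) * w (e i))"
      using eX by (auto simp: A_def scalar_prod_def less_imp_le[OF w_pos] intro!: sum.cong)
    also have "\<dots> = ip X w (P j) (P k)"
      unfolding ip_def using sum.reindex_bij_betw[OF e, of
          "\<lambda>x. poly (P j) (of_int x) * poly (P k) (of_int x) * w x"] by simp
    finally show "(A * transpose_mat A) $$ (j, k) = 1\<^sub>m ?d $$ (j, k)"
      using jk by (simp add: ip_P)
  qed (simp_all add: A_def)
  then have AA: "transpose_mat A * A = 1\<^sub>m ?d"
    using mat_mult_left_right_inverse[OF Ac, of "transpose_mat A"] Ac by simp
  obtain i j where ij: "i < ?d" "j < ?d" "x = e i" "y = e j"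
    using x e unfolding bij_betw_def by (metis (no_types, lifting) atLeastLessThan_iff image_iff)
  then have inj: "i = j \<longleftrightarrow> x = y"
    using e by (auto simp: bij_betw_def inj_on_def)
  have "(transpose_mat A * A) $$ (i, j)
      = (\<Sum>k = 0..<?d. poly (P k) (of_int x) * sqrt (w x) * (poly (P k) (of_int y) * sqrt (w y)))"
    using ij by (simp add: A_def scalar_prod_def)
  also have "\<dots> = (\<Sum>k<?d. poly (P k) (of_int x) * poly (P k) (of_int y)) * (sqrt (w x) * sqrt (w y))"
    by (simp add: sum_distrib_left mult_ac lessThan_atLeast0)
  finally have eq: "(\<Sum>k<?d. poly (P k) (of_int x) * poly (P k) (of_int y)) * (sqrt (w x) * sqrt (w y))
      = (if x = y then 1 else 0)"
    using ij inj AA by simp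
  show ?thesis
  proof (cases "x = y")
    case True
    then show ?thesis using eq w_pos[OF x(2)] by simp
  next
    case False
    then have "(\<Sum>k<?d. poly (P k) (of_int x) * poly (P k) (of_int y)) = 0"
      using eq w_pos[OF x(1)] w_pos[OF x(2)] by auto
    then show ?thesis using False by simp
  qed
qed

text \<open>Expansion in the complete system. Only the values on X are claimed to vanish, since
  \<open>p\<close> may have degree card X or more.\<close>

lemma orthogonal_all_eq_0:
  assumes "\<And>k. k < card X \<Longrightarrow> ip X w p (P k) = 0" "y \<in> X"
  shows "poly p (of_int y) = 0"
proof -
  have "poly p (of_int y) = (\<Sum>x\<in>X. poly p (of_int x) * (if y = x then 1 else 0))"
    using fin assms(2) by (simp add: if_distrib cong: if_cong)
  also have "\<dots> = (\<Sum>x\<in>X. poly p (of_int x) *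
      ((\<Sum>k<card X. poly (P k) (of_int y) * poly (P k) (of_int x)) * w x))"
    by (intro sum.cong refl) (simp add: complete assms(2))
  also have "\<dots> = (\<Sum>k<card X. poly (P k) (of_int y) * ip X w p (P k))"
    unfolding ip_def by (simp add: sum_distrib_left sum_distrib_right mult_ac) (rule sum.swap)
  also have "\<dots> = 0" using assms(1) by simp
  finally show ?thesis .
qed

end

text \<open>Moving \<open>F\<close> to the other side as \<open>G\<close> shows
  \<open>F (P' k)\<close> orthogonal to \<open>P j\<close> for j < k, as \<open>G (P j)\<close> has
  degree at most j. After subtracting the right multiple of \<open>P k\<close> the degree bound
  gives orthogonality to the remaining \<open>P j\<close>. If k is not an index on X, no
  \<open>P j\<close> is left over and the image vanishes on X.\<close>

lemma onp_lowering_aux: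
  assumes "orthonormal_polys X w P" "orthonormal_polys X' w' P'"
    and F: "\<And>q k. degree q \<le> k \<Longrightarrow> degree (F q) \<le> k \<and> coeff (F q) k = \<mu>F k * coeff q k"
    and G: "\<And>q k. degree q \<le> k \<Longrightarrow> degree (G q) \<le> k \<and> coeff (G q) k = \<mu>G k * coeff q k"
    and adj: "\<And>q r. ip X w (F q) r = ip X' w' q (G r)"
    and k: "k < card X'" and x: "x \<in> X"
  shows "poly (F (P' k)) (of_int x)
    = (if k < card X then \<mu>F k * coeff (P' k) k / coeff (P k) k * poly (P k) (of_int x) else 0)"
proof -
  interpret o1: orthonormal_polys X w P by fact
  interpret o2: orthonormal_polys X' w' P' by fact
  have low: "ip X w (F (P' k)) (P j) = 0" if "j < k" "j < card X" for j
    unfolding adj using that G[of "P j" j] o1.degree_P[of j] k by (intro o2.ip_low) auto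
  show ?thesis
  proof (cases "k < card X")
    case True
    define \<gamma> where "\<gamma> = \<mu>F k * coeff (P' k) k / coeff (P k) k"
    define h where "h = F (P' k) - Polynomial.smult \<gamma> (P k)"
    have FP: "degree (F (P' k)) \<le> k" "coeff (F (P' k)) k = \<mu>F k * coeff (P' k) k"
      using F[of "P' k" k] o2.degree_P[OF k] by auto
    have "coeff h k = 0" "degree h \<le> k"
      using FP o1.lead_P[OF True] o1.degree_P[OF True] unfolding h_def \<gamma>_def
      by (auto intro!: degree_diff_le order_trans[OF degree_smult_le])
    then have dh: "degree h < k \<or> h = 0"
      by (metis le_neq_implies_less leading_coeff_0_iff)
    have "ip X w h (P j) = 0" if j: "j < card X" for j
    proof (cases "j < k")
      case True
      then show ?thesis
        using low[of j] j \<open>k < card X\<close> by (simp add: h_def ip_diff_left ip_smult_left o1.ip_P)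
    next
      case False
      then show ?thesis
        using dh o1.ip_low[OF j, of h] ip_commute[of X w h "P j"] by (auto simp: ip_def)
    qed
    then have "poly h (of_int x) = 0"
      by (rule o1.orthogonal_all_eq_0) (use x in auto)
    then show ?thesis
      using True by (simp add: h_def \<gamma>_def)
  next
    case False
    then show ?thesis
      using o1.orthogonal_all_eq_0[OF low x] by auto
  qed
qed

text \<open>The two factors \<open>\<mu>F k * l' / l\<close> and \<open>\<mu>G k * l / l'\<close>, with \<open>l\<close> and \<open>l'\<close> the leading
  coefficients, agree because \<open>F\<close> and \<open>G\<close> are adjoint, and their product is free of \<open>l\<close>, \<open>l'\<close>.\<close>

lemma onp_lowering:
  assumes P: "orthonormal_polys X w P" and P': "orthonormal_polys X' w' P'"
    and F: "\<And>q k. degree q \<le> k \<Longrightarrow> degree (F q) \<le> k \<and> coeff (F q) k = \<mu>F k * coeff q k"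
    and G: "\<And>q k. degree q \<le> k \<Longrightarrow> degree (G q) \<le> k \<and> coeff (G q) k = \<mu>G k * coeff q k"
    and adj: "\<And>q r. ip X w (F q) r = ip X' w' q (G r)"
    and pos: "k < card X \<Longrightarrow> \<mu>F k \<ge> 0"
    and k: "k < card X'" and x: "x \<in> X"
  shows "poly (F (P' k)) (of_int x)
    = (if k < card X then sqrt (\<mu>F k * \<mu>G k) * poly (P k) (of_int x) else 0)"
proof (cases "k < card X")
  case True
  interpret o1: orthonormal_polys X w P by fact
  interpret o2: orthonormal_polys X' w' P' by fact
  define l l' where "l = coeff (P k) k" and "l' = coeff (P' k) k"
  have l: "l > 0" "l' > 0" using o1.lead_P True o2.lead_P k by (auto simp: l_def l'_def)
  have 1: "poly (F (P' k)) (of_int x) = \<mu>F k * l' / l * poly (P k) (of_int x)" if "x \<in> X" for x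
    using onp_lowering_aux[OF P P' F G adj k that] True by (simp add: l_def l'_def)
  have 2: "poly (G (P k)) (of_int y) = \<mu>G k * l / l' * poly (P' k) (of_int y)" if "y \<in> X'" for y
    using onp_lowering_aux[OF P' P G F _ True that] k adj
    by (simp add: l_def l'_def ip_commute)
  have "ip X w (F (P' k)) (P k) = \<mu>F k * l' / l * ip X w (P k) (P k)"
    by (simp add: ip_def 1 sum_distrib_left mult_ac)
  moreover have "ip X' w' (P' k) (G (P k)) = \<mu>G k * l / l' * ip X' w' (P' k) (P' k)"
    by (simp add: ip_def 2 sum_distrib_left mult_ac)
  ultimately have eq: "\<mu>F k * l' / l = \<mu>G k * l / l'"
    using adj[of "P' k" "P k"] o1.ip_P[OF True True] o2.ip_P[OF k k] by simp
  have "(\<mu>F k * l' / l)\<^sup>2 = (\<mu>F k * l' / l) * (\<mu>G k * l / l')"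
    unfolding power2_eq_square by (subst (2) eq) simp
  also have "\<dots> = \<mu>F k * \<mu>G k"
    using l by simp
  finally have "sqrt (\<mu>F k * \<mu>G k) = \<mu>F k * l' / l"
    using pos True l by (intro real_sqrt_unique) auto
  then show ?thesis using True 1[OF x] by simp
qed (use onp_lowering_aux[OF P P' F G adj k x] in auto)


section \<open>Hahn polynomials and difference operators\<close>

text \<open>Everything below depends symmetrically on \<open>A = S\<close> and \<open>B = t\<close>, so that the matrices for
  \<open>t\<close> and for \<open>S\<close> are instances of the same two families.\<close>

definition pts :: "nat \<Rightarrow> nat \<Rightarrow> int \<Rightarrow> int \<Rightarrow> int set" where
  "pts N T A B = {max 0 (A + B - int T)..min (A + int N - 1) (B + int N - 1)}"

definition wt :: "nat \<Rightarrow> nat \<Rightarrow> int \<Rightarrow> int \<Rightarrow> int \<Rightarrow> real" where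
  "wt N T A B x = 1 / (fact (nat x) * fact (nat (A + int N - 1 - x)) * fact (nat (B + int N - 1 - x))
     * fact (nat (int T - A - B + x)))"

definition num_pts :: "nat \<Rightarrow> nat \<Rightarrow> int \<Rightarrow> int \<Rightarrow> nat" where
  "num_pts N T A B = N + nat (min (min A B) (min (int T - A) (int T - B)))"

definition hahn_poly :: "nat \<Rightarrow> nat \<Rightarrow> int \<Rightarrow> int \<Rightarrow> nat \<Rightarrow> real poly" where
  "hahn_poly N T A B k = (THE p. is_onp (pts N T A B) (wt N T A B) k p)"

text \<open>\<open>\<Psi>\<close> without the square root of the weight, so that the difference
  operators acting on it have affine coefficients.\<close>

definition hahn_val :: "nat \<Rightarrow> nat \<Rightarrow> int \<Rightarrow> int \<Rightarrow> nat \<Rightarrow> int \<Rightarrow> real" where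
  "hahn_val N T A B k x = (if k < num_pts N T A B then poly (hahn_poly N T A B k) (of_int x) else 0)"

lemma pts_commute: "pts N T A B = pts N T B A"
  by (auto simp: pts_def)

lemma wt_commute: "wt N T A B = wt N T B A"
  by (auto simp: wt_def fun_eq_iff mult_ac algebra_simps)

lemma num_pts_commute: "num_pts N T A B = num_pts N T B A"
  by (simp add: num_pts_def min.commute)

lemma hahn_poly_commute: "hahn_poly N T A B = hahn_poly N T B A"
  by (simp add: hahn_poly_def fun_eq_iff pts_commute[of N T A B] wt_commute[of N T A B])

lemma hahn_val_commute: "hahn_val N T A B = hahn_val N T B A"
  by (simp add: hahn_val_def fun_eq_iff hahn_poly_commute[of N T A B] num_pts_commute[of N T A B])

lemma finite_pts: "finite (pts N T A B)"
  by (simp add: pts_def)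

lemma wt_pos: "wt N T A B x > 0"
  by (simp add: wt_def)

lemma card_pts:
  assumes "0 \<le> A" "A \<le> int T" "0 \<le> B" "B \<le> int T"
  shows "card (pts N T A B) = num_pts N T A B"
  using assms by (auto simp: pts_def num_pts_def)

lemma points_eq_pts: "points N T S t = pts N T S (int t)"
  by (auto simp: points_def pts_def)

lemma weight_eq_wt: "weight N T S t = wt N T S (int t)"
  by (auto simp: weight_def wt_def fun_eq_iff mult_ac algebra_simps)

lemma hahn_eq_hahn_poly: "hahn N T S t = hahn_poly N T S (int t)"
  by (simp add: fun_eq_iff hahn_def hahn_poly_def is_onp_def ip_def points_eq_pts weight_eq_wt
      power2_eq_square)

lemma \<Psi>_eq_hahn_val:
  assumes "0 \<le> S" "S \<le> int T" "t \<le> T"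
  shows "\<Psi> N T S t k x = hahn_val N T S (int t) k x * sqrt (wt N T S (int t) x)"
  using assms by (simp add: \<Psi>_def hahn_val_def points_eq_pts card_pts hahn_eq_hahn_poly weight_eq_wt)

lemma orthonormal_hahn: "orthonormal_polys (pts N T A B) (wt N T A B) (hahn_poly N T A B)"
proof
  fix k assume k: "k < card (pts N T A B)"
  obtain p where p: "is_onp (pts N T A B) (wt N T A B) k p"
    using ex_onp[of "pts N T A B" "wt N T A B" k, OF finite_pts wt_pos k] by blast
  then show "is_onp (pts N T A B) (wt N T A B) k (hahn_poly N T A B k)"
    unfolding hahn_poly_def by (rule theI) (rule onp_unique[OF finite_pts wt_pos k _ p])
qed (simp_all add: finite_pts wt_pos)

section \<open>The adjoint pair of operators between B and B + 1\<close>

definition up_u :: "nat \<Rightarrow> int \<Rightarrow> int \<Rightarrow> real" where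
  "up_u N A x = of_int (int N + A - x - 1)"
definition up_b :: "nat \<Rightarrow> int \<Rightarrow> int \<Rightarrow> int \<Rightarrow> real" where
  "up_b T A B x = of_int (x + int T - A - B)"
definition dn_u :: "int \<Rightarrow> real" where
  "dn_u x = of_int x"
definition dn_b :: "nat \<Rightarrow> int \<Rightarrow> int \<Rightarrow> real" where
  "dn_b N B x = of_int (B + int N - x)"

lemma up_affine:
  "up_u N A = (\<lambda>x. of_int (int N + A - 1) + (- 1) * of_int x)"
  "up_b T A B = (\<lambda>x. of_int (int T - A - B) - (- 1) * of_int x)"
  by (auto simp: up_u_def up_b_def)

lemma dn_affine:
  "dn_u = (\<lambda>x. 0 + 1 * of_int x)" "dn_b N B = (\<lambda>x. of_int (B + int N) - 1 * of_int x)"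
  by (auto simp: dn_u_def dn_b_def)

definition up_poly :: "nat \<Rightarrow> nat \<Rightarrow> int \<Rightarrow> int \<Rightarrow> real poly \<Rightarrow> real poly" where
  "up_poly N T A B = hop_poly 1 (of_int (int N + A - 1)) (- 1) (of_int (int T - A - B))"
definition dn_poly :: "nat \<Rightarrow> int \<Rightarrow> real poly \<Rightarrow> real poly" where
  "dn_poly N B = hop_poly (- 1) 0 1 (of_int (B + int N))"

lemma poly_up_poly:
  "poly (up_poly N T A B q) (of_int x) = hop 1 (up_u N A) (up_b T A B) (\<lambda>y. poly q (of_int y)) x"
  unfolding up_poly_def up_affine poly_hop_poly ..

lemma poly_dn_poly:
  "poly (dn_poly N B q) (of_int x) = hop (- 1) dn_u (dn_b N B) (\<lambda>y. poly q (of_int y)) x"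
  unfolding dn_poly_def dn_affine poly_hop_poly ..

definition lam_up :: "nat \<Rightarrow> nat \<Rightarrow> int \<Rightarrow> nat \<Rightarrow> real" where
  "lam_up N T B k = of_int (int T + int N - B - 1) - of_nat k"
definition lam_dn :: "nat \<Rightarrow> int \<Rightarrow> nat \<Rightarrow> real" where
  "lam_dn N B k = of_int (B + int N) - of_nat k"

lemma up_poly_coeff:
  "degree q \<le> k \<Longrightarrow> degree (up_poly N T A B q) \<le> k
    \<and> coeff (up_poly N T A B q) k = lam_up N T B k * coeff q k"
  using hop_poly_coeff[of q k] by (simp add: up_poly_def lam_up_def)

lemma dn_poly_coeff:
  "degree q \<le> k \<Longrightarrow> degree (dn_poly N B q) \<le> k
    \<and> coeff (dn_poly N B q) k = lam_dn N B k * coeff q k"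
  using hop_poly_coeff[of q k] by (simp add: dn_poly_def lam_dn_def)

lemma fact_nat_rec: "y > 0 \<Longrightarrow> fact (nat y) = (of_int y :: real) * fact (nat (y - 1))"
  by (subst fact_reduce) (auto simp: nat_diff_distrib')

text \<open>Detailed balance between the step from y - 1 to y and its reversal;
  \<open>wt_stay\<close> is the analogue for staying. The bounds make the factorial recursions
  valid.\<close>

lemma wt_shift:
  assumes "0 < y" "y \<le> A + int N - 1"
  shows "up_u N A (y - 1) * wt N T A B (y - 1) = dn_u y * wt N T A (B + 1) y"
proof -
  have 1: "fact (nat y) = (of_int y :: real) * fact (nat (y - 1))"
    by (rule fact_nat_rec) (use assms in auto)
  have 2: "fact (nat (A + int N - y)) = (of_int (A + int N - y) :: real) * fact (nat (A + int N - 1 - y))"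
    using fact_nat_rec[of "A + int N - y"] assms by (simp add: algebra_simps)
  have 3: "A + int N - 1 - (y - 1) = A + int N - y" "B + int N - 1 - (y - 1) = B + int N - y"
    "B + 1 + int N - 1 - y = B + int N - y" "int T - A - (B + 1) + y = int T - A - B + (y - 1)"
    by auto
  have "c * (1 / (f1 * (c * f2) * f3 * f4)) = d * (1 / (d * f1 * f2 * f3 * f4))"
    if "c \<noteq> 0" "d \<noteq> 0" for c d f1 f2 f3 f4 :: real
    using that by simp
  moreover have "up_u N A (y - 1) = of_int (A + int N - y)" "real_of_int (A + int N - y) \<noteq> 0" "real_of_int y \<noteq> 0"
    using assms by (auto simp: up_u_def)
  ultimately show ?thesis
    unfolding wt_def 3 1 2 dn_u_def by metis
qed

lemma wt_stay:
  assumes "A + B - int T < y" "y \<le> B + int N - 1"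
  shows "up_b T A B y * wt N T A B y = dn_b N B y * wt N T A (B + 1) y"
proof -
  have 1: "fact (nat (B + int N - y)) = (of_int (B + int N - y) :: real) * fact (nat (B + int N - 1 - y))"
    using fact_nat_rec[of "B + int N - y"] assms by (simp add: algebra_simps)
  have 2: "fact (nat (int T - A - B + y)) = (of_int (int T - A - B + y) :: real) * fact (nat (int T - A - (B + 1) + y))"
    using fact_nat_rec[of "int T - A - B + y"] assms by (simp add: algebra_simps)
  have 3: "B + 1 + int N - 1 - y = B + int N - y" by auto
  have "c * (1 / (f1 * f2 * f3 * (c * f4))) = d * (1 / (f1 * f2 * (d * f3) * f4))"
    if "c \<noteq> 0" "d \<noteq> 0" for c d f1 f2 f3 f4 :: real
    using that by simp
  moreover have "up_b T A B y = of_int (int T - A - B + y)" "dn_b N B y = of_int (B + int N - y)"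
    "real_of_int (B + int N - y) \<noteq> 0" "real_of_int (int T - A - B + y) \<noteq> 0"
    using assms by (auto simp: up_b_def dn_b_def)
  ultimately show ?thesis
    unfolding wt_def 3 1 2 by metis
qed

text \<open>Summation by parts: \<open>up\<close> takes functions at B + 1 to functions at B,
  \<open>dn\<close> the other way, and detailed balance matches the terms. Endpoint terms without a
  partner have coefficient 0.\<close>

lemma up_dn_adjoint:
  assumes "0 \<le> A" "A \<le> int T" "0 \<le> B" "B < int T"
  shows "ip (pts N T A B) (wt N T A B) (up_poly N T A B q) r
    = ip (pts N T A (B + 1)) (wt N T A (B + 1)) q (dn_poly N B r)"
proof -
  let ?X = "pts N T A B" and ?X' = "pts N T A (B + 1)"
  let ?w = "wt N T A B" and ?w' = "wt N T A (B + 1)"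
  let ?q = "\<lambda>x. poly q (real_of_int x)" and ?r = "\<lambda>x. poly r (real_of_int x)"
  have "ip ?X ?w (up_poly N T A B q) r
      = (\<Sum>x\<in>?X. up_u N A x * ?w x * ?q (x + 1) * ?r x) + (\<Sum>x\<in>?X. up_b T A B x * ?w x * ?q x * ?r x)"
    by (simp add: ip_def poly_up_poly hop_def sum.distrib[symmetric] algebra_simps)
  also have "(\<Sum>x\<in>?X. up_u N A x * ?w x * ?q (x + 1) * ?r x)
      = (\<Sum>x\<in>{x\<in>?X. x < A + int N - 1}. up_u N A x * ?w x * ?q (x + 1) * ?r x)"
    by (intro sum.mono_neutral_right finite_pts) (auto simp: pts_def up_u_def)
  also have "\<dots> = (\<Sum>y\<in>{y\<in>?X'. 0 < y}. dn_u y * ?w' y * ?q y * ?r (y - 1))"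
  proof (rule sum.reindex_bij_witness[where i = "\<lambda>y. y - 1" and j = "\<lambda>x. x + 1"], goal_cases)
    case (5 x)
    then show ?case using wt_shift[of "x + 1" A N T B] by (auto simp: pts_def)
  qed (use assms in \<open>auto simp: pts_def\<close>)
  also have "\<dots> = (\<Sum>y\<in>?X'. dn_u y * ?w' y * ?q y * ?r (y - 1))"
    by (intro sum.mono_neutral_left finite_pts) (auto simp: pts_def dn_u_def)
  also have "(\<Sum>x\<in>?X. up_b T A B x * ?w x * ?q x * ?r x)
      = (\<Sum>x\<in>{x\<in>?X. A + B - int T < x}. up_b T A B x * ?w x * ?q x * ?r x)"
    by (intro sum.mono_neutral_right finite_pts) (auto simp: pts_def up_b_def)
  also have "\<dots> = (\<Sum>y\<in>{y\<in>?X'. y < B + int N}. dn_b N B y * ?w' y * ?q y * ?r y)"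
  proof (rule sum.cong)
    show "{x\<in>?X. A + B - int T < x} = {y\<in>?X'. y < B + int N}"
      by (auto simp: pts_def)
    fix x assume "x \<in> {y\<in>?X'. y < B + int N}"
    then show "up_b T A B x * ?w x * ?q x * ?r x = dn_b N B x * ?w' x * ?q x * ?r x"
      using wt_stay[of A B T x N] by (auto simp: pts_def)
  qed
  also have "\<dots> = (\<Sum>y\<in>?X'. dn_b N B y * ?w' y * ?q y * ?r y)"
    by (intro sum.mono_neutral_left finite_pts) (auto simp: pts_def dn_b_def)
  also have "(\<Sum>y\<in>?X'. dn_u y * ?w' y * ?q y * ?r (y - 1)) + \<dots> = ip ?X' ?w' q (dn_poly N B r)"
    by (simp add: ip_def poly_dn_poly hop_def sum.distrib[symmetric] algebra_simps)
  finally show ?thesis .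
qed

text \<open>By \<open>onp_lowering\<close> the geometric mean of the two diagonal entries is the
  eigenvalue shared by the adjoint pair.\<close>

definition lam :: "nat \<Rightarrow> nat \<Rightarrow> int \<Rightarrow> nat \<Rightarrow> real" where
  "lam N T B k = sqrt (lam_up N T B k * lam_dn N B k)"

lemma
  assumes "0 \<le> A" "A \<le> int T" "0 \<le> B" "B < int T"
  shows hop_up_hahn_poly: "k < num_pts N T A (B + 1) \<Longrightarrow> x \<in> pts N T A B \<Longrightarrow>
      hop 1 (up_u N A) (up_b T A B) (\<lambda>y. poly (hahn_poly N T A (B + 1) k) (of_int y)) x
        = lam N T B k * hahn_val N T A B k x"
    and hop_dn_hahn_poly: "k < num_pts N T A B \<Longrightarrow> x \<in> pts N T A (B + 1) \<Longrightarrow>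
      hop (- 1) dn_u (dn_b N B) (\<lambda>y. poly (hahn_poly N T A B k) (of_int y)) x
        = lam N T B k * hahn_val N T A (B + 1) k x"
proof -
  have c: "card (pts N T A B) = num_pts N T A B" "card (pts N T A (B + 1)) = num_pts N T A (B + 1)"
    using assms by (auto intro!: card_pts)
  assume k: "k < num_pts N T A (B + 1)" "x \<in> pts N T A B"
  then have "poly (up_poly N T A B (hahn_poly N T A (B + 1) k)) (of_int x)
    = (if k < card (pts N T A B) then sqrt (lam_up N T B k * lam_dn N B k)
        * poly (hahn_poly N T A B k) (of_int x) else 0)"
    by (intro onp_lowering[OF orthonormal_hahn orthonormal_hahn up_poly_coeff dn_poly_coeff
          up_dn_adjoint[OF assms]])
       (use assms in \<open>auto simp: c lam_up_def num_pts_def\<close>)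
  then show "hop 1 (up_u N A) (up_b T A B) (\<lambda>y. poly (hahn_poly N T A (B + 1) k) (of_int y)) x
        = lam N T B k * hahn_val N T A B k x"
    by (simp add: poly_up_poly c lam_def hahn_val_def)
next
  have c: "card (pts N T A B) = num_pts N T A B" "card (pts N T A (B + 1)) = num_pts N T A (B + 1)"
    using assms by (auto intro!: card_pts)
  assume k: "k < num_pts N T A B" "x \<in> pts N T A (B + 1)"
  have adj: "ip (pts N T A (B + 1)) (wt N T A (B + 1)) (dn_poly N B q) r
    = ip (pts N T A B) (wt N T A B) q (up_poly N T A B r)" for q r
    using up_dn_adjoint[OF assms, of N r q] by (simp add: ip_commute)
  have "poly (dn_poly N B (hahn_poly N T A B k)) (of_int x)
    = (if k < card (pts N T A (B + 1)) then sqrt (lam_dn N B k * lam_up N T B k)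
        * poly (hahn_poly N T A (B + 1) k) (of_int x) else 0)"
    by (intro onp_lowering[OF orthonormal_hahn orthonormal_hahn dn_poly_coeff up_poly_coeff adj])
       (use assms k in \<open>auto simp: c lam_dn_def num_pts_def\<close>)
  then show "hop (- 1) dn_u (dn_b N B) (\<lambda>y. poly (hahn_poly N T A B k) (of_int y)) x
        = lam N T B k * hahn_val N T A (B + 1) k x"
    by (simp add: poly_dn_poly c lam_def hahn_val_def mult.commute)
qed

lemma hop_zero: "hop \<sigma> u b (\<lambda>y. 0) x = 0"
  by (simp add: hop_def)

text \<open>If k is not an index at the source, the left side is 0 although k may be an index at the
  target; one of the other alternatives must then make the right side 0.\<close>

lemma
  assumes "0 \<le> A" "A \<le> int T" "0 \<le> B" "B < int T"
  shows hop_up_hahn_val: "k < num_pts N T A (B + 1) \<or> hahn_val N T A B k x = 0 \<or> lam N T B k = 0 \<Longrightarrow>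
      x \<in> pts N T A B \<Longrightarrow> hop 1 (up_u N A) (up_b T A B) (hahn_val N T A (B + 1) k) x
        = lam N T B k * hahn_val N T A B k x"
    and hop_dn_hahn_val: "k < num_pts N T A B \<or> hahn_val N T A (B + 1) k x = 0 \<or> lam N T B k = 0 \<Longrightarrow>
      x \<in> pts N T A (B + 1) \<Longrightarrow> hop (- 1) dn_u (dn_b N B) (hahn_val N T A B k) x
        = lam N T B k * hahn_val N T A (B + 1) k x"
proof -
  assume k: "k < num_pts N T A (B + 1) \<or> hahn_val N T A B k x = 0 \<or> lam N T B k = 0" "x \<in> pts N T A B"
  show "hop 1 (up_u N A) (up_b T A B) (hahn_val N T A (B + 1) k) x = lam N T B k * hahn_val N T A B k x"
  proof (cases "k < num_pts N T A (B + 1)")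
    case True
    then have "hahn_val N T A (B + 1) k = (\<lambda>y. poly (hahn_poly N T A (B + 1) k) (of_int y))"
      by (simp add: hahn_val_def fun_eq_iff)
    then show ?thesis using hop_up_hahn_poly[OF assms True k(2)] by simp
  next
    case False
    then have "hahn_val N T A (B + 1) k = (\<lambda>y. 0)" by (simp add: hahn_val_def fun_eq_iff)
    then show ?thesis using False k(1) by (auto simp: hop_zero)
  qed
next
  assume k: "k < num_pts N T A B \<or> hahn_val N T A (B + 1) k x = 0 \<or> lam N T B k = 0" "x \<in> pts N T A (B + 1)"
  show "hop (- 1) dn_u (dn_b N B) (hahn_val N T A B k) x = lam N T B k * hahn_val N T A (B + 1) k x"
  proof (cases "k < num_pts N T A B")
    case True
    then have "hahn_val N T A B k = (\<lambda>y. poly (hahn_poly N T A B k) (of_int y))"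
      by (simp add: hahn_val_def fun_eq_iff)
    then show ?thesis using hop_dn_hahn_poly[OF assms True k(2)] by simp
  next
    case False
    then have "hahn_val N T A B k = (\<lambda>y. 0)" by (simp add: hahn_val_def fun_eq_iff)
    then show ?thesis using False k(1) by (auto simp: hop_zero)
  qed
qed

lemma hahn_val_complete:
  assumes "0 \<le> A" "A \<le> int T" "0 \<le> B" "B \<le> int T" "x \<in> pts N T A B" "y \<in> pts N T A B"
    and D: "num_pts N T A B \<le> D"
  shows "(\<Sum>k<D. hahn_val N T A B k x * hahn_val N T A B k y) * wt N T A B y = (if x = y then 1 else 0)"
proof -
  interpret orthonormal_polys "pts N T A B" "wt N T A B" "hahn_poly N T A B"
    by (rule orthonormal_hahn)
  have "(\<Sum>k<D. hahn_val N T A B k x * hahn_val N T A B k y)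
      = (\<Sum>k<num_pts N T A B. hahn_val N T A B k x * hahn_val N T A B k y)"
    using D by (intro sum.mono_neutral_right) (auto simp: hahn_val_def)
  also have "\<dots> = (\<Sum>k<num_pts N T A B. poly (hahn_poly N T A B k) (of_int x) * poly (hahn_poly N T A B k) (of_int y))"
    by (simp add: hahn_val_def)
  finally show ?thesis
    using complete[of x y] assms card_pts[OF assms(1-4), of N] by simp
qed

text \<open>\<open>c_t_plus\<close> is the eigenvalue divided by its value at k = 0, a positive
  factor common to all k.\<close>

lemma lam_eq_c_t_plus:
  assumes "t < T" "N \<ge> 1"
  shows "lam N T (int t) k = lam N T (int t) 0 * c_t_plus N T S t k"
proof -
  have "real T + real N - real t - 1 > 0" "real t + real N > 0" using assms by auto
  then have "lam_up N T (int t) k * lam_dn N (int t) k = lam_up N T (int t) 0 * lam_dn N (int t) 0 *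
      ((1 - real k / (real t + real N)) * (1 - real k / (real T + real N - real t - 1)))"
    unfolding lam_up_def lam_dn_def by (simp add: divide_simps)
  then show ?thesis
    by (simp add: lam_def c_t_plus_def real_sqrt_mult)
qed

lemma lam_eq_c_S_plus:
  assumes "0 \<le> S" "S < int T" "N \<ge> 1"
  shows "lam N T S k = lam N T S 0 * c_S_plus N T S t k"
  using lam_eq_c_t_plus[of "nat S" T N k S] assms by (simp add: c_t_plus_def c_S_plus_def add.commute algebra_simps)

lemma lam_0_pos: "0 \<le> B \<Longrightarrow> B < int T \<Longrightarrow> N \<ge> 1 \<Longrightarrow> lam N T B 0 > 0"
  by (simp add: lam_def lam_up_def lam_dn_def)


section \<open>Intertwined Markov chains of trajectories\<close>

definition trajs :: "(nat \<Rightarrow> 'a set) \<Rightarrow> nat \<Rightarrow> 'a list set" where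
  "trajs A t = {X. length X = Suc t \<and> (\<forall>s\<le>t. X ! s \<in> A s)}"

definition wgt :: "(nat \<Rightarrow> 'a \<Rightarrow> 'a \<Rightarrow> real) \<Rightarrow> nat \<Rightarrow> 'a list \<Rightarrow> real" where
  "wgt P t X = (\<Prod>s<t. P s (X ! s) (X ! Suc s))"

lemma trajs_0: "trajs A 0 = (\<lambda>x. [x]) ` A 0"
  by (auto simp: trajs_def length_Suc_conv)

lemma trajs_Suc: "trajs A (Suc t) = (\<lambda>(X, z). X @ [z]) ` (trajs A t \<times> A (Suc t))"
proof (intro equalityI subsetI)
  fix X assume X: "X \<in> trajs A (Suc t)"
  then have "X = take (Suc t) X @ [X ! Suc t]"
    by (simp add: trajs_def take_Suc_conv_app_nth[symmetric])
  moreover have "take (Suc t) X \<in> trajs A t" "X ! Suc t \<in> A (Suc t)"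
    using X by (auto simp: trajs_def)
  ultimately show "X \<in> (\<lambda>(X, z). X @ [z]) ` (trajs A t \<times> A (Suc t))"
    by (metis (no_types, lifting) SigmaI case_prod_conv image_eqI)
qed (auto simp: trajs_def nth_append le_Suc_eq)

lemma finite_trajs: "(\<And>s. s \<le> t \<Longrightarrow> finite (A s)) \<Longrightarrow> finite (trajs A t)"
  by (induction t) (auto simp: trajs_0 trajs_Suc)

lemma sum_trajs_0: "(\<Sum>X\<in>trajs A 0. f X) = (\<Sum>x\<in>A 0. f [x])"
  unfolding trajs_0 by (subst sum.reindex) (auto simp: inj_on_def)

lemma sum_trajs_Suc:
  "(\<Sum>X\<in>trajs A (Suc t). f X) = (\<Sum>X\<in>trajs A t. \<Sum>z\<in>A (Suc t). f (X @ [z]))"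
proof -
  have "inj_on (\<lambda>(X, z). X @ [z]) (trajs A t \<times> A (Suc t))"
    by (auto simp: inj_on_def)
  then show ?thesis
    unfolding trajs_Suc by (subst sum.reindex) (auto simp: sum.cartesian_product intro!: sum.cong)
qed

lemma trajs_length: "X \<in> trajs A t \<Longrightarrow> length X = Suc t"
  by (simp add: trajs_def)

lemma trajs_nth: "X \<in> trajs A t \<Longrightarrow> s \<le> t \<Longrightarrow> X ! s \<in> A s"
  by (simp add: trajs_def)

lemma wgt_cong: "(\<And>s. s \<le> t \<Longrightarrow> X ! s = Y ! s) \<Longrightarrow> wgt P t X = wgt P t Y"
  unfolding wgt_def by (intro prod.cong) auto

lemma wgt_snoc: "X \<in> trajs A t \<Longrightarrow> wgt P (Suc t) (X @ [z]) = wgt P t X * P t (X ! t) z"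
  using trajs_length[of X A t] wgt_cong[of t "X @ [z]" X P] by (simp add: wgt_def nth_append)

text \<open>\<open>A\<close>, \<open>P\<close> are the slices and steps of the old family X, and
  \<open>B\<close>, \<open>Q\<close> those of the new family Y. The link \<open>\<Lambda>\<close>
  runs from the new slice back to the old one, as in the denominators of the Markov step.\<close>

locale intertwining =
  fixes T :: nat and A B :: "nat \<Rightarrow> 'a set" and P Q \<Lambda> :: "nat \<Rightarrow> 'a \<Rightarrow> 'a \<Rightarrow> real" and a0 b0 :: 'a
  assumes finA: "\<And>t. t \<le> T \<Longrightarrow> finite (A t)" and finB: "\<And>t. t \<le> T \<Longrightarrow> finite (B t)"
    and P_nonneg: "\<And>t x y. t < T \<Longrightarrow> x \<in> A t \<Longrightarrow> y \<in> A (Suc t) \<Longrightarrow> P t x y \<ge> 0"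
    and Q_nonneg: "\<And>t x y. t < T \<Longrightarrow> x \<in> B t \<Longrightarrow> y \<in> B (Suc t) \<Longrightarrow> Q t x y \<ge> 0"
    and \<Lambda>_nonneg: "\<And>t x y. t \<le> T \<Longrightarrow> x \<in> B t \<Longrightarrow> y \<in> A t \<Longrightarrow> \<Lambda> t x y \<ge> 0"
    and commute: "\<And>t y x. t < T \<Longrightarrow> y \<in> B t \<Longrightarrow> x \<in> A (Suc t) \<Longrightarrow>
      (\<Sum>z\<in>B (Suc t). Q t y z * \<Lambda> (Suc t) z x) = (\<Sum>z\<in>A t. \<Lambda> t y z * P t z x)"
    and A0: "A 0 = {a0}" and B0: "B 0 = {b0}" and \<Lambda>0: "\<Lambda> 0 b0 a0 = 1"
begin

definition den :: "nat \<Rightarrow> 'a \<Rightarrow> 'a \<Rightarrow> real" where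
  "den t y x = (\<Sum>z\<in>B (Suc t). Q t y z * \<Lambda> (Suc t) z x)"

definition upd :: "nat \<Rightarrow> 'a list \<Rightarrow> 'a list \<Rightarrow> real" where
  "upd t X Y = (\<Prod>s<t. Q s (Y ! s) (Y ! Suc s) * \<Lambda> (Suc s) (Y ! Suc s) (X ! Suc s)
     / den s (Y ! s) (X ! Suc s))"

lemma upd_cong:
  "(\<And>s. s \<le> t \<Longrightarrow> X ! s = X' ! s) \<Longrightarrow> (\<And>s. s \<le> t \<Longrightarrow> Y ! s = Y' ! s) \<Longrightarrow> upd t X Y = upd t X' Y'"
  unfolding upd_def by (intro prod.cong) auto

lemma upd_snoc:
  assumes "length X \<ge> Suc t" "Y \<in> trajs B t"
  shows "upd (Suc t) X (Y @ [z]) = upd t X Y *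
    (Q t (Y ! t) z * \<Lambda> (Suc t) z (X ! Suc t) / den t (Y ! t) (X ! Suc t))"
  using trajs_length[OF assms(2)] upd_cong[of t X X "Y @ [z]" Y] by (simp add: upd_def nth_append)

lemma den_zero:
  assumes "t < T" "y \<in> B t" "x \<in> A (Suc t)" "z \<in> B (Suc t)" "den t y x = 0"
  shows "Q t y z * \<Lambda> (Suc t) z x = 0"
  using assms finB[of "Suc t"] Q_nonneg[of t y] \<Lambda>_nonneg[of "Suc t" _ x] unfolding den_def
  by (subst (asm) sum_nonneg_eq_0_iff) (auto intro!: mult_nonneg_nonneg)

text \<open>Sum out \<open>X(0), X(1), \<dots>\<close> in this order: by the commutation relation the sum over \<open>X(s)\<close>
  reproduces the denominator of the next factor.\<close>

lemma sum_wgt_upd: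
  assumes "t \<le> T" "Y \<in> trajs B t"
  shows "(\<Sum>X\<in>trajs A t. wgt P t X * upd t X Y * h (X ! t))
    = wgt Q t Y * (\<Sum>x\<in>A t. \<Lambda> t (Y ! t) x * h x)"
  using assms
proof (induction t arbitrary: Y h)
  case 0
  then have "Y ! 0 = b0" using B0 by (auto simp: trajs_0)
  then show ?case by (simp add: sum_trajs_0 A0 wgt_def upd_def \<Lambda>0)
next
  case (Suc t)
  from Suc.prems(2) obtain Y' y where Y: "Y = Y' @ [y]" "Y' \<in> trajs B t" "y \<in> B (Suc t)"
    by (auto simp: trajs_Suc)
  have len: "length Y' = Suc t" using trajs_length[OF Y(2)] .
  have Yt: "Y' ! t \<in> B t" using trajs_nth[OF Y(2)] by simp
  define c where "c x = Q t (Y' ! t) y * \<Lambda> (Suc t) y x / den t (Y' ! t) x * h x" for x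
  have "(\<Sum>X\<in>trajs A (Suc t). wgt P (Suc t) X * upd (Suc t) X Y * h (X ! Suc t))
    = (\<Sum>X\<in>trajs A t. \<Sum>x\<in>A (Suc t). c x * (wgt P t X * upd t X Y' * P t (X ! t) x))"
    unfolding sum_trajs_Suc
  proof (intro sum.cong refl)
    fix X x assume X: "X \<in> trajs A t"
    then have "upd (Suc t) (X @ [x]) Y = upd t (X @ [x]) Y' *
        (Q t (Y' ! t) y * \<Lambda> (Suc t) y x / den t (Y' ! t) x)"
      unfolding Y(1) using trajs_length[OF X] by (subst upd_snoc) (auto simp: Y nth_append)
    also have "upd t (X @ [x]) Y' = upd t X Y'"
      by (rule upd_cong) (use trajs_length[OF X] in \<open>auto simp: nth_append\<close>)
    finally show "wgt P (Suc t) (X @ [x]) * upd (Suc t) (X @ [x]) Y * h ((X @ [x]) ! Suc t)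
        = c x * (wgt P t X * upd t X Y' * P t (X ! t) x)"
      using trajs_length[OF X] by (simp add: wgt_snoc[OF X] c_def nth_append)
  qed
  also have "\<dots> = (\<Sum>x\<in>A (Suc t). c x * (\<Sum>X\<in>trajs A t. wgt P t X * upd t X Y' * P t (X ! t) x))"
    by (subst sum.swap) (simp add: sum_distrib_left)
  also have "\<dots> = (\<Sum>x\<in>A (Suc t). c x * (wgt Q t Y' * den t (Y' ! t) x))"
  proof (intro sum.cong refl)
    fix x assume x: "x \<in> A (Suc t)"
    have "(\<Sum>X\<in>trajs A t. wgt P t X * upd t X Y' * P t (X ! t) x)
        = wgt Q t Y' * (\<Sum>z\<in>A t. \<Lambda> t (Y' ! t) z * P t z x)"
      using Suc.IH[of Y' "\<lambda>z. P t z x"] Suc.prems Y(2) by simp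
    also have "(\<Sum>z\<in>A t. \<Lambda> t (Y' ! t) z * P t z x) = den t (Y' ! t) x"
      using commute[of t "Y' ! t" x] Suc.prems Yt x by (simp add: den_def)
    finally show "c x * (\<Sum>X\<in>trajs A t. wgt P t X * upd t X Y' * P t (X ! t) x)
        = c x * (wgt Q t Y' * den t (Y' ! t) x)" by simp
  qed
  also have "\<dots> = (\<Sum>x\<in>A (Suc t). wgt Q t Y' * Q t (Y' ! t) y * (\<Lambda> (Suc t) y x * h x))"
  proof (intro sum.cong refl)
    fix x assume x: "x \<in> A (Suc t)"
    \<comment> \<open>Cancelling is valid even for denominator 0: it is a sum of nonnegative terms,
      and this numerator is one of them.\<close>
    have "Q t (Y' ! t) y * \<Lambda> (Suc t) y x / den t (Y' ! t) x * den t (Y' ! t) x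
        = Q t (Y' ! t) y * \<Lambda> (Suc t) y x"
      using den_zero[of t "Y' ! t" x y] Suc.prems Yt x Y(3) by (cases "den t (Y' ! t) x = 0") auto
    moreover have "c x * (wgt Q t Y' * den t (Y' ! t) x)
      = wgt Q t Y' * h x * (Q t (Y' ! t) y * \<Lambda> (Suc t) y x / den t (Y' ! t) x * den t (Y' ! t) x)"
      by (simp add: c_def)
    ultimately show "c x * (wgt Q t Y' * den t (Y' ! t) x)
        = wgt Q t Y' * Q t (Y' ! t) y * (\<Lambda> (Suc t) y x * h x)"
      by (simp only: mult_ac)
  qed
  also have "\<dots> = wgt Q (Suc t) Y * (\<Sum>x\<in>A (Suc t). \<Lambda> (Suc t) (Y ! Suc t) x * h x)"
    using len wgt_snoc[OF Y(2), of Q y] by (simp add: Y(1) nth_append sum_distrib_left)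
  finally show ?case .
qed

text \<open>The next slice of Y has conditional mass 1 and can be summed out. Where the denominator
  is 0, \<open>upd t X Y\<close> is already 0.\<close>

lemma sum_upd_Suc:
  assumes "t < T" and X: "X \<in> trajs A T" "wgt P T X \<noteq> 0"
  shows "(\<Sum>Y\<in>trajs B (Suc t). upd (Suc t) X Y * f (take (Suc t) Y))
    = (\<Sum>Y\<in>trajs B t. upd t X Y * f Y)"
  unfolding sum_trajs_Suc
proof (intro sum.cong refl)
  fix Y assume Y: "Y \<in> trajs B t"
  have len: "length Y = Suc t" using trajs_length[OF Y] .
  have mem: "Y ! t \<in> B t" "X ! t \<in> A t" "X ! Suc t \<in> A (Suc t)"
    using trajs_nth[OF Y] trajs_nth[OF X(1)] assms(1) by auto
  have "(\<Sum>z\<in>B (Suc t). upd (Suc t) X (Y @ [z]) * f (take (Suc t) (Y @ [z])))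
    = (\<Sum>z\<in>B (Suc t). upd t X Y * f Y / den t (Y ! t) (X ! Suc t) *
        (Q t (Y ! t) z * \<Lambda> (Suc t) z (X ! Suc t)))"
  proof (intro sum.cong refl)
    fix z
    show "upd (Suc t) X (Y @ [z]) * f (take (Suc t) (Y @ [z])) =
        upd t X Y * f Y / den t (Y ! t) (X ! Suc t) * (Q t (Y ! t) z * \<Lambda> (Suc t) z (X ! Suc t))"
      by (subst upd_snoc) (use len trajs_length[OF X(1)] assms(1) Y in auto)
  qed
  also have "\<dots> = upd t X Y * f Y / den t (Y ! t) (X ! Suc t) * den t (Y ! t) (X ! Suc t)"
    by (simp add: den_def sum_distrib_left)
  also have "\<dots> = upd t X Y * f Y"
  proof (cases "den t (Y ! t) (X ! Suc t) = 0")
    case True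
    \<comment> \<open>By commutation the denominator is also the mass of the routes through the old
      slice; as X has nonzero weight, the link at t vanishes.\<close>
    have "(\<Sum>z\<in>A t. \<Lambda> t (Y ! t) z * P t z (X ! Suc t)) = 0"
      using commute[of t "Y ! t" "X ! Suc t"] True mem assms(1) by (simp add: den_def)
    then have "\<Lambda> t (Y ! t) (X ! t) * P t (X ! t) (X ! Suc t) = 0"
      using finA[of t] mem assms(1) P_nonneg[of t _ "X ! Suc t"] \<Lambda>_nonneg[of t "Y ! t"]
      by (subst (asm) sum_nonneg_eq_0_iff) (auto intro!: mult_nonneg_nonneg)
    moreover have "P t (X ! t) (X ! Suc t) \<noteq> 0"
      using X(2) assms(1) unfolding wgt_def by auto
    ultimately have \<Lambda>: "\<Lambda> t (Y ! t) (X ! t) = 0" by simp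
    have "upd t X Y = 0"
    proof (cases t)
      \<comment> \<open>At t = 0 the link is 1, a contradiction.\<close>
      case 0
      then show ?thesis using \<Lambda> mem A0 B0 \<Lambda>0 by simp
    next
      case (Suc s)
      then show ?thesis using \<Lambda> by (simp add: upd_def)
    qed
    then show ?thesis by simp
  qed simp
  finally show "(\<Sum>z\<in>B (Suc t). upd (Suc t) X (Y @ [z]) * f (take (Suc t) (Y @ [z]))) = upd t X Y * f Y" .
qed

lemma sum_upd_take:
  assumes "t \<le> T" and X: "X \<in> trajs A T" "wgt P T X \<noteq> 0"
  shows "(\<Sum>Y\<in>trajs B T. upd T X Y * f (take (Suc t) Y)) = (\<Sum>Y\<in>trajs B t. upd t X Y * f Y)"
proof -
  have "(\<Sum>Y\<in>trajs B s. upd s X Y * f (take (Suc t) Y)) = (\<Sum>Y\<in>trajs B t. upd t X Y * f Y)"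
    if "t \<le> s" "s \<le> T" for s
    using that
  proof (induction s rule: dec_induct)
    case base
    then show ?case by (intro sum.cong) (auto simp: trajs_def)
  next
    case (step s)
    then show ?case
      using sum_upd_Suc[of s X "\<lambda>Y. f (take (Suc t) Y)"] X by (simp add: min_absorb1)
  qed
  then show ?thesis using assms(1) by simp
qed

end

section \<open>Expectations along a lattice walk\<close>

locale intertwined_chain =
  fixes T R :: nat and A :: "nat \<Rightarrow> nat \<Rightarrow> 'a set" and P \<Lambda> :: "nat \<Rightarrow> nat \<Rightarrow> 'a \<Rightarrow> 'a \<Rightarrow> real"
    and a0 :: "nat \<Rightarrow> 'a" and Om :: "nat \<Rightarrow> 'a list set"
    and init :: "'a list \<Rightarrow> real" and p :: "nat \<Rightarrow> 'a list \<Rightarrow> 'a list \<Rightarrow> real"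
    and \<rho> \<theta> :: "nat \<Rightarrow> nat" and m :: nat and \<phi> :: "nat \<Rightarrow> 'a \<Rightarrow> real"
  assumes inter: "\<And>r. r < R \<Longrightarrow>
      intertwining T (A r) (A (Suc r)) (P r) (P (Suc r)) (\<Lambda> r) (a0 r) (a0 (Suc r))"
    and Om: "\<And>r X. r \<le> R \<Longrightarrow> X \<in> Om r \<longleftrightarrow> X \<in> trajs (A r) T \<and> wgt (P r) T X \<noteq> 0"
    and finite_A: "\<And>r t. r \<le> R \<Longrightarrow> t \<le> T \<Longrightarrow> finite (A r t)"
    and init: "\<And>X. X \<in> Om 0 \<Longrightarrow> init X = wgt (P 0) T X"
    and p: "\<And>r X Y. r < R \<Longrightarrow> X \<in> Om r \<Longrightarrow> Y \<in> Om (Suc r) \<Longrightarrow>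
      p r X Y = intertwining.upd (A (Suc r)) (P (Suc r)) (\<Lambda> r) T X Y"
    and walk0: "\<rho> 0 = 0" "\<theta> 0 = T" and walkm: "\<rho> m \<le> R"
    and walk: "\<And>s. s < m \<Longrightarrow> \<rho> (Suc s) = Suc (\<rho> s) \<and> \<theta> (Suc s) = \<theta> s
       \<or> \<rho> (Suc s) = \<rho> s \<and> \<theta> s = Suc (\<theta> (Suc s))"
begin

text \<open>The conditional expectation, given the slice \<open>X(\<theta> s)\<close> at time \<open>\<rho> s\<close>, of the product of the
  functions \<open>\<phi>\<close> over the vertices visited before \<open>s\<close>.\<close>

fun harm :: "nat \<Rightarrow> 'a \<Rightarrow> real" where
  "harm 0 x = 1"
| "harm (Suc s) x = (if \<rho> (Suc s) = \<rho> s
     then \<Sum>y\<in>A (\<rho> s) (\<theta> s). P (\<rho> s) (\<theta> (Suc s)) x y * (\<phi> s y * harm s y)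
     else \<Sum>y\<in>A (\<rho> s) (\<theta> s). \<Lambda> (\<rho> s) (\<theta> s) x y * (\<phi> s y * harm s y))"

lemma \<rho>_mono: "u \<le> s \<Longrightarrow> s \<le> m \<Longrightarrow> \<rho> u \<le> \<rho> s"
proof (induction s rule: dec_induct)
  case (step s)
  then show ?case using walk[of s] by auto
qed simp

lemma \<theta>_anti: "u \<le> s \<Longrightarrow> s \<le> m \<Longrightarrow> \<theta> s \<le> \<theta> u"
proof (induction s rule: dec_induct)
  case (step s)
  then show ?case using walk[of s] by auto
qed simp

text \<open>After s steps the earlier paths and the slices of the current path above
  \<open>\<theta> s\<close> are summed out, with \<open>harm s\<close> recording the result. The
  arbitrary \<open>f\<close> of the remaining slices carries the induction.\<close>

lemma sum_walk:
  assumes "s \<le> m"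
  shows "(\<Sum>H\<in>trajs Om (\<rho> s). init (H ! 0) * wgt p (\<rho> s) H * (\<Prod>u<s. \<phi> u (H ! \<rho> u ! \<theta> u))
        * f (take (Suc (\<theta> s)) (H ! \<rho> s)))
    = (\<Sum>X\<in>trajs (A (\<rho> s)) (\<theta> s). wgt (P (\<rho> s)) (\<theta> s) X * harm s (X ! \<theta> s) * f X)"
  using assms
proof (induction s arbitrary: f)
  case 0
  have "(\<Sum>X\<in>Om 0. init X * f (take (Suc T) X)) = (\<Sum>X\<in>Om 0. wgt (P 0) T X * f X)"
    by (intro sum.cong refl) (auto simp: init Om trajs_def)
  also have "\<dots> = (\<Sum>X\<in>trajs (A 0) T. wgt (P 0) T X * f X)"
    by (intro sum.mono_neutral_left finite_trajs finite_A) (auto simp: Om)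
  finally show ?case
    by (simp add: walk0 sum_trajs_0 wgt_def[of p])
next
  case (Suc s)
  let ?r = "\<rho> s" and ?t = "\<theta> s"
  have s: "s < m" "s \<le> m" and rR: "?r \<le> R" and tT: "?t \<le> T"
    using Suc.prems \<rho>_mono[of s m] walkm \<theta>_anti[of 0 s] walk0 by auto
  define Z where "Z H = init (H ! 0) * wgt p ?r H * (\<Prod>u<s. \<phi> u (H ! \<rho> u ! \<theta> u))" for H
  note IH = Suc.IH[OF s(2), folded Z_def]
  have Hr: "H ! ?r \<in> trajs (A ?r) T" "H ! ?r \<in> Om ?r" if "H \<in> trajs Om ?r" for H
    using trajs_nth[OF that, of ?r] Om[OF rR] by auto
  have take_nth: "take (Suc ?t) (H ! ?r) ! ?t = H ! ?r ! ?t" for H by simp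
  consider (right) "\<rho> (Suc s) = Suc ?r" "\<theta> (Suc s) = ?t"
    | (down) "\<rho> (Suc s) = ?r" "?t = Suc (\<theta> (Suc s))"
    using walk[OF s(1)] by blast
  then show ?case
  proof cases
    \<comment> \<open>The top slice is summed out: the last factor of its weight passes into
      \<open>harm\<close>.\<close>
    case down
    let ?t' = "\<theta> (Suc s)"
    have "(\<Sum>H\<in>trajs Om (\<rho> (Suc s)). init (H ! 0) * wgt p (\<rho> (Suc s)) H
        * (\<Prod>u<Suc s. \<phi> u (H ! \<rho> u ! \<theta> u)) * f (take (Suc (\<theta> (Suc s))) (H ! \<rho> (Suc s))))
      = (\<Sum>H\<in>trajs Om ?r. Z H * (\<phi> s (take (Suc ?t) (H ! ?r) ! ?t)
          * f (take (Suc ?t') (take (Suc ?t) (H ! ?r)))))"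
      using down by (intro sum.cong) (auto simp: Z_def min_absorb1)
    also have "\<dots> = (\<Sum>X\<in>trajs (A ?r) ?t. wgt (P ?r) ?t X * harm s (X ! ?t) *
        (\<phi> s (X ! ?t) * f (take (Suc ?t') X)))"
      by (rule IH)
    also have "\<dots> = (\<Sum>X\<in>trajs (A ?r) ?t'. \<Sum>y\<in>A ?r ?t. wgt (P ?r) ?t' X * f X *
        (P ?r ?t' (X ! ?t') y * (\<phi> s y * harm s y)))"
      unfolding down(2) sum_trajs_Suc
    proof (intro sum.cong refl)
      fix X y assume X: "X \<in> trajs (A ?r) ?t'"
      show "wgt (P ?r) (Suc ?t') (X @ [y]) * harm s ((X @ [y]) ! Suc ?t') *
         (\<phi> s ((X @ [y]) ! Suc ?t') * f (take (Suc ?t') (X @ [y])))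
        = wgt (P ?r) ?t' X * f X * (P ?r ?t' (X ! ?t') y * (\<phi> s y * harm s y))"
        using trajs_length[OF X] by (simp add: wgt_snoc[OF X] nth_append)
    qed
    also have "\<dots> = (\<Sum>X\<in>trajs (A (\<rho> (Suc s))) ?t'. wgt (P (\<rho> (Suc s))) ?t' X *
        harm (Suc s) (X ! ?t') * f X)"
      using down by (simp add: sum_distrib_left mult_ac)
    finally show ?thesis .
  next
    case right
    let ?B = "A (Suc ?r)"
    have rR': "?r < R" using \<rho>_mono[of "Suc s" m] walkm Suc.prems right by auto
    interpret I: intertwining T "A ?r" ?B "P ?r" "P (Suc ?r)" "\<Lambda> ?r" "a0 ?r" "a0 (Suc ?r)"
      by (rule inter[OF rR'])
    \<comment> \<open>\<open>f\<close> sees the new path only up to \<open>\<theta> s\<close>, so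
      its higher slices are summed out and the old path matters only up to that level.\<close>
    have inner: "(\<Sum>Y\<in>Om (Suc ?r). p ?r X Y * f (take (Suc ?t) Y))
        = (\<Sum>Y\<in>trajs ?B ?t. I.upd ?t (take (Suc ?t) X) Y * f Y)" if X: "X \<in> Om ?r" for X
    proof -
      have X': "X \<in> trajs (A ?r) T" "wgt (P ?r) T X \<noteq> 0" using X Om[OF rR] by auto
      have "(\<Sum>Y\<in>Om (Suc ?r). p ?r X Y * f (take (Suc ?t) Y))
          = (\<Sum>Y\<in>Om (Suc ?r). I.upd T X Y * f (take (Suc ?t) Y))"
        by (intro sum.cong refl) (use p[OF rR' X] in auto)
      also have "\<dots> = (\<Sum>Y\<in>trajs ?B T. I.upd T X Y * f (take (Suc ?t) Y))"
      proof (intro sum.mono_neutral_left ballI)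
        show "finite (trajs ?B T)" by (intro finite_trajs I.finB)
        show "Om (Suc ?r) \<subseteq> trajs ?B T" using Om[of "Suc ?r"] rR' by auto
        fix Y assume "Y \<in> trajs ?B T - Om (Suc ?r)"
        then have "wgt (P (Suc ?r)) T Y = 0" using Om[of "Suc ?r"] rR' by auto
        \<comment> \<open>Each factor of the weight of Y occurs in the update, so trajectories
          outside \<open>Om\<close> are never reached.\<close>
        then have "I.upd T X Y = 0" by (auto simp: wgt_def I.upd_def)
        then show "I.upd T X Y * f (take (Suc ?t) Y) = 0" by simp
      qed
      also have "\<dots> = (\<Sum>Y\<in>trajs ?B ?t. I.upd ?t X Y * f Y)"
        by (rule I.sum_upd_take[OF tT X'])
      also have "\<dots> = (\<Sum>Y\<in>trajs ?B ?t. I.upd ?t (take (Suc ?t) X) Y * f Y)"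
        by (intro sum.cong refl arg_cong2[where f = times] I.upd_cong) auto
      finally show ?thesis .
    qed
    have "(\<Sum>H\<in>trajs Om (\<rho> (Suc s)). init (H ! 0) * wgt p (\<rho> (Suc s)) H
        * (\<Prod>u<Suc s. \<phi> u (H ! \<rho> u ! \<theta> u)) * f (take (Suc (\<theta> (Suc s))) (H ! \<rho> (Suc s))))
      = (\<Sum>H\<in>trajs Om ?r. \<Sum>Y\<in>Om (Suc ?r). Z H * (\<phi> s (H ! ?r ! ?t)
          * (p ?r (H ! ?r) Y * f (take (Suc ?t) Y))))"
      unfolding right sum_trajs_Suc
    proof (intro sum.cong refl)
      fix H Y assume H: "H \<in> trajs Om ?r"
      have len: "length H = Suc ?r" using trajs_length[OF H] .
      have "(\<Prod>u<s. \<phi> u ((H @ [Y]) ! \<rho> u ! \<theta> u)) = (\<Prod>u<s. \<phi> u (H ! \<rho> u ! \<theta> u))"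
        using \<rho>_mono[of _ s] s len by (intro prod.cong refl) (auto simp: nth_append less_Suc_eq_le)
      then show "init ((H @ [Y]) ! 0) * wgt p (Suc ?r) (H @ [Y]) *
          (\<Prod>u<Suc s. \<phi> u ((H @ [Y]) ! \<rho> u ! \<theta> u)) * f (take (Suc ?t) ((H @ [Y]) ! Suc ?r))
        = Z H * (\<phi> s (H ! ?r ! ?t) * (p ?r (H ! ?r) Y * f (take (Suc ?t) Y)))"
        using len by (simp add: wgt_snoc[OF H] Z_def nth_append)
    qed
    also have "\<dots> = (\<Sum>H\<in>trajs Om ?r. Z H * (\<phi> s (take (Suc ?t) (H ! ?r) ! ?t)
          * (\<Sum>Y\<in>trajs ?B ?t. I.upd ?t (take (Suc ?t) (H ! ?r)) Y * f Y)))"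
      by (intro sum.cong refl) (simp add: inner[OF Hr(2), symmetric] sum_distrib_left)
    also have "\<dots> = (\<Sum>X\<in>trajs (A ?r) ?t. wgt (P ?r) ?t X * harm s (X ! ?t) * (\<phi> s (X ! ?t) *
        (\<Sum>Y\<in>trajs ?B ?t. I.upd ?t X Y * f Y)))"
      by (rule IH)
    also have "\<dots> = (\<Sum>Y\<in>trajs ?B ?t. f Y *
        (\<Sum>X\<in>trajs (A ?r) ?t. wgt (P ?r) ?t X * I.upd ?t X Y * (\<phi> s (X ! ?t) * harm s (X ! ?t))))"
      by (simp add: sum_distrib_left mult_ac) (rule sum.swap)
    also have "\<dots> = (\<Sum>Y\<in>trajs (A (\<rho> (Suc s))) (\<theta> (Suc s)). wgt (P (\<rho> (Suc s))) (\<theta> (Suc s)) Y *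
        harm (Suc s) (Y ! \<theta> (Suc s)) * f Y)"
      unfolding right
    proof (intro sum.cong refl)
      fix Y assume Y: "Y \<in> trajs ?B ?t"
      show "f Y * (\<Sum>X\<in>trajs (A ?r) ?t. wgt (P ?r) ?t X * I.upd ?t X Y * (\<phi> s (X ! ?t) * harm s (X ! ?t)))
        = wgt (P (Suc ?r)) ?t Y * harm (Suc s) (Y ! ?t) * f Y"
        using right I.sum_wgt_upd[OF tT Y, of "\<lambda>x. \<phi> s x * harm s x"] by simp
    qed
    finally show ?thesis .
  qed
qed

end

section \<open>From the probability space to sums over histories\<close>

lemma markov_chain_prob:
  assumes mc: "markov_chain Pr L E init p M" and "enat k \<le> L"
    and "\<And>j. j \<le> k \<Longrightarrow> h j \<in> E j"
  shows "measure Pr {\<omega>\<in>space Pr. \<forall>j\<le>k. M j \<omega> = h j}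
    = pmf init (h 0) * (\<Prod>j<k. p j (h j) (h (Suc j)))"
  using assms(2,3)
proof (induction k)
  case 0
  have meas: "M 0 \<in> measurable Pr (count_space UNIV)"
    using mc 0 by (auto simp: markov_chain_def)
  have "measure Pr {\<omega>\<in>space Pr. M 0 \<omega> = h 0} = measure (distr Pr (count_space UNIV) (M 0)) {h 0}"
    by (subst measure_distr[OF meas]) (auto intro!: arg_cong[where f = "measure Pr"])
  also have "\<dots> = pmf init (h 0)"
    using mc by (simp add: markov_chain_def measure_pmf_single)
  finally show ?case by simp
next
  case (Suc k)
  interpret prob_space Pr using mc by (simp add: markov_chain_def)
  have Lk: "enat j \<le> L" if "j \<le> Suc k" for j
    using Suc.prems(1) that by (meson enat_ord_simps(1) order_trans)
  have meas: "M j \<in> measurable Pr (count_space UNIV)" if "j \<le> Suc k" for j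
    using mc Lk[OF that] by (auto simp: markov_chain_def)
  let ?C = "{\<omega>\<in>space Pr. \<forall>j\<le>k. M j \<omega> = h j}"
  let ?D = "{\<omega>\<in>space Pr. \<forall>j\<le>Suc k. M j \<omega> = h j}"
  have eq: "{\<omega>\<in>space Pr. M j \<omega> = h j} \<in> sets Pr" if "j \<le> Suc k" for j
    using measurable_sets[OF meas[OF that], of "{h j}"] by (simp add: vimage_def Int_def conj_commute)
  have "?C = (\<Inter>j\<le>k. {\<omega>\<in>space Pr. M j \<omega> = h j})" by auto
  also have "\<dots> \<in> sets Pr" by (intro sets.finite_INT) (auto intro: eq)
  finally have C: "?C \<in> sets Pr" .
  have D: "?D = {\<omega>\<in>space Pr. M (Suc k) \<omega> = h (Suc k) \<and> (\<forall>j\<le>k. M j \<omega> = h j)}"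
    by (auto simp: le_Suc_eq)
  show ?case
  proof (cases "measure Pr ?C > 0")
    case True
    then have "cond_prob Pr (\<lambda>\<omega>. M (Suc k) \<omega> = h (Suc k)) (\<lambda>\<omega>. \<forall>j\<le>k. M j \<omega> = h j) = p k (h k) (h (Suc k))"
      using mc Suc.prems by (auto simp: markov_chain_def)
    then have "measure Pr ?D = measure Pr ?C * p k (h k) (h (Suc k))"
      unfolding D using True by (simp add: cond_prob_def field_simps)
    then show ?thesis using Suc.IH Lk[of k] Suc.prems(2) by simp
  next
    \<comment> \<open>A past of probability 0 has no conditional law, but then both sides are
      0.\<close>
    case False
    then have 0: "measure Pr ?C = 0" using measure_nonneg[of Pr ?C] by linarith
    have "measure Pr ?D \<le> measure Pr ?C"
      by (rule finite_measure_mono[OF _ C]) auto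
    then have "measure Pr ?D = 0" using 0 measure_nonneg[of Pr ?D] by linarith
    moreover have "pmf init (h 0) * (\<Prod>j<k. p j (h j) (h (Suc j))) = 0"
      using Suc.IH Lk[of k] Suc.prems(2) 0 by simp
    ultimately show ?thesis by auto
  qed
qed

lemma markov_chain_event:
  assumes mc: "markov_chain Pr L E init p M" and "enat R \<le> L"
    and fin: "\<And>j. j \<le> R \<Longrightarrow> finite (E j)"
  shows "measure Pr {\<omega>\<in>space Pr. Ev (map (\<lambda>j. M j \<omega>) [0..<Suc R])}
    = (\<Sum>H\<in>trajs E R. pmf init (H ! 0) * wgt p R H * (if Ev H then 1 else 0))"
proof -
  interpret prob_space Pr using mc by (simp add: markov_chain_def)
  have Lj: "enat j \<le> L" if "j \<le> R" for j
    using assms(2) that by (meson enat_ord_simps(1) order_trans)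
  have meas: "M j \<in> measurable Pr (count_space UNIV)" and ME: "\<omega> \<in> space Pr \<Longrightarrow> M j \<omega> \<in> E j"
    if "j \<le> R" for j \<omega>
    using mc Lj[OF that] by (auto simp: markov_chain_def)
  define C where "C H = {\<omega>\<in>space Pr. \<forall>j\<le>R. M j \<omega> = H ! j}" for H
  have Cs: "C H \<in> sets Pr" for H
  proof -
    have "C H = (\<Inter>j\<le>R. M j -` {H ! j} \<inter> space Pr)" by (auto simp: C_def)
    also have "\<dots> \<in> sets Pr" by (intro sets.finite_INT) (auto intro!: measurable_sets[OF meas])
    finally show ?thesis .
  qed
  have hist: "map (\<lambda>j. M j \<omega>) [0..<Suc R] = H" if "\<omega> \<in> C H" "H \<in> trajs E R" for \<omega> H
    using that trajs_length[OF that(2)]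
    by (intro nth_equalityI) (auto simp: C_def less_Suc_eq_le simp del: upt_Suc)
  have "{\<omega>\<in>space Pr. Ev (map (\<lambda>j. M j \<omega>) [0..<Suc R])} = (\<Union>H\<in>{H\<in>trajs E R. Ev H}. C H)"
  proof (intro equalityI subsetI)
    fix \<omega> assume "\<omega> \<in> {\<omega>\<in>space Pr. Ev (map (\<lambda>j. M j \<omega>) [0..<Suc R])}"
    then have \<omega>: "\<omega> \<in> space Pr" "Ev (map (\<lambda>j. M j \<omega>) [0..<Suc R])" by auto
    moreover have "map (\<lambda>j. M j \<omega>) [0..<Suc R] \<in> trajs E R"
      using ME \<omega> by (auto simp: trajs_def less_Suc_eq_le simp del: upt_Suc)
    moreover have "\<omega> \<in> C (map (\<lambda>j. M j \<omega>) [0..<Suc R])"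
      using \<omega> by (auto simp: C_def less_Suc_eq_le simp del: upt_Suc)
    ultimately show "\<omega> \<in> (\<Union>H\<in>{H\<in>trajs E R. Ev H}. C H)" by blast
  next
    fix \<omega> assume "\<omega> \<in> (\<Union>H\<in>{H\<in>trajs E R. Ev H}. C H)"
    then obtain H where H: "H \<in> trajs E R" "Ev H" "\<omega> \<in> C H" by blast
    then show "\<omega> \<in> {\<omega>\<in>space Pr. Ev (map (\<lambda>j. M j \<omega>) [0..<Suc R])}"
      using hist[OF H(3,1)] by (auto simp: C_def simp del: upt_Suc)
  qed
  also have "measure Pr \<dots> = (\<Sum>H\<in>{H\<in>trajs E R. Ev H}. measure Pr (C H))"
  proof (rule finite_measure_finite_Union)
    show "finite {H\<in>trajs E R. Ev H}" using finite_trajs[of R E] fin by simp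
    show "disjoint_family_on C {H\<in>trajs E R. Ev H}"
      unfolding disjoint_family_on_def
    proof (intro ballI impI)
      fix H H' assume "H \<in> {H\<in>trajs E R. Ev H}" "H' \<in> {H\<in>trajs E R. Ev H}" "H \<noteq> H'"
      then show "C H \<inter> C H' = {}" using hist[of _ H] hist[of _ H'] by fastforce
    qed
  qed (auto intro: Cs)
  also have "\<dots> = (\<Sum>H\<in>{H\<in>trajs E R. Ev H}. pmf init (H ! 0) * wgt p R H)"
    unfolding C_def wgt_def
    by (intro sum.cong refl markov_chain_prob[OF mc assms(2)]) (auto dest: trajs_nth)
  also have "\<dots> = (\<Sum>H\<in>trajs E R. pmf init (H ! 0) * wgt p R H * (if Ev H then 1 else 0))"
    using finite_trajs[of R E] fin by (auto simp: sum.inter_filter intro!: sum.cong)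
  finally show ?thesis .
qed


section \<open>The transition matrices and the uniform measure on path families\<close>

text \<open>The affine weights vanish exactly where a move would leave the admissible interval, so
  the operators need no boundary conditions.\<close>

lemma pts_up_bdry:
  assumes "a \<in> pts N T A B"
  shows "a + 1 \<in> pts N T A (B + 1) \<or> up_u N A a = 0" "a \<in> pts N T A (B + 1) \<or> up_b T A B a = 0"
  using assms by (auto simp: pts_def up_u_def up_b_def)

lemma pts_dn_bdry:
  assumes "a \<in> pts N T A (B + 1)"
  shows "a + - 1 \<in> pts N T A B \<or> dn_u a = 0" "a \<in> pts N T A B \<or> dn_b N B a = 0"
  using assms by (auto simp: pts_def dn_u_def dn_b_def)

lemma up_nonneg: "a \<in> pts N T A B \<Longrightarrow> up_u N A a \<ge> 0 \<and> up_b T A B a \<ge> 0"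
  by (auto simp: pts_def up_u_def up_b_def)

lemma dn_nonneg: "a \<in> pts N T A (B + 1) \<Longrightarrow> dn_u a \<ge> 0 \<and> dn_b N B a \<ge> 0"
  by (auto simp: pts_def dn_u_def dn_b_def)

lemma hop_cong:
  assumes "x + \<sigma> \<in> B \<or> u x = 0" "x \<in> B \<or> b x = 0" "\<And>y. y \<in> B \<Longrightarrow> f y = g y"
  shows "hop \<sigma> u b f x = hop \<sigma> u b g x"
  using assms by (auto simp: hop_def)

lemma hop_diff: "hop \<sigma> u b (\<lambda>y. f y - g y) x = hop \<sigma> u b f x - hop \<sigma> u b g x"
  and hop_cmult: "hop \<sigma> u b (\<lambda>y. c * f y) x = c * hop \<sigma> u b f x"
  and hop_sum: "hop \<sigma> u b (\<lambda>y. \<Sum>i\<in>I. F i y) x = (\<Sum>i\<in>I. hop \<sigma> u b (F i) x)"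
  by (simp_all add: hop_def algebra_simps sum_distrib_left sum.distrib)

lemma pochhammer_eq_lam_up: "pochhammer (real T - real_of_int B) N = (\<Prod>k<N. lam_up N T B k)"
proof -
  have "(\<Prod>k<N. lam_up N T B k) = (\<Prod>k<N. real T - real_of_int B + real (N - Suc k))"
    by (intro prod.cong refl) (auto simp: lam_up_def of_nat_diff)
  also have "\<dots> = (\<Prod>k<N. real T - real_of_int B + real k)"
    by (rule prod.nat_diff_reindex)
  finally show ?thesis by (simp add: pochhammer_prod lessThan_atLeast0)
qed

lemma pochhammer_eq_lam_dn: "pochhammer (real_of_int (B + 1)) N = (\<Prod>k<N. lam_dn N B k)"
proof -
  have "(\<Prod>k<N. lam_dn N B k) = (\<Prod>k<N. real_of_int (B + 1) + real (N - Suc k))"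
    by (intro prod.cong refl) (auto simp: lam_dn_def of_nat_diff)
  also have "\<dots> = (\<Prod>k<N. real_of_int (B + 1) + real k)"
    by (rule prod.nat_diff_reindex)
  finally show ?thesis by (simp add: pochhammer_prod lessThan_atLeast0)
qed

lemma pochhammer_up_pos: "B < int T \<Longrightarrow> pochhammer (real T - real_of_int B) N > 0"
  by (rule pochhammer_pos) simp

lemma pochhammer_dn_pos: "0 \<le> B \<Longrightarrow> pochhammer (real_of_int (B + 1)) N > 0"
  by (rule pochhammer_pos) simp

definition up_mat :: "nat \<Rightarrow> nat \<Rightarrow> int \<Rightarrow> int \<Rightarrow> int list \<Rightarrow> int list \<Rightarrow> real" where
  "up_mat N T A B = jump N 1 (up_u N A) (up_b T A B) (pochhammer (real T - real_of_int B) N)"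
definition dn_mat :: "nat \<Rightarrow> int \<Rightarrow> int list \<Rightarrow> int list \<Rightarrow> real" where
  "dn_mat N B = jump N (- 1) dn_u (dn_b N B) (pochhammer (real_of_int (B + 1)) N)"

lemma P_t_plus_eq: "P_t_plus N T S t = up_mat N T S (int t)"
proof -
  have "up_b T S (int t) = (\<lambda>x. of_int (x + int T - int t - S))"
    by (simp add: fun_eq_iff up_b_def)
  then show ?thesis
    by (intro ext) (simp only: P_t_plus_def up_mat_def jump_def up_u_def of_int_of_nat_eq)
qed

lemma P_S_plus_eq: "P_S_plus N T S t = up_mat N T (int t) S"
  by (intro ext) (simp only: P_S_plus_def up_mat_def jump_def up_u_def up_b_def)

lemma P_S_minus_eq: "P_S_minus N T S t = dn_mat N (S - 1)"
proof -
  have "dn_b N (S - 1) = (\<lambda>x. of_int (S + int N - 1 - x))"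
    by (simp add: fun_eq_iff dn_b_def)
  then show ?thesis
    by (intro ext) (simp only: P_S_minus_def dn_mat_def jump_def dn_u_def insert_commute[of "- 1"]
        diff_add_cancel add_uminus_conv_diff)
qed

lemma sum_up_mat:
  assumes "x \<in> tup N (pts N T A B)" "B < int T"
  shows "(\<Sum>y\<in>tup N (pts N T A (B + 1)). up_mat N T A B x y) = 1"
  unfolding up_mat_def
proof (rule sum_jump_eq_1[OF assms(1) insertI1 finite_pts pts_up_bdry up_affine])
  show "pochhammer (real T - real_of_int B) N = (\<Prod>k<N. real_of_int (int N + A - 1)
      + real_of_int (int T - A - B) + real_of_int 1 * - 1 * real k)"
    by (auto simp: pochhammer_eq_lam_up lam_up_def intro!: prod.cong)
qed (use pochhammer_up_pos[OF assms(2), of N] in auto)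

lemma sum_dn_mat:
  assumes "x \<in> tup N (pts N T A (B + 1))" "0 \<le> B"
  shows "(\<Sum>y\<in>tup N (pts N T A B). dn_mat N B x y) = 1"
  unfolding dn_mat_def
proof (rule sum_jump_eq_1[OF assms(1) insertI2[OF insertI1] finite_pts pts_dn_bdry dn_affine])
  show "pochhammer (real_of_int (B + 1)) N = (\<Prod>k<N. 0 + real_of_int (B + int N)
      + real_of_int (- 1) * 1 * real k)"
    unfolding pochhammer_eq_lam_dn by (intro prod.cong) (auto simp: lam_dn_def)
qed (use pochhammer_dn_pos[OF assms(2), of N] in auto)

section \<open>Commutation of the one-step matrices\<close>

lemma hop_up_dn_commute:
  "hop 1 (up_u N (B + 1)) (up_b T (B + 1) A) (hop (- 1) dn_u (dn_b N B) g) x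
    = hop (- 1) dn_u (dn_b N B) (hop 1 (up_u N B) (up_b T B A) g) x"
  by (simp add: hop_def up_u_def up_b_def dn_u_def dn_b_def algebra_simps)

lemma hop_up_up_commute:
  "hop 1 (up_u N B) (up_b T B A) (hop 1 (up_u N (A + 1)) (up_b T (A + 1) B) g) x
    = hop 1 (up_u N A) (up_b T A B) (hop 1 (up_u N (B + 1)) (up_b T (B + 1) A) g) x"
  by (simp add: hop_def up_u_def up_b_def algebra_simps)

text \<open>Both products become composed operators by \<open>sum_jump_jump\<close>, and these agree
  on all functions of an integer: the change of the parameter B absorbs the shift of the
  argument.\<close>

lemma up_dn_mat_commute:
  assumes y: "y \<in> tup N (pts N T (B + 1) A)" and x: "x \<in> tup N (pts N T B (A + 1))"
  shows "(\<Sum>z\<in>tup N (pts N T (B + 1) (A + 1)). up_mat N T (B + 1) A y z * dn_mat N B z x)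
    = (\<Sum>z\<in>tup N (pts N T B A). dn_mat N B y z * up_mat N T B A z x)"
proof -
  have dn: "a + - 1 \<in> pts N T B A' \<or> dn_u a = 0" "a \<in> pts N T B A' \<or> dn_b N B a = 0"
    if "a \<in> pts N T (B + 1) A'" for a A'
    using pts_dn_bdry[of a N T A' B] that by (auto simp: pts_commute)
  let ?\<kappa> = "pochhammer (real T - real_of_int A) N" and ?\<kappa>' = "pochhammer (real_of_int (B + 1)) N"
  let ?up = "\<lambda>B. hop 1 (up_u N B) (up_b T B A)" and ?dn = "hop (- 1) dn_u (dn_b N B)"
  have "(\<Sum>z\<in>tup N (pts N T (B + 1) (A + 1)). up_mat N T (B + 1) A y z * dn_mat N B z x)
      = vandermonde N x * (slater N (\<lambda>k. ?up (B + 1) (?dn (point_mass (x ! k)))) y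
          / (?\<kappa> * ?\<kappa>' * vandermonde N y))"
    unfolding up_mat_def dn_mat_def
    by (rule sum_jump_jump[OF y x _ _ finite_pts finite_pts]) ((erule pts_up_bdry dn | simp)+)
  moreover have "(\<Sum>z\<in>tup N (pts N T B A). dn_mat N B y z * up_mat N T B A z x)
      = vandermonde N x * (slater N (\<lambda>k. ?dn (?up B (point_mass (x ! k)))) y
          / (?\<kappa>' * ?\<kappa> * vandermonde N y))"
    unfolding up_mat_def dn_mat_def
    by (rule sum_jump_jump[OF y x _ _ finite_pts finite_pts]) ((erule pts_up_bdry dn | simp)+)
  moreover have "?up (B + 1) (?dn g) = ?dn (?up B g)" for g
    by (rule ext) (rule hop_up_dn_commute)
  ultimately show ?thesis by (simp only: mult.commute[of ?\<kappa> ?\<kappa>'])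
qed

lemma up_up_mat_commute:
  assumes y: "y \<in> tup N (pts N T B A)" and x: "x \<in> tup N (pts N T (B + 1) (A + 1))"
  shows "(\<Sum>z\<in>tup N (pts N T B (A + 1)). up_mat N T B A y z * up_mat N T (A + 1) B z x)
    = (\<Sum>z\<in>tup N (pts N T (B + 1) A). up_mat N T A B y z * up_mat N T (B + 1) A z x)"
proof -
  have up: "a + 1 \<in> pts N T (B + 1) A' \<or> up_u N A' a = 0" "a \<in> pts N T (B + 1) A' \<or> up_b T A' B a = 0"
    if "a \<in> pts N T B A'" for a A'
    using pts_up_bdry[of a N T A' B] that by (auto simp: pts_commute)
  let ?\<kappa> = "pochhammer (real T - real_of_int A) N" and ?\<kappa>' = "pochhammer (real T - real_of_int B) N"
  let ?up = "\<lambda>A B. hop 1 (up_u N A) (up_b T A B)"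
  have "(\<Sum>z\<in>tup N (pts N T B (A + 1)). up_mat N T B A y z * up_mat N T (A + 1) B z x)
      = vandermonde N x * (slater N (\<lambda>k. ?up B A (?up (A + 1) B (point_mass (x ! k)))) y
          / (?\<kappa> * ?\<kappa>' * vandermonde N y))"
    unfolding up_mat_def
    by (rule sum_jump_jump[OF y x _ _ finite_pts finite_pts]) ((erule pts_up_bdry up | simp)+)
  moreover have "(\<Sum>z\<in>tup N (pts N T (B + 1) A). up_mat N T A B y z * up_mat N T (B + 1) A z x)
      = vandermonde N x * (slater N (\<lambda>k. ?up A B (?up (B + 1) A (point_mass (x ! k)))) y
          / (?\<kappa>' * ?\<kappa> * vandermonde N y))"
    unfolding up_mat_def
    by (rule sum_jump_jump[OF y x _ _ finite_pts finite_pts]) ((erule pts_up_bdry up | simp)+)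
  moreover have "?up B A (?up (A + 1) B g) = ?up A B (?up (B + 1) A g)" for g
    by (rule ext) (rule hop_up_up_commute)
  ultimately show ?thesis by (simp only: mult.commute[of ?\<kappa> ?\<kappa>'])
qed

section \<open>Frozen end slices and the instance of the intertwining\<close>

lemma tup_full:
  assumes "x \<in> tup N {a..a + int N - 1}"
  shows "x = [a..a + int N - 1]"
proof (rule sorted_distinct_set_unique)
  show "sorted x" "distinct x" using assms by (auto simp: tup_def strict_sorted_iff)
  then have "card (set x) = N" using assms by (simp add: tup_def distinct_card)
  then show "set x = set [a..a + int N - 1]"
    using assms by (simp add: tup_def card_subset_eq)
qed simp_all

lemma tup_full_eq: "tup N {a..a + int N - 1} = {[a..a + int N - 1]}"
proof
  show "{[a..a + int N - 1]} \<subseteq> tup N {a..a + int N - 1}"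
    by (auto simp: tup_def strict_sorted_iff)
qed (use tup_full in blast)

lemma tuples_0: "0 \<le> S \<Longrightarrow> S \<le> int T \<Longrightarrow> tuples N T S 0 = {[0..int N - 1]}"
  using tup_full_eq[of N 0] by (simp add: tuples_eq_tup points_eq_pts pts_def)

lemma tuples_T: "0 \<le> S \<Longrightarrow> S \<le> int T \<Longrightarrow> tuples N T S T = {[S..S + int N - 1]}"
  using tup_full_eq[of N S] by (simp add: tuples_eq_tup points_eq_pts pts_def)

lemma finite_tuples: "finite (tuples N T S t)"
  by (simp add: tuples_eq_tup points_eq_pts finite_tup finite_pts)

lemma intertwining_tuples:
  assumes S: "0 \<le> S" "S \<le> int T" "0 \<le> S + e" "S + e \<le> int T" and e: "e \<in> {1, - 1}"
  shows "intertwining T (tuples N T S) (tuples N T (S + e)) (P_t_plus N T S) (P_t_plus N T (S + e))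
    (P_S (- e) N T (S + e)) [0..int N - 1] [0..int N - 1]"
proof
  have tp: "tuples N T S' t = tup N (pts N T S' (int t))" for S' t
    by (simp add: tuples_eq_tup points_eq_pts)
  have \<Lambda>: "P_S (- e) N T (S + e) t = (if e = 1 then dn_mat N S else up_mat N T (int t) (S + e))" for t
    using e by (auto simp: P_S_def P_S_plus_eq P_S_minus_eq)
  show nn: "P_t_plus N T S' t x y \<ge> 0" if "t < T" "x \<in> tuples N T S' t" "y \<in> tuples N T S' (Suc t)"
    for S' t x y
    using that pochhammer_up_pos[of "int t" T N] unfolding P_t_plus_eq up_mat_def tp
    by (intro jump_nonneg[of x N "pts N T S' (int t)" y "pts N T S' (int (Suc t))"])
       (auto dest: up_nonneg)
  show "P_t_plus N T (S + e) t x y \<ge> 0" if "t < T" "x \<in> tuples N T (S + e) t" "y \<in> tuples N T (S + e) (Suc t)"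
    for t x y by (rule nn[OF that])
  show "P_S (- e) N T (S + e) t x y \<ge> 0" if "t \<le> T" "x \<in> tuples N T (S + e) t" "y \<in> tuples N T S t" for t x y
  proof (cases "e = 1")
    case True
    have "dn_mat N S x y \<ge> 0"
      using that pochhammer_dn_pos[OF S(1), of N] True unfolding tp dn_mat_def
      by (intro jump_nonneg[of x N "pts N T (S + 1) (int t)" y "pts N T S (int t)"])
         (auto simp: pts_commute[of N T _ "int t"] dest: dn_nonneg)
    then show ?thesis using True unfolding \<Lambda> by simp
  next
    case False
    have "up_mat N T (int t) (S + e) x y \<ge> 0"
      using that pochhammer_up_pos[of "S + e" T N] S False e unfolding tp up_mat_def
      by (intro jump_nonneg[of x N "pts N T (S + e) (int t)" y "pts N T S (int t)"])
         (auto simp: pts_commute[of N T _ "int t"] dest: up_nonneg)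
    then show ?thesis using False unfolding \<Lambda> by simp
  qed
  show "(\<Sum>z\<in>tuples N T (S + e) (Suc t). P_t_plus N T (S + e) t y z * P_S (- e) N T (S + e) (Suc t) z x)
    = (\<Sum>z\<in>tuples N T S t. P_S (- e) N T (S + e) t y z * P_t_plus N T S t z x)"
    if "t < T" "y \<in> tuples N T (S + e) t" "x \<in> tuples N T S (Suc t)" for t x y
  proof (cases "e = 1")
    case True
    have "y \<in> tup N (pts N T (S + 1) (int t))" "x \<in> tup N (pts N T S (int t + 1))"
      using that True by (simp_all add: tp add.commute)
    from up_dn_mat_commute[OF this] show ?thesis
      unfolding \<Lambda> using True by (simp add: P_t_plus_eq tp add.commute[of 1 "int t"])
  next
    case False
    then have e': "e = - 1" using e by simp
    have "y \<in> tup N (pts N T (S - 1) (int t))" "x \<in> tup N (pts N T (S - 1 + 1) (int t + 1))"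
      using that e' by (simp_all add: tp add.commute)
    from up_up_mat_commute[OF this] show ?thesis
      unfolding \<Lambda> using e' by (simp add: P_t_plus_eq tp add.commute[of 1 "int t"])
  qed
  show t0: "tuples N T S 0 = {[0..int N - 1]}" "tuples N T (S + e) 0 = {[0..int N - 1]}"
    using S by (auto intro!: tuples_0)
  \<comment> \<open>At t = 0 there is one tuple only, so the entry is a whole row, and row sums are
    1.\<close>
  show "P_S (- e) N T (S + e) 0 [0..int N - 1] [0..int N - 1] = 1"
  proof (cases "e = 1")
    case True
    have "(\<Sum>y\<in>tup N (pts N T 0 S). dn_mat N S [0..int N - 1] y) = 1"
      by (rule sum_dn_mat) (use S t0(2) True in \<open>auto simp: tp pts_commute\<close>)
    then show ?thesis using True t0(1) unfolding \<Lambda> by (simp add: tp pts_commute[of N T 0])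
  next
    case False
    then have e': "e = - 1" using e by simp
    have "(\<Sum>y\<in>tup N (pts N T 0 (S - 1 + 1)). up_mat N T 0 (S - 1) [0..int N - 1] y) = 1"
      by (rule sum_up_mat) (use S t0(2) e' in \<open>auto simp: tp pts_commute\<close>)
    then show ?thesis using e' t0(1) unfolding \<Lambda> by (simp add: tp pts_commute[of N T 0])
  qed
qed (simp_all add: finite_tuples)

text \<open>The denominators are nonnegative, so the positivity test in \<open>step\<close> fails
  only where one of them is 0; there \<open>upd\<close> is 0 too, by the convention for division by
  0.\<close>

lemma step_eq_upd:
  assumes S: "0 \<le> S" "S \<le> int T" "0 \<le> S + e" "S + e \<le> int T" and e: "e \<in> {1, - 1}"
    and X: "X \<in> trajs (tuples N T S) T" and Y: "Y \<in> trajs (tuples N T (S + e)) T"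
  shows "step N T S e X Y = intertwining.upd (tuples N T (S + e)) (P_t_plus N T (S + e))
    (P_S (- e) N T (S + e)) T X Y"
proof -
  interpret intertwining T "tuples N T S" "tuples N T (S + e)" "P_t_plus N T S" "P_t_plus N T (S + e)"
    "P_S (- e) N T (S + e)" "[0..int N - 1]" "[0..int N - 1]"
    by (rule intertwining_tuples[OF S e])
  have den: "step_denom N T (S + e) e t y x = den t y x" for t y x
    by (simp add: step_denom_def den_def)
  have nn: "den t (Y ! t) (X ! Suc t) \<ge> 0" if "t < T" for t
    unfolding den_def using that trajs_nth[OF X, of "Suc t"] trajs_nth[OF Y, of t]
    by (intro sum_nonneg mult_nonneg_nonneg Q_nonneg \<Lambda>_nonneg) auto
  show ?thesis
  proof (cases "\<forall>t<T. den t (Y ! t) (X ! Suc t) > 0")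
    case True
    then show ?thesis by (simp add: step_def den upd_def)
  next
    case False
    then obtain t where t: "t < T" "den t (Y ! t) (X ! Suc t) = 0"
      using nn by (metis order_le_less)
    then have "upd T X Y = 0"
      unfolding upd_def by (intro prod_zero) auto
    moreover have "step N T S e X Y = 0"
      using False by (auto simp: step_def den)
    ultimately show ?thesis by simp
  qed
qed

text \<open>A path visits every level of \<open>x\<close> it climbs exactly once with an up-step, and every value
  of \<open>t - x\<close> exactly once with a flat step; so the product of the step weights depends on the
  endpoints only.\<close>

lemma prod_steps:
  fixes x :: "nat \<Rightarrow> int"
  assumes "\<And>t. t < m \<Longrightarrow> x (Suc t) - x t \<in> {0, 1}"
  shows "x 0 \<le> x m \<and> x m \<le> x 0 + int m \<and>
    (\<Prod>t<m. if x (Suc t) = x t + 1 then f (x t) else g (int t - x t))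
    = (\<Prod>j<nat (x m - x 0). f (x 0 + int j)) * (\<Prod>j<m - nat (x m - x 0). g (int j - x 0) :: real)"
  using assms
proof (induction m)
  case (Suc m)
  have IH: "x 0 \<le> x m" "x m \<le> x 0 + int m"
    "(\<Prod>t<m. if x (Suc t) = x t + 1 then f (x t) else g (int t - x t))
    = (\<Prod>j<nat (x m - x 0). f (x 0 + int j)) * (\<Prod>j<m - nat (x m - x 0). g (int j - x 0))"
    using Suc.IH Suc.prems by auto
  consider "x (Suc m) = x m + 1" | "x (Suc m) = x m" using Suc.prems[of m] by auto
  then show ?case
  proof cases
    case 1
    have "nat (x (Suc m) - x 0) = Suc (nat (x m - x 0))" using 1 IH by auto
    then show ?thesis using 1 IH by simp
  next
    case 2
    have "Suc m - nat (x m - x 0) = Suc (m - nat (x m - x 0))"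
      "int (m - nat (x m - x 0)) - x 0 = int m - x m" using IH by auto
    then show ?thesis using 2 IH by simp
  qed
qed simp

lemma up_mat_eq:
  assumes "\<And>i. i < N \<Longrightarrow> y ! i - x ! i \<in> {0, 1}"
  shows "up_mat N T A B x y = vandermonde N y / vandermonde N x *
    ((\<Prod>i<N. if y ! i = x ! i + 1 then up_u N A (x ! i) else up_b T A B (x ! i))
      / pochhammer (real T - real_of_int B) N)"
proof -
  have "(\<Prod>i<N. if y ! i = x ! i + 1 then up_u N A (x ! i) else up_b T A B (x ! i))
      = (\<Prod>i\<in>{..<N} \<inter> {i. y ! i = x ! i + 1}. up_u N A (x ! i))
        * (\<Prod>i\<in>{..<N} \<inter> - {i. y ! i = x ! i + 1}. up_b T A B (x ! i))"
    by (rule prod.If_cases) simp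
  also have "{..<N} \<inter> {i. y ! i = x ! i + 1} = {i. i < N \<and> y ! i = x ! i + 1}"
    by auto
  also have "{..<N} \<inter> - {i. y ! i = x ! i + 1} = {i. i < N \<and> y ! i = x ! i}"
    using assms by fastforce
  finally show ?thesis using assms by (simp add: up_mat_def jump_def mult_ac)
qed

text \<open>The Vandermonde factors telescope to a quotient of the two end values, which agree since
  both ends are N consecutive integers; \<open>prod_steps\<close> treats the remaining weights path
  by path. Hence the chain in t with steps \<open>P_t_plus\<close> weighs all families
  equally.\<close>

lemma wgt_paths:
  assumes S: "0 \<le> S" "S \<le> int T"
  shows "\<exists>C. \<forall>X\<in>\<Omega> N T S. X \<in> trajs (tuples N T S) T \<and> wgt (P_t_plus N T S) T X = C \<and> C \<noteq> 0"
proof -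
  define C where "C = (\<Prod>t<T. 1 / pochhammer (real T - real t) N) *
    (\<Prod>i<N. (\<Prod>j<nat S. up_u N S (int i + int j)) * (\<Prod>j<T - nat S. real_of_int (int T - S - (int j - int i))))"
  have "C \<noteq> 0"
  proof -
    have "pochhammer (real T - real t) N \<noteq> 0" if "t < T" for t
      using pochhammer_up_pos[of "int t" T N] that by simp
    then show ?thesis by (auto simp: C_def up_u_def)
  qed
  moreover have "X \<in> trajs (tuples N T S) T \<and> wgt (P_t_plus N T S) T X = C" if X: "X \<in> \<Omega> N T S" for X
  proof -
    have len: "length X = T + 1"
      using X by (simp add: \<Omega>_def)
    have tup: "length (X ! t) = N" "sorted_wrt (<) (X ! t)"
      and ends: "i < N \<Longrightarrow> X ! 0 ! i = int i" "i < N \<Longrightarrow> X ! T ! i = S + int i"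
      and stp: "t < T \<Longrightarrow> i < N \<Longrightarrow> X ! Suc t ! i - X ! t ! i \<in> {0, 1}" if "t \<le> T" for t i
      using X that by (auto simp: \<Omega>_def)
    have bnd: "X ! s ! i \<le> X ! (s + d) ! i \<and> X ! (s + d) ! i \<le> X ! s ! i + int d"
      if "i < N" "s + d \<le> T" for s d i
      using prod_steps[of d "\<lambda>u. X ! (s + u) ! i" "\<lambda>_. 1" "\<lambda>_. 1"] stp[of "s + _" i] that by simp
    have "X ! t \<in> tuples N T S t" if t: "t \<le> T" for t
    proof -
      have "X ! t ! i \<in> points N T S t" if i: "i < N" for i
        using bnd[OF i, of 0 t] bnd[OF i, of t "T - t"] ends[OF le0 i] t i by (auto simp: points_def)
      then show ?thesis using tup[OF t] by (auto simp: tuples_def in_set_conv_nth)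
    qed
    then have traj: "X \<in> trajs (tuples N T S) T" using len by (simp add: trajs_def)
    then have V: "vandermonde N (X ! t) > 0" if "t \<le> T" for t
      using trajs_nth[OF traj that] vandermonde_pos by (auto simp: tuples_eq_tup)
    have "wgt (P_t_plus N T S) T X = (\<Prod>t<T. vandermonde N (X ! Suc t) / vandermonde N (X ! t) *
      ((\<Prod>i<N. if X ! Suc t ! i = X ! t ! i + 1 then up_u N S (X ! t ! i) else up_b T S (int t) (X ! t ! i))
        / pochhammer (real T - real t) N))"
      unfolding wgt_def P_t_plus_eq
      by (intro prod.cong refl, subst up_mat_eq) (use stp in auto)
    also have "\<dots> = (\<Prod>t<T. vandermonde N (X ! Suc t) / vandermonde N (X ! t)) *
      ((\<Prod>t<T. \<Prod>i<N. if X ! Suc t ! i = X ! t ! i + 1 then up_u N S (X ! t ! i)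
          else up_b T S (int t) (X ! t ! i)) * (\<Prod>t<T. 1 / pochhammer (real T - real t) N))"
      by (simp add: prod.distrib[symmetric])
    also have "(\<Prod>t<T. vandermonde N (X ! Suc t) / vandermonde N (X ! t)) = 1"
    proof -
      have "(\<Prod>t<m. vandermonde N (X ! Suc t) / vandermonde N (X ! t))
          = vandermonde N (X ! m) / vandermonde N (X ! 0)" if "m \<le> T" for m
        using that
      proof (induction m)
        case 0
        then show ?case using V[of 0] by simp
      next
        case (Suc m)
        then show ?case using V[of m] by simp
      qed
      moreover have "vandermonde N (X ! T) = vandermonde N (X ! 0)"
        using ends[OF le0] unfolding vandermonde_def by (intro prod.cong refl) auto
      ultimately show ?thesis using V[of 0] by simp
    qed
    also have "(\<Prod>t<T. \<Prod>i<N. if X ! Suc t ! i = X ! t ! i + 1 then up_u N S (X ! t ! i)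
          else up_b T S (int t) (X ! t ! i))
        = (\<Prod>i<N. \<Prod>t<T. if X ! Suc t ! i = X ! t ! i + 1 then up_u N S (X ! t ! i)
          else up_b T S (int t) (X ! t ! i))"
      by (rule prod.swap)
    also have "\<dots> = (\<Prod>i<N. (\<Prod>j<nat S. up_u N S (int i + int j)) *
        (\<Prod>j<T - nat S. real_of_int (int T - S - (int j - int i))))"
    proof (intro prod.cong refl)
      fix i assume "i \<in> {..<N}"
      then have i: "i < N" by simp
      have "(\<Prod>t<T. if X ! Suc t ! i = X ! t ! i + 1 then up_u N S (X ! t ! i)
          else up_b T S (int t) (X ! t ! i))
        = (\<Prod>t<T. if X ! Suc t ! i = X ! t ! i + 1 then up_u N S (X ! t ! i)
          else real_of_int (int T - S - (int t - X ! t ! i)))"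
        by (intro prod.cong refl) (auto simp: up_b_def)
      also have "\<dots> = (\<Prod>j<nat (X ! T ! i - X ! 0 ! i). up_u N S (X ! 0 ! i + int j)) *
          (\<Prod>j<T - nat (X ! T ! i - X ! 0 ! i). real_of_int (int T - S - (int j - X ! 0 ! i)))"
        using prod_steps[of T "\<lambda>t. X ! t ! i" "up_u N S" "\<lambda>y. real_of_int (int T - S - y)"]
          stp[of _ i] i by simp
      finally show "(\<Prod>t<T. if X ! Suc t ! i = X ! t ! i + 1 then up_u N S (X ! t ! i)
          else up_b T S (int t) (X ! t ! i)) = (\<Prod>j<nat S. up_u N S (int i + int j)) *
        (\<Prod>j<T - nat S. real_of_int (int T - S - (int j - int i)))"
        using ends[OF le0 i] by simp
    qed
    finally show ?thesis using traj by (simp add: C_def)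
  qed
  ultimately show ?thesis by blast
qed

lemma sum_wgt_trajs:
  assumes "0 \<le> S" "S \<le> int T" "m \<le> T"
  shows "(\<Sum>X\<in>trajs (tuples N T S) m. wgt (P_t_plus N T S) m X) = 1"
  using assms(3)
proof (induction m)
  case 0
  show ?case unfolding sum_trajs_0 wgt_def using assms by (simp add: tuples_0)
next
  case (Suc m)
  have "(\<Sum>z\<in>tuples N T S (Suc m). P_t_plus N T S m (X ! m) z) = 1"
    if "X \<in> trajs (tuples N T S) m" for X
    using sum_up_mat[of "X ! m" N T S "int m"] trajs_nth[OF that, of m] Suc.prems
    by (simp add: tuples_eq_tup points_eq_pts P_t_plus_eq add.commute)
  then show ?case
    using Suc by (simp add: sum_trajs_Suc wgt_snoc sum_distrib_left[symmetric])
qed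

text \<open>A nonzero matrix entry forces steps 0 or 1, and the end slices are frozen; conversely
  \<open>wgt_paths\<close> gives families nonzero weight.\<close>

lemma mem_\<Omega>_iff:
  assumes S: "0 \<le> S" "S \<le> int T"
  shows "X \<in> \<Omega> N T S \<longleftrightarrow> X \<in> trajs (tuples N T S) T \<and> wgt (P_t_plus N T S) T X \<noteq> 0"
proof
  assume "X \<in> \<Omega> N T S"
  then show "X \<in> trajs (tuples N T S) T \<and> wgt (P_t_plus N T S) T X \<noteq> 0"
    using wgt_paths[OF S, of N] by metis
next
  assume X: "X \<in> trajs (tuples N T S) T \<and> wgt (P_t_plus N T S) T X \<noteq> 0"
  then have tupX: "X ! t \<in> tuples N T S t" if "t \<le> T" for t
    using trajs_nth that by blast
  have "P_t_plus N T S t (X ! t) (X ! Suc t) \<noteq> 0" if "t < T" for t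
    using X that by (auto simp: wgt_def)
  then have stp: "\<forall>i<N. X ! Suc t ! i - X ! t ! i \<in> {0, 1}" if "t < T" for t
    using that unfolding P_t_plus_def by metis
  have "X ! 0 = [0..int N - 1]" "X ! T = [S..S + int N - 1]"
    using tupX[of 0] tupX[of T] tuples_0[OF S] tuples_T[OF S] by auto
  then have "X ! 0 ! i = int i \<and> X ! T ! i = S + int i" if "i < N" for i
    using that by simp
  then show "X \<in> \<Omega> N T S"
    using stp tupX trajs_length[of X "tuples N T S" T] X by (auto simp: \<Omega>_def tuples_def)
qed

lemma finite_\<Omega>: "0 \<le> S \<Longrightarrow> S \<le> int T \<Longrightarrow> finite (\<Omega> N T S)"
  using finite_trajs[of T "tuples N T S"] finite_tuples
  by (rule_tac finite_subset[of _ "trajs (tuples N T S) T"]) (auto simp: mem_\<Omega>_iff)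

text \<open>The weights are constant on the families and sum to 1 because the rows are
  stochastic.\<close>

lemma pmf_\<Omega>:
  assumes S: "0 \<le> S" "S \<le> int T" and X: "X \<in> \<Omega> N T S"
  shows "pmf (pmf_of_set (\<Omega> N T S)) X = wgt (P_t_plus N T S) T X"
proof -
  obtain C where C: "\<And>X. X \<in> \<Omega> N T S \<Longrightarrow> wgt (P_t_plus N T S) T X = C"
    using wgt_paths[OF S] by metis
  have "1 = (\<Sum>X\<in>trajs (tuples N T S) T. wgt (P_t_plus N T S) T X)"
    by (simp add: sum_wgt_trajs[OF S])
  also have "\<dots> = (\<Sum>X\<in>\<Omega> N T S. wgt (P_t_plus N T S) T X)"
    by (intro sum.mono_neutral_right finite_trajs finite_tuples) (auto simp: mem_\<Omega>_iff[OF S])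
  also have "\<dots> = real (card (\<Omega> N T S)) * C"
    using C by simp
  finally have "C = 1 / real (card (\<Omega> N T S))"
    by (metis nonzero_eq_divide_eq mult.commute mult_zero_left zero_neq_one)
  moreover have "\<Omega> N T S \<noteq> {}" using X by auto
  ultimately show ?thesis
    using X C[OF X] finite_\<Omega>[OF S] by simp
qed


section \<open>Evolution of the determinants along a walk\<close>

locale shuffling =
  fixes N T n :: nat and S0 :: int and \<epsilon> :: "nat \<Rightarrow> int" and r t :: "nat \<Rightarrow> nat" and x :: "nat \<Rightarrow> int"
    and R :: nat
  assumes N1: "N \<ge> 1"
    and R_def: "R = Max (insert 0 (r ` {..<n}))"
    and S_bounds: "\<And>k. k \<le> R \<Longrightarrow> 0 \<le> S_at S0 \<epsilon> k \<and> S_at S0 \<epsilon> k \<le> int T"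
    and \<epsilon>: "\<And>k. k < R \<Longrightarrow> \<epsilon> (Suc k) \<in> {1, - 1}"
    and inj: "inj_on (\<lambda>i. (r i, t i, x i)) {..<n}"
    and r_mono: "\<And>i j. i \<le> j \<Longrightarrow> j < n \<Longrightarrow> r i \<le> r j"
    and t_anti: "\<And>i j. i \<le> j \<Longrightarrow> j < n \<Longrightarrow> t i \<ge> t j"
    and t_le: "\<And>i. i < n \<Longrightarrow> t i \<le> T"
    and x_points: "\<And>i. i < n \<Longrightarrow> x i \<in> points N T (S_at S0 \<epsilon> (r i)) (t i)"
begin

abbreviation S :: "nat \<Rightarrow> int" where "S \<equiv> S_at S0 \<epsilon>"

lemma S_Suc: "S (Suc k) = S k + \<epsilon> (Suc k)"
  by (simp add: S_at_def)

lemma S_0: "S 0 = S0"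
  by (simp add: S_at_def)

text \<open>A monotone lattice walk from \<open>(0, T)\<close> to \<open>(R, 0)\<close> through all the points
  \<open>(r i, t i)\<close>, the pointwise maximum of walks through the single points; after \<open>s\<close> steps it
  is at \<open>(\<rho> s, \<theta> s)\<close>, and \<open>pos i\<close> is the time of the visit to \<open>(r i, t i)\<close>.\<close>

definition pos :: "nat \<Rightarrow> nat" where "pos i = r i + (T - t i)"
definition \<rho> :: "nat \<Rightarrow> nat" where "\<rho> s = Max (insert 0 ((\<lambda>i. min (r i) (s - (T - t i))) ` {..<n}))"
definition \<theta> :: "nat \<Rightarrow> nat" where "\<theta> s = T - (s - \<rho> s)"
definition m :: nat where "m = T + R"

lemma r_le: "i < n \<Longrightarrow> r i \<le> R"
  unfolding R_def by (intro Max_ge) auto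

lemma \<rho>_ge: "i < n \<Longrightarrow> min (r i) (s - (T - t i)) \<le> \<rho> s"
  unfolding \<rho>_def by (intro Max_ge) auto

lemma \<rho>_leI: "(\<And>i. i < n \<Longrightarrow> min (r i) (s - (T - t i)) \<le> b) \<Longrightarrow> \<rho> s \<le> b"
  unfolding \<rho>_def by (subst Max_le_iff) auto

lemma \<rho>_le_R: "\<rho> s \<le> R"
  using r_le by (intro \<rho>_leI) (auto simp: min_le_iff_disj)

lemma \<rho>_le: "\<rho> s \<le> s"
  by (intro \<rho>_leI) auto

lemma \<rho>_Suc: "\<rho> s \<le> \<rho> (Suc s) \<and> \<rho> (Suc s) \<le> Suc (\<rho> s)"
proof
  show "\<rho> s \<le> \<rho> (Suc s)"
  proof (rule \<rho>_leI)
    fix i assume "i < n"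
    then show "min (r i) (s - (T - t i)) \<le> \<rho> (Suc s)"
      using \<rho>_ge[of i "Suc s"] by linarith
  qed
  show "\<rho> (Suc s) \<le> Suc (\<rho> s)"
  proof (rule \<rho>_leI)
    fix i assume "i < n"
    then show "min (r i) (Suc s - (T - t i)) \<le> Suc (\<rho> s)"
      using \<rho>_ge[of i s] by linarith
  qed
qed

lemma \<rho>_lipschitz: "\<rho> (s + d) \<le> \<rho> s + d"
proof (induction d)
  case (Suc d)
  then show ?case using \<rho>_Suc[of "s + d"] by simp
qed simp

lemma \<rho>_m: "\<rho> m = R"
proof (rule antisym[OF \<rho>_le_R])
  have "r i \<le> \<rho> m" if "i < n" for i
    using \<rho>_ge[OF that, of m] r_le[OF that] by (simp add: m_def)
  then show "R \<le> \<rho> m"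
    unfolding R_def by (subst Max_le_iff) auto
qed

lemma walk_bound: "s \<le> m \<Longrightarrow> s - \<rho> s \<le> T"
  using \<rho>_lipschitz[of s "m - s"] \<rho>_le[of s] \<rho>_m by (auto simp: m_def)

lemma walk:
  assumes "s < m"
  shows "\<rho> (Suc s) = Suc (\<rho> s) \<and> \<theta> (Suc s) = \<theta> s \<or> \<rho> (Suc s) = \<rho> s \<and> \<theta> s = Suc (\<theta> (Suc s))"
  using \<rho>_Suc[of s] walk_bound[of "Suc s"] \<rho>_le[of s] assms unfolding \<theta>_def by linarith

lemma \<rho>_0: "\<rho> 0 = 0" and \<theta>_0: "\<theta> 0 = T" and \<theta>_m: "\<theta> m = 0"
  using \<rho>_le[of 0] by (simp_all add: \<theta>_def \<rho>_m) (simp add: m_def)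

lemma \<theta>_le: "\<theta> s \<le> T"
  by (simp add: \<theta>_def)

text \<open>A later point has \<open>t j\<close> at most \<open>t i\<close>, so its walk goes down
  for at least \<open>T - t i\<close> steps; an earlier one has \<open>r j\<close> at most
  \<open>r i\<close>. Neither pushes the maximum beyond \<open>r i\<close>.\<close>

lemma \<rho>_pos: "i < n \<Longrightarrow> \<rho> (pos i) = r i"
proof (rule antisym)
  assume i: "i < n"
  show "r i \<le> \<rho> (pos i)"
    using \<rho>_ge[OF i, of "pos i"] by (simp add: pos_def)
  show "\<rho> (pos i) \<le> r i"
  proof (rule \<rho>_leI)
    fix j assume j: "j < n"
    show "min (r j) (pos i - (T - t j)) \<le> r i"
    proof (cases "i \<le> j")
      case True
      then show ?thesis using t_anti[OF True j] by (simp add: pos_def)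
    next
      case False
      then show ?thesis using r_mono[of j i] i by simp
    qed
  qed
qed

lemma \<theta>_pos: "i < n \<Longrightarrow> \<theta> (pos i) = t i"
  using \<rho>_pos[of i] t_le[of i] by (simp add: \<theta>_def) (simp add: pos_def)

lemma pos_le_m: "i < n \<Longrightarrow> pos i \<le> m"
  using r_le[of i] by (simp add: pos_def m_def)

lemma pos_mono: "i \<le> j \<Longrightarrow> j < n \<Longrightarrow> pos i \<le> pos j"
  using r_mono[of i j] t_anti[of i j] by (simp add: pos_def add_mono)

lemma \<rho>_mono: "s \<le> s' \<Longrightarrow> \<rho> s \<le> \<rho> s'"
  by (induction s' rule: dec_induct) (use \<rho>_Suc in \<open>auto intro: order_trans\<close>)

lemma \<theta>_anti: "s \<le> s' \<Longrightarrow> s' \<le> m \<Longrightarrow> \<theta> s' \<le> \<theta> s"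
proof (induction s' rule: dec_induct)
  case (step u)
  then show ?case using walk[of u] by auto
qed simp

section \<open>Operators and eigenvalues along the walk\<close>

abbreviation Sv :: "nat \<Rightarrow> int" where "Sv s \<equiv> S (\<rho> s)"
definition pv :: "nat \<Rightarrow> int set" where "pv s = pts N T (Sv s) (int (\<theta> s))"
definition dv :: "nat \<Rightarrow> nat" where "dv s = num_pts N T (Sv s) (int (\<theta> s))"
definition H :: "nat \<Rightarrow> nat \<Rightarrow> int \<Rightarrow> real" where "H s = hahn_val N T (Sv s) (int (\<theta> s))"
definition C :: "nat \<Rightarrow> nat \<Rightarrow> nat \<Rightarrow> real" where
  "C k s s' = c_coeff N T S0 \<epsilon> k (\<rho> s, \<theta> s) (\<rho> s', \<theta> s')"

lemma Sv: "0 \<le> Sv s" "Sv s \<le> int T"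
  using S_bounds[OF \<rho>_le_R] by auto

lemma \<theta>: "0 \<le> int (\<theta> s)" "int (\<theta> s) \<le> int T"
  using \<theta>_le[of s] by auto

lemma H_eq_0: "k \<ge> dv s \<Longrightarrow> H s k y = 0"
  by (simp add: H_def dv_def hahn_val_def)

lemma N_le_dv: "N \<le> dv s"
  by (simp add: dv_def num_pts_def)

lemma dv_le: "dv s \<le> N + T"
  using \<theta>(2)[of s] by (simp add: dv_def num_pts_def)

lemma C_refl: "C k s s = 1"
  by (simp add: C_def c_coeff_def)

text \<open>\<open>c_coeff\<close> changes t first and S afterwards, not in the order of the walk.
  But each \<open>c_t_minus\<close> varies with t alone and each \<open>c_S\<close> with S alone, so
  the coefficient splits into a product over levels and one over times, each multiplicative.\<close>

lemma C_mult:
  assumes "s \<le> s'" "s' \<le> s''" "s'' \<le> m"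
  shows "C k s s' * C k s' s'' = C k s s''"
proof -
  have t: "(\<Prod>j = \<theta> s' + 1..\<theta> s. g j) * (\<Prod>j = \<theta> s'' + 1..\<theta> s'. g j) = (\<Prod>j = \<theta> s'' + 1..\<theta> s. g j)"
    for g :: "nat \<Rightarrow> real"
    using \<theta>_anti[of s s'] \<theta>_anti[of s' s''] assms
      prod.atLeastLessThan_concat[of "Suc (\<theta> s'')" "Suc (\<theta> s')" "Suc (\<theta> s)" g]
    by (simp add: atLeastLessThanSuc_atLeastAtMost mult.commute)
  have r: "(\<Prod>j = \<rho> s..<\<rho> s'. g j) * (\<Prod>j = \<rho> s'..<\<rho> s''. g j) = (\<Prod>j = \<rho> s..<\<rho> s''. g j)"
    for g :: "nat \<Rightarrow> real"
    using \<rho>_mono[of s s'] \<rho>_mono[of s' s''] assms by (intro prod.atLeastLessThan_concat) auto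
  have C: "C k s s' = (\<Prod>j = \<theta> s' + 1..\<theta> s. c_t_minus N T 0 j k)
      * (\<Prod>j = \<rho> s..<\<rho> s'. c_S (\<epsilon> (j + 1)) N T (S j) 0 k)" for s s'
  proof -
    have "c_t_minus N T A = c_t_minus N T 0" "c_S e N T A' b = c_S e N T A' 0" for A e A' b
      by (simp_all add: fun_eq_iff c_t_minus_def c_t_plus_def c_S_def c_S_minus_def c_S_plus_def)
    from this(1)[of "Sv s"] this(2)[of _ _ "\<theta> s"] show ?thesis
      by (simp add: C_def c_coeff_def)
  qed
  show ?thesis
    unfolding C t[symmetric] r[symmetric] by (simp only: mult_ac)
qed

definition down :: "nat \<Rightarrow> bool" where "down s \<longleftrightarrow> \<rho> (Suc s) = \<rho> s"

lemma downD: "s < m \<Longrightarrow> down s \<Longrightarrow> \<theta> s = Suc (\<theta> (Suc s)) \<and> Sv (Suc s) = Sv s"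
  using walk[of s] by (auto simp: down_def)

lemma not_downD:
  assumes "s < m" "\<not> down s"
  shows "\<rho> (Suc s) = Suc (\<rho> s) \<and> \<theta> (Suc s) = \<theta> s \<and> Sv (Suc s) = Sv s + \<epsilon> (Suc (\<rho> s))
    \<and> (\<epsilon> (Suc (\<rho> s)) = 1 \<or> \<epsilon> (Suc (\<rho> s)) = - 1)"
  using walk[of s] assms \<epsilon>[of "\<rho> s"] \<rho>_le_R[of "Suc s"] by (auto simp: down_def S_Suc)

lemma C_Suc:
  assumes "s < m"
  shows "C k s (Suc s) = (if down s then c_t_plus N T (Sv s) (\<theta> (Suc s)) k
    else c_S (\<epsilon> (Suc (\<rho> s))) N T (Sv s) (\<theta> s) k)"
proof (cases "down s")
  case True
  then have "\<rho> (Suc s) = \<rho> s" "\<theta> s = Suc (\<theta> (Suc s))"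
    using downD[OF assms] by (auto simp: down_def)
  then show ?thesis
    using True by (simp add: C_def c_coeff_def c_t_minus_def)
next
  case False
  then have "\<rho> (Suc s) = Suc (\<rho> s)" "\<theta> (Suc s) = \<theta> s"
    using not_downD[OF assms] by auto
  then show ?thesis
    using False by (simp add: C_def c_coeff_def)
qed

definition \<beta> :: "nat \<Rightarrow> real" where
  "\<beta> s = (if down s then lam N T (int (\<theta> (Suc s))) 0
     else if \<epsilon> (Suc (\<rho> s)) = 1 then lam N T (Sv s) 0 else lam N T (Sv s - 1) 0)"

text \<open>Functions move forward from vertex s to s + 1, while \<open>Mat s\<close> has its rows
  at s + 1 and its columns at s. Hence an increase of S uses \<open>dn\<close> and a decrease uses
  \<open>up\<close>.\<close>

definition Hop :: "nat \<Rightarrow> (int \<Rightarrow> real) \<Rightarrow> int \<Rightarrow> real" where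
  "Hop s = (if down s then hop 1 (up_u N (Sv s)) (up_b T (Sv s) (int (\<theta> (Suc s))))
     else if \<epsilon> (Suc (\<rho> s)) = 1 then hop (- 1) dn_u (dn_b N (Sv s))
     else hop 1 (up_u N (int (\<theta> s))) (up_b T (int (\<theta> s)) (Sv s - 1)))"

definition Mat :: "nat \<Rightarrow> int list \<Rightarrow> int list \<Rightarrow> real" where
  "Mat s = (if down s then P_t_plus N T (Sv s) (\<theta> (Suc s))
     else P_S (- \<epsilon> (Suc (\<rho> s))) N T (Sv (Suc s)) (\<theta> s))"

lemma step_cases [consumes 1, case_names down plus minus]:
  assumes "s < m"
  obtains "down s" "int (\<theta> s) = int (\<theta> (Suc s)) + 1" "Sv (Suc s) = Sv s" "int (\<theta> (Suc s)) < int T"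
  | "\<not> down s" "\<epsilon> (Suc (\<rho> s)) = 1" "Sv (Suc s) = Sv s + 1" "\<theta> (Suc s) = \<theta> s" "Sv s < int T"
  | "\<not> down s" "\<epsilon> (Suc (\<rho> s)) = - 1" "Sv s = Sv (Suc s) + 1" "\<theta> (Suc s) = \<theta> s" "Sv (Suc s) < int T"
proof (cases "down s")
  case True
  note d = downD[OF assms True]
  show ?thesis
    by (rule that(1)[OF True]) (use d \<theta>_le[of s] in simp_all)
next
  case False
  note d = not_downD[OF assms False]
  from d consider "\<epsilon> (Suc (\<rho> s)) = 1" | "\<epsilon> (Suc (\<rho> s)) = - 1" by blast
  then show ?thesis
  proof cases
    case 1
    show ?thesis
      by (rule that(2)[OF False 1]) (use d 1 Sv(2)[of "Suc s"] in auto)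
  next
    case 2
    show ?thesis
      by (rule that(3)[OF False 2]) (use d 2 Sv(2)[of s] in auto)
  qed
qed

lemma Mat_Hop:
  assumes "s < m"
  shows "\<exists>\<sigma> u b \<kappa>. Hop s = hop \<sigma> u b \<and> Mat s = jump N \<sigma> u b \<kappa> \<and> \<sigma> \<in> {1, - 1}
    \<and> (\<forall>a\<in>pv (Suc s). (a + \<sigma> \<in> pv s \<or> u a = 0) \<and> (a \<in> pv s \<or> b a = 0))"
  using assms
proof (cases rule: step_cases)
  case down
  have "\<forall>a\<in>pv (Suc s). (a + 1 \<in> pv s \<or> up_u N (Sv s) a = 0)
      \<and> (a \<in> pv s \<or> up_b T (Sv s) (int (\<theta> (Suc s))) a = 0)"
    unfolding pv_def down using pts_up_bdry by blast
  then show ?thesis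
    using down by (auto simp: Hop_def Mat_def P_t_plus_eq up_mat_def)
next
  case plus
  have "\<forall>a\<in>pv (Suc s). (a + - 1 \<in> pv s \<or> dn_u a = 0) \<and> (a \<in> pv s \<or> dn_b N (Sv s) a = 0)"
    unfolding pv_def plus(3,4) pts_commute[of N T _ "int (\<theta> s)"] using pts_dn_bdry by blast
  then show ?thesis
    using plus unfolding Hop_def Mat_def P_S_def
    by (intro exI[of _ "- 1"] exI[of _ dn_u] exI[of _ "dn_b N (Sv s)"]
        exI[of _ "pochhammer (real_of_int (Sv s + 1)) N"])
       (simp add: P_S_minus_eq dn_mat_def)
next
  case minus
  have "\<forall>a\<in>pv (Suc s). (a + 1 \<in> pv s \<or> up_u N (int (\<theta> s)) a = 0)
      \<and> (a \<in> pv s \<or> up_b T (int (\<theta> s)) (Sv (Suc s)) a = 0)"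
    unfolding pv_def minus(3,4) pts_commute[of N T _ "int (\<theta> s)"] using pts_up_bdry by blast
  then show ?thesis
    using minus unfolding Hop_def Mat_def P_S_def
    by (intro exI[of _ 1] exI[of _ "up_u N (int (\<theta> s))"] exI[of _ "up_b T (int (\<theta> s)) (Sv (Suc s))"]
        exI[of _ "pochhammer (real T - real_of_int (Sv (Suc s))) N"])
       (simp add: P_S_plus_eq up_mat_def)
qed

lemma lam_C:
  assumes "s < m"
  shows "\<beta> s > 0" "\<beta> s * C k s (Suc s) = (if down s then lam N T (int (\<theta> (Suc s))) k
     else if \<epsilon> (Suc (\<rho> s)) = 1 then lam N T (Sv s) k else lam N T (Sv s - 1) k)"
proof -
  show "\<beta> s > 0"
    using assms
  proof (cases rule: step_cases)
    case minus
    then show ?thesis using Sv(1)[of "Suc s"] N1 by (simp add: \<beta>_def lam_0_pos)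
  qed (use Sv(1)[of s] N1 in \<open>simp_all add: \<beta>_def lam_0_pos\<close>)
  show "\<beta> s * C k s (Suc s) = (if down s then lam N T (int (\<theta> (Suc s))) k
     else if \<epsilon> (Suc (\<rho> s)) = 1 then lam N T (Sv s) k else lam N T (Sv s - 1) k)"
    using assms
  proof (cases rule: step_cases)
    case down
    then show ?thesis using C_Suc[OF assms] lam_eq_c_t_plus[of "\<theta> (Suc s)" T N k "Sv s"] N1 by (simp add: \<beta>_def)
  next
    case plus
    then show ?thesis using C_Suc[OF assms] lam_eq_c_S_plus[of "Sv s" T N k "\<theta> s"] N1 Sv(1)[of s]
      by (simp add: \<beta>_def c_S_def)
  next
    case minus
    then show ?thesis using C_Suc[OF assms] lam_eq_c_S_plus[of "Sv (Suc s)" T N k "\<theta> s"] N1 Sv(1)[of "Suc s"]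
      by (simp add: \<beta>_def c_S_def c_S_minus_def)
  qed
qed

lemma Hop_H:
  assumes s: "s < m" and k: "k < dv s \<or> H (Suc s) k y = 0 \<or> C k s (Suc s) = 0" and y: "y \<in> pv (Suc s)"
  shows "Hop s (H s k) y = \<beta> s * C k s (Suc s) * H (Suc s) k y"
  unfolding lam_C(2)[OF s]
proof -
  have k': "k < dv s \<or> H (Suc s) k y = 0 \<or> \<beta> s * C k s (Suc s) = 0"
    using k by auto
  from s show "Hop s (H s k) y = (if down s then lam N T (int (\<theta> (Suc s))) k
      else if \<epsilon> (Suc (\<rho> s)) = 1 then lam N T (Sv s) k else lam N T (Sv s - 1) k) * H (Suc s) k y"
  proof (cases rule: step_cases)
    case down
    then show ?thesis
      using hop_up_hahn_val[OF Sv[of s] \<theta>(1) down(4), where N = N and k = k and x = y] k' y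
      unfolding lam_C(2)[OF s] by (simp add: Hop_def H_def dv_def pv_def)
  next
    case plus
    then show ?thesis
      using hop_dn_hahn_val[OF \<theta>[of s] Sv(1)[of s] plus(5), where N = N and k = k and x = y] k' y
      unfolding lam_C(2)[OF s]
      by (simp add: Hop_def H_def dv_def pv_def pts_commute[of N T _ "int (\<theta> s)"]
          num_pts_commute[of N T _ "int (\<theta> s)"] hahn_val_commute[of N T _ "int (\<theta> s)"])
  next
    case minus
    then show ?thesis
      using hop_up_hahn_val[OF \<theta>[of s] Sv(1)[of "Suc s"] minus(5), where N = N and k = k and x = y] k' y
      unfolding lam_C(2)[OF s]
      by (simp add: Hop_def H_def dv_def pv_def pts_commute[of N T _ "int (\<theta> s)"]
          num_pts_commute[of N T _ "int (\<theta> s)"] hahn_val_commute[of N T _ "int (\<theta> s)"])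
  qed
qed

text \<open>Once the index \<open>k\<close> leaves the range \<open>k < dv s\<close> through the change of \<open>S\<close>, the
  coefficient vanishes; if it does so through the decrease of \<open>\<theta> s\<close>, it never returns.\<close>

lemma C_nonzero_bounds:
  assumes "u \<le> s" "s \<le> m" "k < dv u" "C k u s \<noteq> 0"
  shows "int k < int N + Sv s \<and> int k < int N + (int T - Sv s) \<and> int k < int N + (int T - int (\<theta> s))"
  using assms
proof (induction s rule: dec_induct)
  case base
  then show ?case using Sv[of u] \<theta>[of u] by (auto simp: dv_def num_pts_def)
next
  case (step s)
  have s: "s < m" using step by simp
  have nz: "C k u s \<noteq> 0" "C k s (Suc s) \<noteq> 0"
    using C_mult[of u s "Suc s" k] step by auto
  have IH: "int k < int N + Sv s" "int k < int N + (int T - Sv s)" "int k < int N + (int T - int (\<theta> s))"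
    using step nz by auto
  from s show ?case
  proof (cases rule: step_cases)
    case down
    then show ?thesis using IH by auto
  next
    case plus
    have "c_S_plus N T (Sv s) (\<theta> s) k \<noteq> 0"
      using nz(2) plus by (simp add: C_Suc[OF s] c_S_def)
    moreover have "c_S_plus N T (Sv s) (\<theta> s) k = 0" if "int k = int N + (int T - Sv s) - 1"
    proof -
      have eq: "real k = real T + real N - real_of_int (Sv s) - 1"
        using that by linarith
      have "real T + real N - real_of_int (Sv s) - 1 \<noteq> 0"
        using plus(5) N1 by linarith
      then show ?thesis by (simp add: c_S_plus_def eq)
    qed
    ultimately show ?thesis using IH plus by force
  next
    case minus
    have "c_S_plus N T (Sv (Suc s)) (\<theta> s) k \<noteq> 0"
      using nz(2) minus by (simp add: C_Suc[OF s] c_S_def c_S_minus_def)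
    moreover have "c_S_plus N T (Sv (Suc s)) (\<theta> s) k = 0" if "int k = int N + Sv (Suc s)"
    proof -
      have eq: "real k = real_of_int (Sv (Suc s)) + real N"
        using that by linarith
      have "real_of_int (Sv (Suc s)) + real N \<noteq> 0"
        using Sv(1)[of "Suc s"] N1 by linarith
      then show ?thesis by (simp add: c_S_plus_def eq)
    qed
    ultimately show ?thesis using IH minus by force
  qed
qed

text \<open>The relation alone can fail when k is an index at s + 1 but not at s. Since k is an
  index at u and \<open>\<theta>\<close> never increases, only a change of S can have removed it,
  and then \<open>C k u s\<close> is 0.\<close>

lemma Hop_H':
  assumes u: "u \<le> s" "s < m" "k < dv u" and y: "y \<in> pv (Suc s)"
  shows "C k u s * Hop s (H s k) y = \<beta> s * (C k u (Suc s) * H (Suc s) k y)"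
proof (cases "C k u s = 0")
  case True
  then show ?thesis using C_mult[of u s "Suc s" k] u by auto
next
  case False
  have "k < dv s \<or> H (Suc s) k y = 0"
  proof (rule disjCI)
    assume "H (Suc s) k y \<noteq> 0"
    then have "k < dv (Suc s)" using H_eq_0[of "Suc s" k y] by force
    then have "int k < int N + int (\<theta> (Suc s))"
      using \<theta>[of "Suc s"] Sv[of "Suc s"] by (auto simp: dv_def num_pts_def)
    moreover have "\<theta> (Suc s) \<le> \<theta> s" using \<theta>_anti[of s "Suc s"] u by simp
    moreover have "int k < int N + Sv s \<and> int k < int N + (int T - Sv s) \<and> int k < int N + (int T - int (\<theta> s))"
      by (rule C_nonzero_bounds[of u]) (use False u in simp_all)
    ultimately have "int k - int N < min (min (Sv s) (int (\<theta> s))) (min (int T - Sv s) (int T - int (\<theta> s)))"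
      by simp
    moreover have "k < N + nat b" if "int k - int N < b" for b
      using that by arith
    ultimately show "k < dv s"
      unfolding dv_def num_pts_def by blast
  qed
  then have "Hop s (H s k) y = \<beta> s * C k s (Suc s) * H (Suc s) k y"
    by (intro Hop_H u(2) y) auto
  moreover have "C k u (Suc s) = C k u s * C k s (Suc s)"
    using C_mult[of u s "Suc s" k] u by simp
  ultimately show ?thesis by simp
qed

lemma Hop_linear:
  assumes "s < m"
  shows "Hop s (\<lambda>y. f y - g y) z = Hop s f z - Hop s g z"
    and "Hop s (\<lambda>y. c * f y) z = c * Hop s f z"
    and "Hop s (\<lambda>y. \<Sum>i\<in>I. F i y) z = (\<Sum>i\<in>I. Hop s (F i) z)"
  using Mat_Hop[OF assms] by (auto simp: hop_diff hop_cmult hop_sum)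

lemma Hop_cong:
  assumes "s < m" "z \<in> pv (Suc s)" "\<And>y. y \<in> pv s \<Longrightarrow> f y = g y"
  shows "Hop s f z = Hop s g z"
proof -
  obtain \<sigma> u b where "Hop s = hop \<sigma> u b"
    and "\<forall>a\<in>pv (Suc s). (a + \<sigma> \<in> pv s \<or> u a = 0) \<and> (a \<in> pv s \<or> b a = 0)"
    using Mat_Hop[OF assms(1)] by blast
  then show ?thesis
    using assms(2,3) by (auto intro!: hop_cong[of z \<sigma> "pv s"])
qed

definition wpt :: "nat \<Rightarrow> real" where "wpt i = wt N T (S (r i)) (int (t i)) (x i)"
definition \<psi> :: "nat \<Rightarrow> nat \<Rightarrow> real" where "\<psi> i k = \<Psi> N T (S (r i)) (t i) k (x i)"

lemma wpt_pos: "wpt i > 0"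
  by (simp add: wpt_def wt_pos)

lemma x_pv: "i < n \<Longrightarrow> x i \<in> pv (pos i)"
  using x_points[of i] by (simp add: pv_def points_eq_pts \<rho>_pos \<theta>_pos)

lemma \<psi>_eq: "i < n \<Longrightarrow> \<psi> i k = H (pos i) k (x i) * sqrt (wpt i)"
  using S_bounds[OF r_le[of i]] t_le[of i]
  by (simp add: \<psi>_def \<Psi>_eq_hahn_val H_def wpt_def \<rho>_pos \<theta>_pos)

lemma \<psi>_eq_0: "i < n \<Longrightarrow> k \<ge> dv (pos i) \<Longrightarrow> \<psi> i k = 0"
  by (simp add: \<psi>_eq H_eq_0)

abbreviation D :: nat where "D \<equiv> N + T"

text \<open>Completeness at the vertex of the point. It takes all indices to represent the point
  mass; \<open>D\<close> bounds their number at every vertex.\<close>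

lemma \<psi>_complete:
  assumes i: "i < n" and y: "y \<in> pv (pos i)"
  shows "(\<Sum>k<D. \<psi> i k * H (pos i) k y) = (if y = x i then 1 / sqrt (wpt i) else 0)"
proof -
  have "(\<Sum>k<D. H (pos i) k y * H (pos i) k (x i)) * wpt i = (if y = x i then 1 else 0)"
    using hahn_val_complete[OF Sv[of "pos i"] \<theta>[of "pos i"], of y N "x i" D] y x_pv[OF i] dv_le[of "pos i"] i
    by (simp add: pv_def dv_def H_def wpt_def \<rho>_pos \<theta>_pos)
  then have eq: "(\<Sum>k<D. H (pos i) k y * H (pos i) k (x i)) = (if y = x i then 1 else 0) / wpt i"
    using wpt_pos[of i] by (simp add: field_simps split: if_splits)
  have "(\<Sum>k<D. \<psi> i k * H (pos i) k y) = sqrt (wpt i) * (\<Sum>k<D. H (pos i) k y * H (pos i) k (x i))"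
    by (simp add: \<psi>_eq[OF i] sum_distrib_left mult_ac)
  then show ?thesis
    using sqrt_divide_self_eq[of "wpt i"] wpt_pos[of i] unfolding eq
    by (simp add: inverse_eq_divide)
qed

section \<open>Evolution of the functions with point perturbations\<close>

definition \<phi>1 :: "(nat \<Rightarrow> real) \<Rightarrow> nat \<Rightarrow> int \<Rightarrow> real" where
  "\<phi>1 z s y = (\<Prod>i | i < n \<and> pos i = s. 1 - z i * (if y = x i then 1 else 0))"

definition \<phi> :: "(nat \<Rightarrow> real) \<Rightarrow> nat \<Rightarrow> int list \<Rightarrow> real" where
  "\<phi> z s X = (\<Prod>a<N. \<phi>1 z s (X ! a))"

text \<open>The factor of a vertex is applied on leaving it, so \<open>gev z s\<close> has felt only
  the points at earlier vertices.\<close>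

primrec gev :: "(nat \<Rightarrow> real) \<Rightarrow> nat \<Rightarrow> nat \<Rightarrow> int \<Rightarrow> real" where
  "gev z 0 = H 0"
| "gev z (Suc s) = (\<lambda>j. Hop s (\<lambda>y. \<phi>1 z s y * gev z s j y))"

definition B :: "nat \<Rightarrow> real" where "B s = (\<Prod>u<s. \<beta> u)"

text \<open>The size of the perturbation that point i creates in function j: its value there before
  the vertex acts, with the common factor \<open>B\<close> removed.\<close>

definition Y :: "(nat \<Rightarrow> real) \<Rightarrow> nat \<Rightarrow> nat \<Rightarrow> real" where
  "Y z j i = gev z (pos i) j (x i) * sqrt (wpt i) / B (pos i)"

lemma B_pos: "s \<le> m \<Longrightarrow> B s > 0"
  unfolding B_def using lam_C(1) by (intro prod_pos) auto

lemma same_pos_eq: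
  assumes "i < n" "i' < n" "pos i = pos i'" "x i = x i'"
  shows "i = i'"
proof -
  have "r i = r i'" "t i = t i'"
    using \<rho>_pos[of i] \<rho>_pos[of i'] \<theta>_pos[of i] \<theta>_pos[of i'] assms by auto
  then show ?thesis
    using inj assms unfolding inj_on_def by auto
qed

text \<open>Points at one vertex have distinct \<open>x i\<close>, so at most one factor differs
  from 1.\<close>

lemma \<phi>1_eq: "\<phi>1 z s y = 1 - (\<Sum>i | i < n \<and> pos i = s. z i * (if y = x i then 1 else 0))"
proof (cases "\<exists>i<n. pos i = s \<and> y = x i")
  case True
  then obtain i where i: "i < n" "pos i = s" "y = x i" by auto
  have other: "y \<noteq> x j" if "j \<in> {i. i < n \<and> pos i = s} - {i}" for j
    using that i same_pos_eq[of i j] by auto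
  have "\<phi>1 z s y = 1 - z i"
    unfolding \<phi>1_def using i other by (subst prod.remove[of _ i]) auto
  moreover have "(\<Sum>i | i < n \<and> pos i = s. z i * (if y = x i then 1 else 0)) = z i"
    using i other by (subst sum.remove[of _ i]) auto
  ultimately show ?thesis by simp
next
  case False
  then show ?thesis by (auto simp: \<phi>1_def intro!: prod.neutral sum.neutral)
qed

text \<open>A Duhamel formula: the free evolution of function j minus, for each point passed, the
  point mass created there and carried freely from \<open>pos i\<close> to s.\<close>

definition gsum :: "(nat \<Rightarrow> real) \<Rightarrow> nat \<Rightarrow> nat set \<Rightarrow> nat \<Rightarrow> int \<Rightarrow> real" where
  "gsum z s I j y = B s * (C j 0 s * H s j y
     - (\<Sum>i\<in>I. z i * Y z j i * (\<Sum>k<D. \<psi> i k * C k (pos i) s * H s k y)))"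

lemma \<phi>1_gev:
  assumes s: "s \<le> m" and y: "y \<in> pv s" and g: "\<And>y. y \<in> pv s \<Longrightarrow> gev z s j y = gsum z s {i. i < n \<and> pos i < s} j y"
  shows "\<phi>1 z s y * gev z s j y = gsum z s {i. i < n \<and> pos i < Suc s} j y"
proof -
  let ?I = "{i. i < n \<and> pos i = s}"
  let ?f = "\<lambda>i. z i * Y z j i * (\<Sum>k<D. \<psi> i k * C k (pos i) s * H s k y)"
  have f: "B s * ?f i = z i * (if y = x i then 1 else 0) * gev z s j y" if "i \<in> ?I" for i
  proof -
    have i: "i < n" "s = pos i" using that by auto
    \<comment> \<open>A perturbation just created is still concentrated at its point.\<close>
    have "(\<Sum>k<D. \<psi> i k * C k (pos i) s * H s k y) = (if y = x i then 1 / sqrt (wpt i) else 0)"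
      using \<psi>_complete[OF i(1), of y] y i by (simp add: C_refl)
    then show ?thesis
      using B_pos[OF s] wpt_pos[of i] i by (auto simp: Y_def)
  qed
  have I: "(\<Sum>i\<in>?I. B s * ?f i) = (\<Sum>i\<in>?I. z i * (if y = x i then 1 else 0)) * gev z s j y"
    unfolding sum_distrib_right by (rule sum.cong[OF refl f])
  have "{i. i < n \<and> pos i < Suc s} = {i. i < n \<and> pos i < s} \<union> ?I" by auto
  then have "(\<Sum>i | i < n \<and> pos i < Suc s. ?f i) = (\<Sum>i | i < n \<and> pos i < s. ?f i) + (\<Sum>i\<in>?I. ?f i)"
    by (simp only:) (subst sum.union_disjoint, auto)
  then have "gsum z s {i. i < n \<and> pos i < Suc s} j y
      = gsum z s {i. i < n \<and> pos i < s} j y - (\<Sum>i\<in>?I. B s * ?f i)"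
    by (simp add: gsum_def algebra_simps sum_distrib_left)
  also have "\<dots> = \<phi>1 z s y * gev z s j y"
    unfolding I using g[OF y] by (simp add: \<phi>1_eq algebra_simps)
  finally show ?thesis by simp
qed

lemma gev_eq:
  assumes "s \<le> m" "j < N" "y \<in> pv s"
  shows "gev z s j y = gsum z s {i. i < n \<and> pos i < s} j y"
  using assms
proof (induction s arbitrary: y)
  case 0
  then show ?case by (simp add: gsum_def B_def C_refl)
next
  case (Suc s)
  have s: "s < m" "s \<le> m" using Suc.prems by auto
  let ?I = "{i. i < n \<and> pos i < Suc s}"
  have "gev z (Suc s) j y = Hop s (\<lambda>y. gsum z s ?I j y) y"
    using \<phi>1_gev[OF s(2) _ Suc.IH[OF s(2) Suc.prems(2)]] s Suc.prems
    by (simp, intro Hop_cong) auto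
  also have "\<dots> = B s * (C j 0 s * Hop s (H s j) y
     - (\<Sum>i\<in>?I. z i * Y z j i * (\<Sum>k<D. \<psi> i k * (C k (pos i) s * Hop s (H s k) y))))"
    unfolding gsum_def by (simp add: Hop_linear[OF s(1)] mult.assoc)
  also have "C j 0 s * Hop s (H s j) y = \<beta> s * (C j 0 (Suc s) * H (Suc s) j y)"
    by (rule Hop_H') (use s Suc.prems N_le_dv[of 0] in auto)
  also have "(\<Sum>i\<in>?I. z i * Y z j i * (\<Sum>k<D. \<psi> i k * (C k (pos i) s * Hop s (H s k) y)))
    = (\<Sum>i\<in>?I. z i * Y z j i * (\<Sum>k<D. \<psi> i k * (\<beta> s * (C k (pos i) (Suc s) * H (Suc s) k y))))"
  proof (rule sum.cong[OF refl])
    fix i assume i: "i \<in> ?I"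
    \<comment> \<open>\<open>Hop_H'\<close> asks for k to be an index at \<open>pos i\<close>;
      otherwise \<open>\<psi> i k\<close> is 0.\<close>
    have "\<psi> i k * (C k (pos i) s * Hop s (H s k) y) = \<psi> i k * (\<beta> s * (C k (pos i) (Suc s) * H (Suc s) k y))" for k
    proof (cases "k < dv (pos i)")
      case True
      then show ?thesis using Hop_H'[of "pos i" s k y] i s Suc.prems by simp
    qed (use i \<psi>_eq_0[of i k] in auto)
    then show "z i * Y z j i * (\<Sum>k<D. \<psi> i k * (C k (pos i) s * Hop s (H s k) y))
        = z i * Y z j i * (\<Sum>k<D. \<psi> i k * (\<beta> s * (C k (pos i) (Suc s) * H (Suc s) k y)))"
      by (simp only:)
  qed
  also have "B s * (\<beta> s * (C j 0 (Suc s) * H (Suc s) j y)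
      - (\<Sum>i\<in>?I. z i * Y z j i * (\<Sum>k<D. \<psi> i k * (\<beta> s * (C k (pos i) (Suc s) * H (Suc s) k y)))))
    = gsum z (Suc s) ?I j y"
    by (simp add: gsum_def B_def algebra_simps sum_distrib_left)
  finally show ?case .
qed

text \<open>At \<open>\<theta> m\<close> = 0 only N indices survive, so the N functions are
  combinations of N Hahn functions and their determinant factors.\<close>

lemma \<phi>1_gev_m:
  assumes j: "j < N" and y: "y \<in> pv m"
  shows "\<phi>1 z m y * gev z m j y = (\<Sum>k<N. H m k y *
    (B m * ((if j = k then C j 0 m else 0) - (\<Sum>i<n. Y z j i * (z i * \<psi> i k * C k (pos i) m)))))"
proof -
  have "dv m = N"
    using Sv[of m] by (simp add: dv_def num_pts_def \<theta>_m)
  then have "(\<Sum>k<D. \<psi> i k * C k (pos i) m * H m k y) = (\<Sum>k<N. \<psi> i k * C k (pos i) m * H m k y)" for i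
    by (intro sum.mono_neutral_right) (auto intro!: H_eq_0)
  moreover have "{i. i < n \<and> pos i < Suc m} = {..<n}"
    using pos_le_m by (auto simp: less_Suc_eq_le)
  ultimately have "\<phi>1 z m y * gev z m j y = B m * (C j 0 m * H m j y
     - (\<Sum>i<n. z i * Y z j i * (\<Sum>k<N. \<psi> i k * C k (pos i) m * H m k y)))"
    using \<phi>1_gev[OF order_refl y gev_eq[OF order_refl j]] by (simp add: gsum_def)
  also have "(\<Sum>i<n. z i * Y z j i * (\<Sum>k<N. \<psi> i k * C k (pos i) m * H m k y))
      = (\<Sum>k<N. H m k y * (\<Sum>i<n. Y z j i * (z i * \<psi> i k * C k (pos i) m)))"
    by (simp add: sum_distrib_left mult_ac) (rule sum.swap)
  also have "C j 0 m * H m j y = (\<Sum>k<N. H m k y * (if j = k then C j 0 m else 0))"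
    using j by (simp add: if_distrib cong: if_cong)
  finally show ?thesis
    by (simp add: sum_distrib_left sum_subtractf[symmetric] algebra_simps)
qed

text \<open>The propagator between two points over all indices, those below N included; this makes
  it vanish for distinct points at one vertex.\<close>

definition W :: "nat \<Rightarrow> nat \<Rightarrow> real" where
  "W i' i = (\<Sum>k<D. \<psi> i' k * C k (pos i') (pos i) * \<psi> i k)"

lemma W_same_pos:
  assumes "i < n" "i' < n" "pos i = pos i'" "i \<noteq> i'"
  shows "W i' i = 0"
proof -
  have "x i \<noteq> x i'" using same_pos_eq assms by blast
  moreover have "W i' i = (\<Sum>k<D. \<psi> i' k * H (pos i') k (x i)) * sqrt (wpt i)"
    using assms by (simp add: W_def C_refl \<psi>_eq[of i] sum_distrib_right mult.assoc)
  ultimately show ?thesis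
    using \<psi>_complete[of i' "x i"] x_pv[of i] assms by simp
qed

text \<open>Evaluated at the points, the Duhamel formula is a unitriangular system for
  \<open>Y\<close>. Earlier points at the same vertex may be included because their \<open>W\<close>
  is 0.\<close>

lemma Y_rec:
  assumes "j < N" "i < n"
  shows "C j 0 (pos i) * \<psi> i j = Y z j i + (\<Sum>i'<i. Y z j i' * (z i' * W i' i))"
proof -
  have sum_eq: "(\<Sum>i' | i' < n \<and> pos i' < pos i. z i' * Y z j i' * W i' i) = (\<Sum>i'<i. z i' * Y z j i' * W i' i)"
  proof (rule sum.mono_neutral_left)
    show "{i'. i' < n \<and> pos i' < pos i} \<subseteq> {..<i}"
      using pos_mono[of i] assms by (force simp: not_less[symmetric])
    show "\<forall>i'\<in>{..<i} - {i'. i' < n \<and> pos i' < pos i}. z i' * Y z j i' * W i' i = 0"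
    proof
      fix i' assume i': "i' \<in> {..<i} - {i'. i' < n \<and> pos i' < pos i}"
      then have "pos i' = pos i" using pos_mono[of i' i] assms by auto
      then show "z i' * Y z j i' * W i' i = 0"
        using W_same_pos[of i i'] i' assms by auto
    qed
  qed simp
  have "gev z (pos i) j (x i) = B (pos i) * (C j 0 (pos i) * H (pos i) j (x i)
     - (\<Sum>i' | i' < n \<and> pos i' < pos i. z i' * Y z j i' *
          (\<Sum>k<D. \<psi> i' k * C k (pos i') (pos i) * H (pos i) k (x i))))"
    using gev_eq[OF pos_le_m[OF assms(2)] assms(1) x_pv[OF assms(2)]] by (simp add: gsum_def)
  then have "Y z j i = (C j 0 (pos i) * H (pos i) j (x i)
     - (\<Sum>i' | i' < n \<and> pos i' < pos i. z i' * Y z j i' *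
          (\<Sum>k<D. \<psi> i' k * C k (pos i') (pos i) * H (pos i) k (x i)))) * sqrt (wpt i)"
    using B_pos[OF pos_le_m[OF assms(2)]] by (simp add: Y_def)
  also have "\<dots> = C j 0 (pos i) * \<psi> i j - (\<Sum>i' | i' < n \<and> pos i' < pos i. z i' * Y z j i' * W i' i)"
    unfolding W_def \<psi>_eq[OF assms(2)] left_diff_distrib sum_distrib_right
    by (simp add: sum_distrib_left mult_ac)
  finally show ?thesis
    unfolding sum_eq by (simp add: mult_ac)
qed

text \<open>Below N every eigenvalue on the walk is positive. This justifies the divisions by c in
  the kernel and in the Schur complement.\<close>

lemma C_pos:
  assumes "k < N" "s \<le> s'" "s' \<le> m"
  shows "C k s s' > 0"
  using assms(2,3)
proof (induction s' rule: dec_induct)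
  case base
  then show ?case by (simp add: C_refl)
next
  case (step u)
  have u: "u < m" using step by simp
  have lam: "lam N T b k > 0" if "0 \<le> b" "b < int T" for b
    using that assms(1) by (auto simp: lam_def lam_up_def lam_dn_def)
  have "(if down u then lam N T (int (\<theta> (Suc u))) k
     else if \<epsilon> (Suc (\<rho> u)) = 1 then lam N T (Sv u) k else lam N T (Sv u - 1) k) > 0"
    using u
  proof (cases rule: step_cases)
    case minus
    then show ?thesis using Sv(1)[of "Suc u"] by (simp add: lam)
  qed (use Sv(1)[of u] in \<open>simp_all add: lam\<close>)
  then have "\<beta> u * C k u (Suc u) > 0"
    unfolding lam_C(2)[OF u] .
  then have "C k u (Suc u) > 0"
    using lam_C(1)[OF u] by (simp add: zero_less_mult_iff)
  then show ?case
    using C_mult[of s u "Suc u" k] step by (metis Suc_leD le_SucI less_imp_le lessI mult_pos_pos)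
qed

section \<open>Identification of the kernel\<close>

definition K :: "nat \<Rightarrow> nat \<Rightarrow> real" where
  "K i j = kernel N T S0 \<epsilon> (r i, t i, x i) (r j, t j, x j)"

lemma K_ge:
  assumes "i < n" "j < n" "r j \<le> r i" "t i \<le> t j"
  shows "K i j = (\<Sum>k<N. 1 / C k (pos j) (pos i) * \<psi> i k * \<psi> j k)"
  using assms by (simp add: K_def kernel_def C_def \<psi>_def \<rho>_pos \<theta>_pos)

text \<open>The sum over k >= N is the full propagator minus its part below N. At a common vertex
  the kernel uses its first case, which agrees because \<open>W\<close> is 0.\<close>

lemma K_less:
  assumes ij: "i < j" "j < n"
  shows "K i j = (\<Sum>k<N. C k (pos i) (pos j) * \<psi> i k * \<psi> j k) - W i j"
proof (cases "pos i = pos j")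
  case True
  then have "r i = r j" "t i = t j"
    using \<rho>_pos[of i] \<rho>_pos[of j] \<theta>_pos[of i] \<theta>_pos[of j] ij by auto
  then show ?thesis
    using K_ge[of i j] W_same_pos[of j i] True ij by (simp add: C_refl)
next
  case False
  have le: "r i \<le> r j" "t j \<le> t i" using r_mono[of i j] t_anti[of i j] ij by auto
  moreover have "\<not> (r i = r j \<and> t i = t j)" using False by (auto simp: pos_def)
  ultimately have 1: "\<not> (r j \<le> r i \<and> t i \<le> t j)" and 2: "r i < r j \<or> r i = r j \<and> t j < t i" by auto
  have "K i j = - (\<Sum>\<^sub>\<infinity>k\<in>{N..}. C k (pos i) (pos j) * \<psi> i k * \<psi> j k)"
    unfolding K_def kernel_def case_prod_conv if_not_P[OF 1] if_P[OF 2] C_def \<psi>_def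
    using ij by (simp add: \<rho>_pos \<theta>_pos)
  also have "(\<Sum>\<^sub>\<infinity>k\<in>{N..}. C k (pos i) (pos j) * \<psi> i k * \<psi> j k)
      = (\<Sum>\<^sub>\<infinity>k\<in>{N..<D}. C k (pos i) (pos j) * \<psi> i k * \<psi> j k)"
    using \<psi>_eq_0[of i] dv_le[of "pos i"] ij by (intro infsum_cong_neutral) auto
  also have "\<dots> = (\<Sum>k\<in>{N..<D}. C k (pos i) (pos j) * \<psi> i k * \<psi> j k)"
    by (rule infsum_finite) simp
  also have "\<dots> = W i j - (\<Sum>k<N. C k (pos i) (pos j) * \<psi> i k * \<psi> j k)"
  proof -
    have "sum f {..<D} = sum f {..<N} + sum f {N..<D}" for f :: "nat \<Rightarrow> real"
      using sum.atLeastLessThan_concat[of 0 N D f] by (simp add: lessThan_atLeast0)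
    then have "W i j = (\<Sum>k<N. \<psi> i k * C k (pos i) (pos j) * \<psi> j k)
        + (\<Sum>k\<in>{N..<D}. \<psi> i k * C k (pos i) (pos j) * \<psi> j k)"
      unfolding W_def .
    then show ?thesis by (simp add: mult_ac)
  qed
  finally show ?thesis by simp
qed

text \<open>\<open>detf_schur\<close> with the unitriangular matrix of \<open>Y_rec\<close> as G. By
  multiplicativity the coefficients combine to \<open>C k (pos i) (pos j)\<close> above the
  diagonal, where G supplies the \<open>W\<close> of \<open>K_less\<close>, and to the inverse of
  \<open>C k (pos j) (pos i)\<close> elsewhere.\<close>

lemma detf_gev:
  "detf N (\<lambda>j k. (if j = k then C j 0 m else 0) - (\<Sum>i<n. Y z j i * (z i * \<psi> i k * C k (pos i) m)))
    = (\<Prod>k<N. C k 0 m) * detf n (\<lambda>i j. (if i = j then 1 else 0) - z i * K i j)"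
proof -
  define G where "G i j = (if i = j then 1 else if i < j then z i * W i j else 0)" for i j
  have "detf N (\<lambda>j k. (if j = k then C j 0 m else 0) - (\<Sum>i<n. Y z j i * (z i * \<psi> i k * C k (pos i) m)))
    = (\<Prod>k<N. C k 0 m) * detf n (\<lambda>i j. G i j -
        (\<Sum>k<N. z i * \<psi> i k * C k (pos i) m * (C k 0 (pos j) * \<psi> j k) / C k 0 m))"
  proof (rule detf_schur)
    show "C k 0 m \<noteq> 0" if "k < N" for k
      using C_pos[OF that, of 0 m] by simp
    show "C k 0 (pos j) * \<psi> j k = (\<Sum>i<n. Y z k i * G i j)" if "k < N" "j < n" for k j
    proof -
      have "(\<Sum>i<n. Y z k i * G i j) = (\<Sum>i<Suc j. Y z k i * G i j)"
        using that by (intro sum.mono_neutral_right) (auto simp: G_def)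
      also have "\<dots> = Y z k j + (\<Sum>i<j. Y z k i * (z i * W i j))"
        by (simp add: G_def)
      finally show ?thesis using Y_rec[OF that] by simp
    qed
  qed (auto simp: G_def)
  also have "detf n (\<lambda>i j. G i j -
        (\<Sum>k<N. z i * \<psi> i k * C k (pos i) m * (C k 0 (pos j) * \<psi> j k) / C k 0 m))
    = detf n (\<lambda>i j. (if i = j then 1 else 0) - z i * K i j)"
  proof (rule detf_cong)
    fix i j assume ij: "i < n" "j < n"
    show "G i j - (\<Sum>k<N. z i * \<psi> i k * C k (pos i) m * (C k 0 (pos j) * \<psi> j k) / C k 0 m)
        = (if i = j then 1 else 0) - z i * K i j"
    proof (cases "i < j")
      case True
      have eq: "z i * \<psi> i k * C k (pos i) m * (C k 0 (pos j) * \<psi> j k) / C k 0 m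
          = z i * (C k (pos i) (pos j) * \<psi> i k * \<psi> j k)" if k: "k < N" for k
      proof -
        have "C k 0 (pos j) = C k 0 (pos i) * C k (pos i) (pos j)" "C k 0 m = C k 0 (pos i) * C k (pos i) m"
          using C_mult pos_mono[of i j] pos_le_m ij True by auto
        moreover have "C k 0 (pos i) \<noteq> 0" "C k (pos i) m \<noteq> 0"
          using C_pos[OF k] pos_le_m[OF ij(1)] by (metis less_irrefl le0 order_refl)+
        ultimately show ?thesis by simp
      qed
      have "(\<Sum>k<N. z i * \<psi> i k * C k (pos i) m * (C k 0 (pos j) * \<psi> j k) / C k 0 m)
          = z i * (K i j + W i j)"
        unfolding K_less[OF True ij(2)] diff_add_cancel sum_distrib_left
        by (rule sum.cong[OF refl], rule eq) simp
      then show ?thesis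
        using True by (simp add: G_def algebra_simps)
    next
      case False
      then have le: "j \<le> i" by simp
      have eq: "z i * \<psi> i k * C k (pos i) m * (C k 0 (pos j) * \<psi> j k) / C k 0 m
          = z i * (1 / C k (pos j) (pos i) * \<psi> i k * \<psi> j k)" if k: "k < N" for k
      proof -
        have "C k 0 m = C k 0 (pos j) * (C k (pos j) (pos i) * C k (pos i) m)"
          using C_mult pos_mono[OF le ij(1)] pos_le_m ij by auto
        moreover have "C k 0 (pos j) \<noteq> 0" "C k (pos i) m \<noteq> 0" "C k (pos j) (pos i) \<noteq> 0"
          using C_pos[OF k] pos_le_m[OF ij(1)] pos_le_m[OF ij(2)] pos_mono[OF le ij(1)]
          by (metis less_irrefl le0 order_refl)+
        ultimately show ?thesis by simp
      qed
      have "(\<Sum>k<N. z i * \<psi> i k * C k (pos i) m * (C k 0 (pos j) * \<psi> j k) / C k 0 m) = z i * K i j"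
        unfolding K_ge[OF ij r_mono[OF le ij(1)] t_anti[OF le ij(1)]] sum_distrib_left
        by (rule sum.cong[OF refl], rule eq) simp
      then show ?thesis
        using False by (simp add: G_def)
    qed
  qed
  finally show ?thesis .
qed

section \<open>From the walk to the correlation functions\<close>

abbreviation a0 :: "int list" where "a0 \<equiv> [0..int N - 1]"

primrec hm :: "(nat \<Rightarrow> real) \<Rightarrow> nat \<Rightarrow> int list \<Rightarrow> real" where
  "hm z 0 = (\<lambda>_. 1)"
| "hm z (Suc s) = (\<lambda>X. \<Sum>y\<in>tup N (pv s). Mat s X y * (\<phi> z s y * hm z s y))"

lemma slater_\<phi>: "slater N (\<lambda>j y. \<phi>1 z s y * gev z s j y) X = \<phi> z s X * slater N (gev z s) X"
  unfolding \<phi>_def by (rule slater_scale_arg)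

text \<open>The start holds as the Slater determinant of Hahn polynomials is a multiple of the
  Vandermonde, and each matrix contributes only \<open>1 / \<kappa>\<close>. The quantifier order
  matters: c serves all z, so z = 0 can determine it later.\<close>

lemma hm_eq_slater:
  assumes "s \<le> m"
  shows "\<exists>c. \<forall>z. \<forall>X\<in>tup N (pv s). hm z s X = c * (slater N (gev z s) X / vandermonde N X)"
  using assms
proof (induction s)
  case 0
  let ?q = "hahn_poly N T (Sv 0) (int (\<theta> 0))"
  interpret orthonormal_polys "pv 0" "wt N T (Sv 0) (int (\<theta> 0))" ?q
    unfolding pv_def by (rule orthonormal_hahn)
  have card: "card (pv 0) = dv 0"
    unfolding pv_def dv_def by (rule card_pts) (use Sv \<theta> in auto)
  have kN: "k < card (pv 0)" if "k < N" for k
    using that N_le_dv[of 0] by (simp add: card)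
  define l where "l = (\<Prod>k<N. coeff (?q k) k)"
  have "l > 0" unfolding l_def using kN by (intro prod_pos) (auto intro: lead_P)
  have "slater N (gev z 0) X = l * vandermonde N X" if "X \<in> tup N (pv 0)" for z X
  proof -
    have "slater N (gev z 0) X = slater N (\<lambda>k y. poly (?q k) (of_int y)) X"
      by (rule slater_cong[OF that]) (use kN card in \<open>auto simp: H_def hahn_val_def dv_def\<close>)
    also have "\<dots> = l * vandermonde N X"
      unfolding l_def by (rule slater_poly) (use kN degree_P in auto)
    finally show ?thesis .
  qed
  then have "\<forall>z. \<forall>X\<in>tup N (pv 0). hm z 0 X = 1 / l * (slater N (gev z 0) X / vandermonde N X)"
    using \<open>l > 0\<close> vandermonde_pos by fastforce
  then show ?case by blast
next
  case (Suc s)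
  have s: "s < m" using Suc.prems by simp
  obtain c where c: "\<And>z X. X \<in> tup N (pv s) \<Longrightarrow> hm z s X = c * (slater N (gev z s) X / vandermonde N X)"
    using Suc.IH s by auto
  obtain \<sigma> u b \<kappa> where hop: "Hop s = hop \<sigma> u b" "Mat s = jump N \<sigma> u b \<kappa>" "\<sigma> \<in> {1, - 1}"
    and bd: "\<And>a. a \<in> pv (Suc s) \<Longrightarrow> a + \<sigma> \<in> pv s \<or> u a = 0" "\<And>a. a \<in> pv (Suc s) \<Longrightarrow> a \<in> pv s \<or> b a = 0"
    using Mat_Hop[OF s] by metis
  have "hm z (Suc s) X = c / \<kappa> * (slater N (gev z (Suc s)) X / vandermonde N X)"
    if X: "X \<in> tup N (pv (Suc s))" for z X
  proof -
    have "hm z (Suc s) X = (\<Sum>y\<in>tup N (pv s). c * (Mat s X y *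
        (slater N (\<lambda>j y. \<phi>1 z s y * gev z s j y) y / vandermonde N y)))"
      by (simp add: c slater_\<phi> mult_ac)
    also have "\<dots> = c * (slater N (gev z (Suc s)) X / (\<kappa> * vandermonde N X))"
      unfolding sum_distrib_left[symmetric] hop(2)
      by (subst sum_jump_slater[OF X hop(3) _ bd]) (simp_all add: hop(1) pv_def finite_pts)
    finally show ?thesis by simp
  qed
  then show ?case by blast
qed

lemma a0_pv: "tup N (pv m) = {a0}"
  using tuples_0[OF Sv[of m], of N] by (simp add: tuples_eq_tup points_eq_pts pv_def \<theta>_m)

lemma hm_final: "\<exists>c. \<forall>z. hm z m a0 * \<phi> z m a0 = c * detf n (\<lambda>i j. (if i = j then 1 else 0) - z i * K i j)"
proof -
  obtain c where c: "\<And>z. hm z m a0 = c * (slater N (gev z m) a0 / vandermonde N a0)"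
    using hm_eq_slater[OF order_refl] a0_pv by auto
  have a0: "a0 \<in> tup N (pv m)" using a0_pv by simp
  define a where "a z j k = (if j = k then C j 0 m else 0) - (\<Sum>i<n. Y z j i * (z i * \<psi> i k * C k (pos i) m))"
    for z j k
  have "slater N (\<lambda>j y. \<phi>1 z m y * gev z m j y) a0
      = detf N (\<lambda>i k. H m k (a0 ! i)) * (B m ^ N * ((\<Prod>k<N. C k 0 m) *
          detf n (\<lambda>i j. (if i = j then 1 else 0) - z i * K i j)))" for z
  proof -
    have "slater N (\<lambda>j y. \<phi>1 z m y * gev z m j y) a0
        = detf N (\<lambda>i j. \<Sum>k<N. H m k (a0 ! i) * (B m * a z j k))"
      unfolding slater_def a_def
      by (rule detf_cong, rule \<phi>1_gev_m) (use tup_nth_mem[OF a0] in auto)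
    also have "\<dots> = detf N (\<lambda>i k. H m k (a0 ! i)) * detf N (\<lambda>k j. B m * a z j k)"
      by (rule detf_mult)
    also have "detf N (\<lambda>k j. B m * a z j k) = B m ^ N * detf N (\<lambda>k j. a z j k)"
      by (rule detf_scale)
    also have "detf N (\<lambda>k j. a z j k) = detf N (a z)"
      by (rule detf_transpose)
    also have "detf N (a z) = (\<Prod>k<N. C k 0 m) * detf n (\<lambda>i j. (if i = j then 1 else 0) - z i * K i j)"
      using detf_gev[of z] unfolding a_def .
    finally show ?thesis .
  qed
  then have "hm z m a0 * \<phi> z m a0 = c / vandermonde N a0 * detf N (\<lambda>i k. H m k (a0 ! i)) * B m ^ N *
      (\<Prod>k<N. C k 0 m) * detf n (\<lambda>i j. (if i = j then 1 else 0) - z i * K i j)" for z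
    unfolding slater_\<phi> c by (simp add: mult_ac divide_simps)
  then show ?thesis by blast
qed

definition hist_wgt :: "int list list list \<Rightarrow> real" where
  "hist_wgt G = pmf (pmf_of_set (\<Omega> N T S0)) (G ! 0) * wgt (\<lambda>r. step N T (S r) (\<epsilon> (r + 1))) R G"

definition hit :: "int list list list \<Rightarrow> nat \<Rightarrow> real" where
  "hit G i = (if x i \<in> set (G ! r i ! t i) then 1 else 0)"

lemma sum_hist_wgt:
  "(\<Sum>G\<in>trajs (\<lambda>r. \<Omega> N T (S r)) R. hist_wgt G * (\<Prod>i<n. 1 - z i * hit G i)) = hm z m a0 * \<phi> z m a0"
proof -
  let ?A = "\<lambda>r. tuples N T (S r)" and ?Om = "\<lambda>r. \<Omega> N T (S r)"
  have Ab: "0 \<le> S k + \<epsilon> (Suc k) \<and> S k + \<epsilon> (Suc k) \<le> int T" if "k < R" for k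
    using S_bounds[of "Suc k"] that by (simp add: S_Suc)
  interpret CH: intertwined_chain T R ?A "\<lambda>r. P_t_plus N T (S r)"
    "\<lambda>r. P_S (- \<epsilon> (Suc r)) N T (S (Suc r))" "\<lambda>_. a0" ?Om "pmf (pmf_of_set (\<Omega> N T S0))"
    "\<lambda>r. step N T (S r) (\<epsilon> (r + 1))" \<rho> \<theta> m "\<phi> z"
  proof (rule intertwined_chain.intro)
    show "intertwining T (?A k) (?A (Suc k)) (P_t_plus N T (S k)) (P_t_plus N T (S (Suc k)))
        (P_S (- \<epsilon> (Suc k)) N T (S (Suc k))) a0 a0" if "k < R" for k
      unfolding S_Suc by (rule intertwining_tuples) (use S_bounds[of k] Ab[OF that] \<epsilon>[OF that] that in auto)
    show "X \<in> ?Om k \<longleftrightarrow> X \<in> trajs (?A k) T \<and> wgt (P_t_plus N T (S k)) T X \<noteq> 0" if "k \<le> R" for k X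
      using mem_\<Omega>_iff[of "S k" T X N] S_bounds[OF that] by simp
    show "pmf (pmf_of_set (\<Omega> N T S0)) X = wgt (P_t_plus N T (S 0)) T X" if "X \<in> ?Om 0" for X
      using pmf_\<Omega>[of "S 0" T X N] S_bounds[of 0] that by (simp add: S_0)
    show "step N T (S k) (\<epsilon> (k + 1)) X Y
        = intertwining.upd (?A (Suc k)) (P_t_plus N T (S (Suc k))) (P_S (- \<epsilon> (Suc k)) N T (S (Suc k))) T X Y"
      if "k < R" "X \<in> ?Om k" "Y \<in> ?Om (Suc k)" for k X Y
      using step_eq_upd[of "S k" T "\<epsilon> (Suc k)" X N Y] S_bounds[of k] S_bounds[of "Suc k"] \<epsilon>[of k] that
      by (simp add: mem_\<Omega>_iff S_Suc)
    show "\<rho> 0 = 0" "\<theta> 0 = T" "\<rho> m \<le> R"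
      by (rule \<rho>_0, rule \<theta>_0, rule \<rho>_le_R)
    show "\<rho> (Suc s) = Suc (\<rho> s) \<and> \<theta> (Suc s) = \<theta> s \<or> \<rho> (Suc s) = \<rho> s \<and> \<theta> s = Suc (\<theta> (Suc s))"
      if "s < m" for s by (rule walk[OF that])
  qed (rule finite_tuples)
  have harm: "CH.harm s X = hm z s X" if "s \<le> m" for s X
    using that
  proof (induction s arbitrary: X)
    case (Suc s)
    have tp: "tuples N T (Sv s) (\<theta> s) = tup N (pv s)"
      by (simp add: tuples_eq_tup points_eq_pts pv_def)
    have "CH.harm s = hm z s" using Suc by auto
    then show ?case
      unfolding CH.harm.simps hm.simps tp Mat_def
      using Suc.prems not_downD[of s] by (auto simp: down_def)
  qed simp
  have "(\<Prod>i<n. 1 - z i * hit G i) = (\<Prod>u<Suc m. \<phi> z u (G ! \<rho> u ! \<theta> u))"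
    if G: "G \<in> trajs ?Om R" for G
  proof -
    have "\<phi> z u (G ! \<rho> u ! \<theta> u) = (\<Prod>i | i < n \<and> pos i = u. 1 - z i * hit G i)" if "u < Suc m" for u
    proof -
      have "G ! \<rho> u \<in> \<Omega> N T (Sv u)" using trajs_nth[OF G \<rho>_le_R] .
      then have "length (G ! \<rho> u ! \<theta> u) = N" "sorted_wrt (<) (G ! \<rho> u ! \<theta> u)"
        using \<theta>_le[of u] by (auto simp: \<Omega>_def)
      then have X: "length (G ! \<rho> u ! \<theta> u) = N" "distinct (G ! \<rho> u ! \<theta> u)"
        by (auto simp: strict_sorted_iff)
      have "\<phi> z u (G ! \<rho> u ! \<theta> u) = (\<Prod>i | i < n \<and> pos i = u. \<Prod>a<N. 1 - z i *
          (if G ! \<rho> u ! \<theta> u ! a = x i then 1 else 0))"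
        unfolding \<phi>_def \<phi>1_def by (rule prod.swap)
      also have "\<dots> = (\<Prod>i | i < n \<and> pos i = u. 1 - z i * hit G i)"
      proof (intro prod.cong refl)
        fix i assume "i \<in> {i. i < n \<and> pos i = u}"
        then have i: "i < n" "\<rho> u = r i" "\<theta> u = t i" using \<rho>_pos \<theta>_pos by auto
        let ?X = "G ! r i ! t i"
        \<comment> \<open>The entries are distinct, so \<open>x i\<close> is met at most
          once.\<close>
        have "(\<Prod>a<N. 1 - z i * (if ?X ! a = x i then 1 else 0)) = (\<Prod>y\<in>set ?X. 1 - z i * (if y = x i then 1 else 0))"
        proof -
          have "bij_betw ((!) ?X) {..<N} (set ?X)"
            using X unfolding i by (metis bij_betw_nth)
          from prod.reindex_bij_betw[OF this, of "\<lambda>y. 1 - z i * (if y = x i then 1 else 0)"]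
          show ?thesis .
        qed
        also have "\<dots> = 1 - z i * hit G i"
        proof (cases "x i \<in> set ?X")
          case True
          then show ?thesis
            by (subst prod.remove[of _ "x i"]) (auto simp: hit_def intro!: prod.neutral)
        next
          case False
          then show ?thesis by (auto simp: hit_def intro!: prod.neutral)
        qed
        finally show "(\<Prod>a<N. 1 - z i * (if G ! \<rho> u ! \<theta> u ! a = x i then 1 else 0)) = 1 - z i * hit G i"
          unfolding i .
      qed
      finally show ?thesis .
    qed
    then have "(\<Prod>u<Suc m. \<phi> z u (G ! \<rho> u ! \<theta> u))
        = (\<Prod>u<Suc m. \<Prod>i\<in>{i\<in>{..<n}. pos i = u}. 1 - z i * hit G i)"
      by (intro prod.cong refl) auto
    also have "\<dots> = (\<Prod>i<n. 1 - z i * hit G i)"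
      by (rule prod.group) (use pos_le_m in \<open>auto simp: less_Suc_eq_le\<close>)
    finally show ?thesis by simp
  qed
  \<comment> \<open>\<open>sum_walk\<close> covers the vertices before m; the factor at m enters as
    its function f.\<close>
  then have "(\<Sum>G\<in>trajs ?Om R. hist_wgt G * (\<Prod>i<n. 1 - z i * hit G i))
    = (\<Sum>G\<in>trajs ?Om (\<rho> m). pmf (pmf_of_set (\<Omega> N T S0)) (G ! 0)
        * wgt (\<lambda>r. step N T (S r) (\<epsilon> (r + 1))) (\<rho> m) G
        * (\<Prod>u<m. \<phi> z u (G ! \<rho> u ! \<theta> u)) * (\<lambda>X. \<phi> z m (X ! 0)) (take (Suc (\<theta> m)) (G ! \<rho> m)))"
    unfolding \<rho>_m hist_wgt_def by (intro sum.cong refl) (simp add: \<theta>_m \<rho>_m)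
  also have "\<dots> = (\<Sum>X\<in>trajs (?A (\<rho> m)) (\<theta> m). wgt (P_t_plus N T (S (\<rho> m))) (\<theta> m) X
      * CH.harm m (X ! \<theta> m) * (\<lambda>X. \<phi> z m (X ! 0)) X)"
    by (rule CH.sum_walk) simp
  also have "\<dots> = hm z m a0 * \<phi> z m a0"
    using tuples_0[OF Sv[of m], of N] by (simp add: \<theta>_m sum_trajs_0 wgt_def harm)
  finally show ?thesis .
qed

lemma sum_hist_wgt_det:
  assumes total: "(\<Sum>G\<in>trajs (\<lambda>r. \<Omega> N T (S r)) R. hist_wgt G) = 1"
  shows "(\<Sum>G\<in>trajs (\<lambda>r. \<Omega> N T (S r)) R. hist_wgt G * (\<Prod>i<n. hit G i)) = detf n K"
proof -
  obtain c where c: "\<And>z. hm z m a0 * \<phi> z m a0 = c * detf n (\<lambda>i j. (if i = j then 1 else 0) - z i * K i j)"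
    using hm_final by blast
  \<comment> \<open>At z = 0 the left side is the total mass and the determinant is that of the
    identity.\<close>
  have "hm (\<lambda>_. 0) m a0 * \<phi> (\<lambda>_. 0) m a0 = 1"
    using sum_hist_wgt[of "\<lambda>_. 0"] total by simp
  then have "c = 1"
    using c[of "\<lambda>_. 0"] detf_diagonal[of n "\<lambda>_. 1 :: real"] by simp
  have E: "(\<Sum>G\<in>trajs (\<lambda>r. \<Omega> N T (S r)) R. hist_wgt G * (\<Prod>i<n. 1 - z i * hit G i))
      = detf n (\<lambda>i j. (if i = j then 1 else 0) - z i * K i j)" for z
    unfolding sum_hist_wgt c \<open>c = 1\<close> by simp
  have "(\<Prod>i<n. hit G i) = (\<Sum>A\<in>Pow {0..<n}. (-1) ^ card A *
      (\<Prod>i<n. 1 - (if i \<in> A then 1 else 0) * hit G i))" for G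
  proof -
    \<comment> \<open>As a diagonal determinant, the product of indicators obeys the same
      inclusion-exclusion as \<open>K\<close>, so the two expansions match term by term.\<close>
    have "(\<Prod>i<n. hit G i) = detf n (\<lambda>i j. if i = j then hit G i else 0)"
      by (rule detf_diagonal[symmetric])
    also have "\<dots> = (\<Sum>A\<in>Pow {0..<n}. (-1) ^ card A * detf n (\<lambda>i j. (if i = j then 1 else 0)
        - (if i \<in> A then 1 else 0) * (if i = j then hit G i else 0)))"
      by (rule detf_inclusion_exclusion[symmetric])
    also have "\<dots> = (\<Sum>A\<in>Pow {0..<n}. (-1) ^ card A *
        (\<Prod>i<n. 1 - (if i \<in> A then 1 else 0) * hit G i))"
      unfolding detf_diagonal[symmetric]
      by (intro sum.cong refl arg_cong2[where f = times] detf_cong) auto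
    finally show ?thesis .
  qed
  then have "(\<Sum>G\<in>trajs (\<lambda>r. \<Omega> N T (S r)) R. hist_wgt G * (\<Prod>i<n. hit G i))
    = (\<Sum>A\<in>Pow {0..<n}. (-1) ^ card A * (\<Sum>G\<in>trajs (\<lambda>r. \<Omega> N T (S r)) R.
        hist_wgt G * (\<Prod>i<n. 1 - (if i \<in> A then 1 else 0) * hit G i)))"
    by (simp add: sum_distrib_left mult_ac) (subst sum.swap, simp)
  also have "\<dots> = detf n K"
    unfolding E by (rule detf_inclusion_exclusion)
  finally show ?thesis .
qed

end

theorem theorem5p1:
  fixes N T n :: nat and S0 :: int
    and \<epsilon> :: "nat \<Rightarrow> int" and L :: enat
    and Pr :: "'w measure" and M :: "nat \<Rightarrow> 'w \<Rightarrow> int list list"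
    and r t :: "nat \<Rightarrow> nat" and x :: "nat \<Rightarrow> int"
  assumes "N \<ge> 1" and "T \<ge> 1" and "0 \<le> S0" and "S0 \<le> int T"
    and "\<And>i. 1 \<le> i \<Longrightarrow> enat i \<le> L \<Longrightarrow> \<epsilon> i \<in> {1, -1}"
    and "\<And>m. enat m \<le> L \<Longrightarrow> 0 \<le> S_at S0 \<epsilon> m \<and> S_at S0 \<epsilon> m \<le> int T"
    and "path_chain Pr N T S0 \<epsilon> L M"
    and "inj_on (\<lambda>i. (r i, t i, x i)) {..<n}"
    and "\<And>i j. i \<le> j \<Longrightarrow> j < n \<Longrightarrow> r i \<le> r j"
    and "\<And>i j. i \<le> j \<Longrightarrow> j < n \<Longrightarrow> t i \<ge> t j"
    and "\<And>i. i < n \<Longrightarrow> enat (r i) \<le> L"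
    and "\<And>i. i < n \<Longrightarrow> t i \<le> T"
    and "\<And>i. i < n \<Longrightarrow> x i \<in> points N T (S_at S0 \<epsilon> (r i)) (t i)"
  shows "correlation Pr (configuration T L M) n (\<lambda>i. (r i, t i, x i))
    = Determinant.det (Matrix.mat n n (\<lambda>(i, j).
        kernel N T S0 \<epsilon> (r i, t i, x i) (r j, t j, x j)))"
proof -
  \<comment> \<open>Inserting 0 keeps the maximum meaningful for n = 0.\<close>
  define R where "R = Max (insert 0 (r ` {..<n}))"
  have "R \<in> insert 0 (r ` {..<n})"
    unfolding R_def by (rule Max_in) auto
  then have "enat R \<le> L"
    using assms(11) by (auto simp: zero_enat_def[symmetric])
  then have RL: "enat k \<le> L" if "k \<le> R" for k
    using that by (meson enat_ord_simps(1) order_trans)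
  interpret shuffling N T n S0 \<epsilon> r t x R
  proof
    show "\<epsilon> (Suc k) \<in> {1, - 1}" if "k < R" for k
      using assms(5)[of "Suc k"] RL[of "Suc k"] that by simp
  qed (use assms RL R_def in auto)
  have mc: "markov_chain Pr L (\<lambda>r. \<Omega> N T (S r)) (pmf_of_set (\<Omega> N T S0))
      (\<lambda>r. step N T (S r) (\<epsilon> (r + 1))) M"
    using assms(7) by (simp add: path_chain_def)
  interpret prob_space Pr using mc by (simp add: markov_chain_def)
  have fin: "finite (\<Omega> N T (S k))" if "k \<le> R" for k
    using finite_\<Omega>[of "S k" T N] S_bounds[OF that] by simp
  note event = markov_chain_event[OF mc \<open>enat R \<le> L\<close> fin, folded hist_wgt_def]
  \<comment> \<open>The total mass is read off from the given probability space instead of the row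
    sums of \<open>step\<close>.\<close>
  have "(\<Sum>G\<in>trajs (\<lambda>r. \<Omega> N T (S r)) R. hist_wgt G) = 1"
    using event[of "\<lambda>_. True"] prob_space by simp
  then have "(\<Sum>G\<in>trajs (\<lambda>r. \<Omega> N T (S r)) R. hist_wgt G * (\<Prod>i<n. hit G i)) = detf n K"
    by (rule sum_hist_wgt_det)
  moreover have "(\<Prod>i<n. hit G i) = (if \<forall>i<n. x i \<in> set (G ! r i ! t i) then 1 else 0)" for G
    by (auto simp: hit_def intro!: prod.neutral)
  ultimately have "measure Pr {\<omega>\<in>space Pr. \<forall>i<n. x i \<in> set (map (\<lambda>j. M j \<omega>) [0..<Suc R] ! r i ! t i)}
      = detf n K"
    using event[of "\<lambda>G. \<forall>i<n. x i \<in> set (G ! r i ! t i)"] by simp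
  moreover have "map (\<lambda>j. M j \<omega>) [0..<Suc R] ! r i = M (r i) \<omega>" if "i < n" for i \<omega>
    using r_le[OF that] by (simp del: upt_Suc)
  ultimately show ?thesis
    using assms(11,12) by (simp add: correlation_def configuration_def detf_def K_def cong: conj_cong)
qed

end
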